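(* Let $X$ be a finite set of points in $\mathbb{P}^1\times\mathbb{P}^1$ in sufficiently general position with $|X|>1$, and suppose that there exists $(i,j)\in\mathbb{N}^2$ with $i<j$ such that $|X|=(i+1)(j+1)$. Then there is a virtual resolution of $S/I_X$ of length two. Explicitly, write $|X|=(i+2)q+r$ with $q,r\in\mathbb{N}$ and $0\le r<i+2$. Then there is a virtual resolution of $S/I_X$ of the form $$0\to S(-i-1,-j-1)^{2i+2}\to S(-i,-j-1)^{i+1}\oplus S(-i-1,-q)^{i+2-r}\oplus S(-i-1,-q-1)^{r}\to S\to S/I_X\to 0,$$ where if $r=0$ the summand $S(-i-1,-q-1)^{0}$ does not appear.
   Context: $\mathbb{N}=\{0,1,2,\dots\}$. $\Bbbk$ is a field of characteristic $0$ and $S=\Bbbk[x_0,x_1,y_0,y_1]$ is the $\mathbb{Z}^2$-graded coordinate ring of $\mathbb{P}^1\times\mathbb{P}^1$, with $\deg x_i=(1,0)$, $\deg y_i=(0,1)$. $S(-a,-b)$ is the free module $S$ with generator in degree $(a,b)$; all maps are degree-preserving. $B=\langle x_0,x_1\rangle\cap\langle y_0,y_1\rangle$ is the irrelevant ideal. For an $S$-module $M$, $\Gamma_B(M)=\{m\in M: B^tm=0\text{ for some }t\in\mathbb{N}\}$. Virtual resolution: a complex $\mathcal{F}_\bullet=\cdots\to F_2\to F_1\to F_0$ of finitely generated free $S$-modules is a virtual resolution of a finitely generated $S$-module $M$ if (1) for each $i>0$ there is $t$ with $B^tH_i(\mathcal{F}_\bullet)=0$, and (2) $H_0(\mathcal{F}_\bullet)/\Gamma_B(H_0(\mathcal{F}_\bullet))\cong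 M/\Gamma_B(M)$. In the displayed form, $F_0=S$, and the tail "$\to S/I_X\to 0$" only indicates the module being virtually resolved (the displayed sequence need not be exact). Its length is the largest $i$ with $F_i\neq0$. Points: for $P=[a_0:a_1]\times[b_0:b_1]$, $I_P=\langle a_1x_0-a_0x_1,\ b_1y_0-b_0y_1\rangle$; for a finite set $X=\{P_1,\dots,P_s\}$ of distinct points, $I_X=I_{P_1}\cap\cdots\cap I_{P_s}$. The Hilbert function is $H_X(i,j)=\dim_\Bbbk (S/I_X)_{i,j}$ on $\mathbb{N}^2$. For a function $H$ on $\mathbb{N}^2$ (extended by $0$ when an argument is negative), $\Delta H(i,j)=H(i,j)-H(i-1,j)-H(i,j-1)+H(i-1,j-1)$, and $\Delta^2H_X=\Delta(\Delta H_X)=(d_{i,j})$. Let $\alpha_{i,j}$ be the number of minimal generators of $I_X$ of degree $(i,j)$. $X$ has the generic Hilbert function if $H_X(i,j)=\min\{|X|,(i+1)(j+1)\}$ for all $(i,j)\in\mathbb{N}^2$. Sufficiently general position: by a known theorem of Giuffrida, Maggioni and Ragusa, for every $s\ge1$ there is a dense open subset $U\subseteq(\mathbb{P}^1\times\mathbb{P}^1)^s$ such that for every $(P_1,\dots,P_s)\in U$ the set $X=\{P_1,\dots,P_s\}$ (of $s$ distinct points) satisfies: (1) $X$ has the generic Hilbert function; (2) whenever $d_{i,j}<0$ and either $d_{i,t}>0$ for some $t>j$ or $d_{t,j}>0$ for some $t>i$, one has $\alpha_{i,j}=-d_{i,j}$; and moreover every nonzero $\alpha_{i,j}$ arises as in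 (2). A set $X=\{P_1,\dots,P_s\}$ is in sufficiently general position if $(P_1,\dots,P_s)$ belongs to this open set $U$. *)

theory Defs
  imports
    "HOL-Analysis.Abstract_Topology"
    "HOL-Library.Poly_Mapping"
    "HOL-Algebra.Module"
    "HOL-Algebra.Ideal_Product"
begin

section \<open>The bigraded coordinate ring\<close>

datatype var = X0 | X1 | Y0 | Y1

type_synonym 'k bipoly = "(var \<Rightarrow>\<^sub>0 nat) \<Rightarrow>\<^sub>0 'k"

definition Const :: "'k::field \<Rightarrow> 'k bipoly" where
  "Const c = Poly_Mapping.single 0 c"

definition Var :: "var \<Rightarrow> 'k::field bipoly" where
  "Var v = Poly_Mapping.single (Poly_Mapping.single v 1) 1"

definition S_ring :: "'k::field bipoly ring" where
  "S_ring = \<lparr>carrier = UNIV, mult = (*), one = 1, zero = 0, add = (+)\<rparr>"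

definition bideg :: "(var \<Rightarrow>\<^sub>0 nat) \<Rightarrow> int \<times> int" where
  "bideg m = (int (Poly_Mapping.lookup m X0 + Poly_Mapping.lookup m X1), int (Poly_Mapping.lookup m Y0 + Poly_Mapping.lookup m Y1))"

definition S_comp :: "int \<times> int \<Rightarrow> 'k::field bipoly set" where
  "S_comp e = {p. \<forall>m\<in>Poly_Mapping.keys p. bideg m = e}"

definition irrelevant_ideal :: "'k::field bipoly set" where
  "irrelevant_ideal = Idl\<^bsub>S_ring\<^esub> {Var X0, Var X1} \<inter> Idl\<^bsub>S_ring\<^esub> {Var Y0, Var Y1}"

primrec irrelevant_power :: "nat \<Rightarrow> 'k::field bipoly set" where
  "irrelevant_power 0 = UNIV"
| "irrelevant_power (Suc t) = ideal_prod S_ring (irrelevant_power t) irrelevant_ideal"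

section \<open>Bigraded modules\<close>

record ('a, 'm) gmodule = "('a, 'm) module" +
  hcomp :: "int \<times> int \<Rightarrow> 'm set"

definition graded_module :: "('k::field bipoly, 'm) gmodule \<Rightarrow> bool" where
  "graded_module M \<longleftrightarrow>
     Module.module S_ring M \<and>
     (\<forall>e. subgroup (hcomp M e) (add_monoid M)) \<and>
     (\<forall>a b a' b'. \<forall>p\<in>S_comp (a, b). \<forall>x\<in>hcomp M (a', b').
        p \<odot>\<^bsub>M\<^esub> x \<in> hcomp M (a + a', b + b')) \<and>
     (\<forall>x\<in>carrier M. \<exists>!c. (\<forall>e. c e \<in> hcomp M e) \<and> finite {e. c e \<noteq> \<zero>\<^bsub>M\<^esub>} \<and>
        x = finsum M c {e. c e \<noteq> \<zero>\<^bsub>M\<^esub>})"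

definition fin_gen_module :: "('k::field bipoly, 'm) gmodule \<Rightarrow> bool" where
  "fin_gen_module M \<longleftrightarrow>
     (\<exists>A. finite A \<and> A \<subseteq> carrier M \<and>
       (\<forall>x\<in>carrier M. \<exists>c. x = finsum M (\<lambda>a. c a \<odot>\<^bsub>M\<^esub> a) A))"

definition graded_hom ::
  "('k::field bipoly, 'm) gmodule \<Rightarrow> ('k bipoly, 'n) gmodule \<Rightarrow> ('m \<Rightarrow> 'n) \<Rightarrow> bool" where
  "graded_hom M N f \<longleftrightarrow>
     f \<in> carrier M \<rightarrow> carrier N \<and>
     (\<forall>x\<in>carrier M. \<forall>y\<in>carrier M. f (x \<oplus>\<^bsub>M\<^esub> y) = f x \<oplus>\<^bsub>N\<^esub> f y) \<and>
     (\<forall>p. \<forall>x\<in>carrier M. f (p \<odot>\<^bsub>M\<^esub> x) = p \<odot>\<^bsub>N\<^esub> f x) \<and>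
     (\<forall>e. f ` hcomp M e \<subseteq> hcomp N e)"

text \<open>The inverse of a bijective graded homomorphism of graded modules is again graded.\<close>

definition graded_iso ::
  "('k::field bipoly, 'm) gmodule \<Rightarrow> ('k bipoly, 'n) gmodule \<Rightarrow> bool" where
  "graded_iso M N \<longleftrightarrow> (\<exists>f. graded_hom M N f \<and> bij_betw f (carrier M) (carrier N))"

definition sub_gmodule ::
  "('k::field bipoly, 'm) gmodule \<Rightarrow> 'm set \<Rightarrow> ('k bipoly, 'm) gmodule" where
  "sub_gmodule M N = M\<lparr>carrier := N, hcomp := \<lambda>e. hcomp M e \<inter> N\<rparr>"

text \<open>The fields \<^term>\<open>mult\<close> and \<^term>\<open>one\<close>, inherited from the ring record, play no role
  for modules.\<close>

definition quot_gmodule ::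
  "('k::field bipoly, 'm) gmodule \<Rightarrow> 'm set \<Rightarrow> ('k bipoly, 'm set) gmodule" where
  "quot_gmodule M N =
     \<lparr>carrier = a_rcosets\<^bsub>M\<^esub> N, mult = undefined, one = undefined,
      zero = N, add = set_add M,
      smult = (\<lambda>p C. \<Union>x\<in>C. N +>\<^bsub>M\<^esub> (p \<odot>\<^bsub>M\<^esub> x)),
      hcomp = (\<lambda>e. (\<lambda>x. N +>\<^bsub>M\<^esub> x) ` hcomp M e)\<rparr>"

definition S_gmodule :: "('k::field bipoly, 'k bipoly) gmodule" where
  "S_gmodule =
     \<lparr>carrier = UNIV, mult = (*), one = 1, zero = 0, add = (+), smult = (*), hcomp = S_comp\<rparr>"

text \<open>A list of bidegrees \<open>[(a\<^sub>0, b\<^sub>0), (a\<^sub>1, b\<^sub>1), \<dots>]\<close> stands for the graded free module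
  \<open>S(-a\<^sub>0, -b\<^sub>0) \<oplus> S(-a\<^sub>1, -b\<^sub>1) \<oplus> \<dots>\<close>, whose \<open>n\<close>-th basis element has degree \<open>(a\<^sub>n, b\<^sub>n)\<close>.\<close>

definition free_gmodule ::
  "(int \<times> int) list \<Rightarrow> ('k::field bipoly, nat \<Rightarrow> 'k bipoly) gmodule" where
  "free_gmodule ds =
     \<lparr>carrier = {v. \<forall>n\<ge>length ds. v n = 0}, mult = undefined, one = undefined,
      zero = (\<lambda>_. 0), add = (\<lambda>v w n. v n + w n),
      smult = (\<lambda>p v n. p * v n),
      hcomp = (\<lambda>e. {v. (\<forall>n\<ge>length ds. v n = 0) \<and>
        (\<forall>n<length ds. v n \<in> S_comp (fst e - fst (ds ! n), snd e - snd (ds ! n)))})\<rparr>"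

definition Gamma_B :: "('k::field bipoly, 'm) gmodule \<Rightarrow> 'm set" where
  "Gamma_B M =
     {x \<in> carrier M. \<exists>t. \<forall>b\<in>irrelevant_power t. b \<odot>\<^bsub>M\<^esub> x = \<zero>\<^bsub>M\<^esub>}"

section \<open>Virtual resolutions\<close>

text \<open>In a complex \<open>(F, \<delta>)\<close> the map \<open>\<delta> n\<close> goes from \<open>F\<^sub>n\<close> to \<open>F\<^sub>n\<^sub>-\<^sub>1\<close> for \<open>n > 0\<close>;
  \<open>\<delta> 0\<close> is not used.\<close>

definition free_complex ::
  "(nat \<Rightarrow> (int \<times> int) list) \<Rightarrow>
   (nat \<Rightarrow> (nat \<Rightarrow> 'k::field bipoly) \<Rightarrow> (nat \<Rightarrow> 'k bipoly)) \<Rightarrow> bool" where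
  "free_complex F \<delta> \<longleftrightarrow>
     (\<forall>n. graded_hom (free_gmodule (F (Suc n))) (free_gmodule (F n)) (\<delta> (Suc n))) \<and>
     (\<forall>n. \<forall>v\<in>carrier (free_gmodule (F (Suc (Suc n)))).
        \<delta> (Suc n) (\<delta> (Suc (Suc n)) v) = (\<lambda>_. 0))"

definition cycles ::
  "(nat \<Rightarrow> (int \<times> int) list) \<Rightarrow>
   (nat \<Rightarrow> (nat \<Rightarrow> 'k::field bipoly) \<Rightarrow> (nat \<Rightarrow> 'k bipoly)) \<Rightarrow> nat \<Rightarrow> (nat \<Rightarrow> 'k bipoly) set" where
  "cycles F \<delta> n = {v \<in> carrier (free_gmodule (F n)). n > 0 \<longrightarrow> \<delta> n v = (\<lambda>_. 0)}"

definition homology ::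
  "(nat \<Rightarrow> (int \<times> int) list) \<Rightarrow>
   (nat \<Rightarrow> (nat \<Rightarrow> 'k::field bipoly) \<Rightarrow> (nat \<Rightarrow> 'k bipoly)) \<Rightarrow> nat \<Rightarrow>
   ('k bipoly, (nat \<Rightarrow> 'k bipoly) set) gmodule" where
  "homology F \<delta> n =
     quot_gmodule (sub_gmodule (free_gmodule (F n)) (cycles F \<delta> n))
       (\<delta> (Suc n) ` carrier (free_gmodule (F (Suc n))))"

definition virtual_resolution ::
  "(nat \<Rightarrow> (int \<times> int) list) \<Rightarrow>
   (nat \<Rightarrow> (nat \<Rightarrow> 'k::field bipoly) \<Rightarrow> (nat \<Rightarrow> 'k bipoly)) \<Rightarrow>
   ('k bipoly, 'm) gmodule \<Rightarrow> bool" where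
  "virtual_resolution F \<delta> M \<longleftrightarrow>
     graded_module M \<and> fin_gen_module M \<and> free_complex F \<delta> \<and>
     (\<forall>n>0. \<exists>t. \<forall>b\<in>irrelevant_power t. \<forall>h\<in>carrier (homology F \<delta> n).
        b \<odot>\<^bsub>homology F \<delta> n\<^esub> h = \<zero>\<^bsub>homology F \<delta> n\<^esub>) \<and>
     graded_iso (quot_gmodule (homology F \<delta> 0) (Gamma_B (homology F \<delta> 0)))
       (quot_gmodule M (Gamma_B M))"

definition has_length :: "(nat \<Rightarrow> (int \<times> int) list) \<Rightarrow> nat \<Rightarrow> bool" where
  "has_length F l \<longleftrightarrow> F l \<noteq> [] \<and> (\<forall>n>l. F n = [])"

section \<open>Points\<close>

definition proj_rel :: "'k::field \<times> 'k \<Rightarrow> 'k \<times> 'k \<Rightarrow> bool" where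
  "proj_rel u v \<longleftrightarrow> u \<noteq> (0, 0) \<and> (\<exists>c. c \<noteq> 0 \<and> v = (c * fst u, c * snd u))"

lemma proj_rel_sym: "proj_rel u v \<Longrightarrow> proj_rel v (u :: 'k::field \<times> 'k)"
proof -
  assume "proj_rel u v"
  then obtain c where c: "u \<noteq> (0, 0)" "c \<noteq> 0" "v = (c * fst u, c * snd u)"
    by (auto simp: proj_rel_def)
  have "v \<noteq> (0, 0)" using c by (cases u) auto
  moreover have "u = (inverse c * fst v, inverse c * snd v)"
    using c by (cases u) (simp add: mult.assoc[symmetric])
  moreover have "inverse c \<noteq> 0" using c(2) by simp
  ultimately show "proj_rel v u"
    unfolding proj_rel_def by blast
qed

lemma proj_rel_trans: "proj_rel u v \<Longrightarrow> proj_rel v w \<Longrightarrow> proj_rel u (w :: 'k::field \<times> 'k)"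
proof -
  assume "proj_rel u v" "proj_rel v w"
  then obtain c d where "u \<noteq> (0, 0)" "c \<noteq> 0" "v = (c * fst u, c * snd u)"
    "d \<noteq> 0" "w = (d * fst v, d * snd v)"
    unfolding proj_rel_def by blast
  then show "proj_rel u w"
    unfolding proj_rel_def by (auto intro!: exI[of _ "d * c"] simp: mult.assoc)
qed

quotient_type (overloaded) 'k p1 = "'k::field \<times> 'k" / partial: proj_rel
proof (rule part_equivpI)
  show "\<exists>x :: 'k \<times> 'k. proj_rel x x"
    by (rule exI[of _ "(1, 0)"]) (auto simp: proj_rel_def intro: exI[of _ 1])
qed (auto intro: sympI transpI proj_rel_sym proj_rel_trans)

text \<open>\<open>coords (a\<^sub>0, a\<^sub>1) u\<close> says \<open>u = [a\<^sub>0 : a\<^sub>1]\<close>.\<close>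

lift_definition coords :: "'k::field \<times> 'k \<Rightarrow> 'k p1 \<Rightarrow> bool" is proj_rel
proof -
  fix v u w :: "'k \<times> 'k"
  assume "proj_rel u w"
  then show "proj_rel v u \<longleftrightarrow> proj_rel v w"
    using proj_rel_sym proj_rel_trans by blast
qed

type_synonym 'k point = "'k p1 \<times> 'k p1"

lemma S_ring_cring: "cring (S_ring :: 'k::field bipoly ring)"
proof (rule cringI)
  show "abelian_group (S_ring :: 'k bipoly ring)"
  proof (rule abelian_groupI)
    show "\<exists>y\<in>carrier S_ring. y \<oplus>\<^bsub>S_ring\<^esub> x = \<zero>\<^bsub>S_ring\<^esub>" for x :: "'k bipoly"
      by (auto simp: S_ring_def intro: exI[of _ "- x"])
  qed (auto simp: S_ring_def algebra_simps)
  show "Group.comm_monoid (S_ring :: 'k bipoly ring)"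
    by (rule comm_monoidI) (auto simp: S_ring_def algebra_simps)
qed (auto simp: S_ring_def algebra_simps)

lemma S_ideal_mult: "ideal I S_ring \<Longrightarrow> f \<in> I \<Longrightarrow> p * f \<in> (I :: 'k::field bipoly set)"
  using ideal.I_l_closed[of I S_ring f p] by (simp add: S_ring_def)

lemma Const_unit_mem:
  assumes "ideal I S_ring" "c \<noteq> (0 :: 'k::field)"
  shows "Const c * f \<in> I \<longleftrightarrow> f \<in> I"
proof
  assume "Const c * f \<in> I"
  from S_ideal_mult[OF assms(1) this, of "Const (inverse c)"]
  have "(Const (inverse c) * Const c) * f \<in> I" by (simp add: mult.assoc)
  moreover have "Const (inverse c) * Const c = 1"
    using assms(2) by (simp add: Const_def Poly_Mapping.mult_single)
  ultimately show "f \<in> I" by simp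
qed (rule S_ideal_mult[OF assms(1)])

definition linear_form :: "var \<Rightarrow> var \<Rightarrow> 'k::field \<times> 'k \<Rightarrow> 'k bipoly" where
  "linear_form v0 v1 a = Const (snd a) * Var v0 - Const (fst a) * Var v1"

lemma linear_form_mem:
  assumes "ideal I S_ring" "proj_rel a b"
  shows "linear_form v0 v1 b \<in> I \<longleftrightarrow> linear_form v0 v1 a \<in> I"
proof -
  from assms(2) obtain c where c: "c \<noteq> 0" "b = (c * fst a, c * snd a)"
    by (auto simp: proj_rel_def)
  have "Const (x * y) = Const x * Const y" for x y :: 'a
    by (simp add: Const_def Poly_Mapping.mult_single)
  then have "linear_form v0 v1 b = Const c * linear_form v0 v1 a"
    using c by (simp add: linear_form_def algebra_simps)
  then show ?thesis using Const_unit_mem[OF assms(1) c(1)] by simp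
qed

lift_definition point_ideal :: "'k::field p1 \<Rightarrow> 'k p1 \<Rightarrow> 'k bipoly set" is
  "\<lambda>a b. Idl\<^bsub>S_ring\<^esub> {linear_form X0 X1 a, linear_form Y0 Y1 b}"
proof -
  fix a a' b b' :: "'k \<times> 'k"
  assume "proj_rel a a'" "proj_rel b b'"
  then show "Idl\<^bsub>S_ring\<^esub> {linear_form X0 X1 a, linear_form Y0 Y1 b} =
      Idl\<^bsub>S_ring\<^esub> {linear_form X0 X1 a', linear_form Y0 Y1 b'}"
    unfolding genideal_def using linear_form_mem by (metis (no_types) empty_subsetI insert_subset)
qed

definition vanishing_ideal :: "'k::field point set \<Rightarrow> 'k bipoly set" where
  "vanishing_ideal X = (\<Inter>(u, v)\<in>X. point_ideal u v)"

definition coord_gmodule :: "'k::field point set \<Rightarrow> ('k bipoly, 'k bipoly set) gmodule" where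
  "coord_gmodule X = quot_gmodule S_gmodule (vanishing_ideal X)"

section \<open>Hilbert function and minimal generators\<close>

definition is_basis :: "('k::field bipoly, 'm) gmodule \<Rightarrow> 'm set \<Rightarrow> 'm set \<Rightarrow> bool" where
  "is_basis M V A \<longleftrightarrow> A \<subseteq> V \<and>
     (\<forall>v\<in>V. \<exists>!c :: 'm \<Rightarrow> 'k. (\<forall>a. a \<notin> A \<longrightarrow> c a = 0) \<and>
        v = finsum M (\<lambda>a. Const (c a) \<odot>\<^bsub>M\<^esub> a) A)"

text \<open>The dimension over the ground field of a finite-dimensional subspace \<open>V\<close> of \<open>M\<close>.\<close>

definition k_dim :: "('k::field bipoly, 'm) gmodule \<Rightarrow> 'm set \<Rightarrow> nat" where
  "k_dim M V = (THE n. \<exists>A. finite A \<and> card A = n \<and> is_basis M V A)"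

definition hilbert_function :: "'k::field point set \<Rightarrow> nat \<Rightarrow> nat \<Rightarrow> nat" where
  "hilbert_function X i j = k_dim (coord_gmodule X) (hcomp (coord_gmodule X) (int i, int j))"

definition generic_hilbert_function :: "'k::field point set \<Rightarrow> bool" where
  "generic_hilbert_function X \<longleftrightarrow>
     (\<forall>i j. hilbert_function X i j = min (card X) ((i + 1) * (j + 1)))"

definition diff2 :: "(nat \<Rightarrow> nat \<Rightarrow> int) \<Rightarrow> nat \<Rightarrow> nat \<Rightarrow> int" where
  "diff2 H i j = H i j - (if i = 0 then 0 else H (i - 1) j) - (if j = 0 then 0 else H i (j - 1))
     + (if i = 0 \<or> j = 0 then 0 else H (i - 1) (j - 1))"

definition second_diff :: "'k::field point set \<Rightarrow> nat \<Rightarrow> nat \<Rightarrow> int" where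
  "second_diff X = diff2 (diff2 (\<lambda>i j. int (hilbert_function X i j)))"

definition minimal_generators :: "'k::field bipoly set \<Rightarrow> 'k bipoly set \<Rightarrow> bool" where
  "minimal_generators I G \<longleftrightarrow> finite G \<and> G \<subseteq> (\<Union>e. S_comp e) \<and> Idl\<^bsub>S_ring\<^esub> G = I \<and>
     (\<forall>G'. G' \<subset> G \<longrightarrow> Idl\<^bsub>S_ring\<^esub> G' \<noteq> I)"

text \<open>By graded Nakayama, the number of generators of a given degree is the same for all minimal
  homogeneous generating sets.\<close>

definition num_min_generators :: "'k::field point set \<Rightarrow> nat \<Rightarrow> nat \<Rightarrow> nat" where
  "num_min_generators X i j =
     card ((SOME G. minimal_generators (vanishing_ideal X) G) \<inter> S_comp (int i, int j))"

section \<open>The Zariski topology on tuples of points\<close>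

text \<open>Points of \<open>(P\<^sup>1 \<times> P\<^sup>1)\<^sup>s\<close> are lists of length \<open>s\<close>; the variable \<open>(n, v)\<close> is the
  coordinate \<open>v\<close> of the \<open>n\<close>-th point.\<close>

definition poly_eval :: "('v \<Rightarrow> 'k) \<Rightarrow> (('v \<Rightarrow>\<^sub>0 nat) \<Rightarrow>\<^sub>0 'k::field) \<Rightarrow> 'k" where
  "poly_eval a f = (\<Sum>m\<in>Poly_Mapping.keys f. Poly_Mapping.lookup f m *
     (\<Prod>v\<in>Poly_Mapping.keys m. a v ^ Poly_Mapping.lookup m v))"

definition multihomogeneous :: "nat \<Rightarrow> ((nat \<times> var \<Rightarrow>\<^sub>0 nat) \<Rightarrow>\<^sub>0 'k::field) \<Rightarrow> bool" where
  "multihomogeneous s f \<longleftrightarrow>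
     (\<exists>dx dy :: nat \<Rightarrow> nat. \<forall>m\<in>Poly_Mapping.keys f.
        (\<forall>v\<in>Poly_Mapping.keys m. fst v < s) \<and>
        (\<forall>n<s. Poly_Mapping.lookup m (n, X0) + Poly_Mapping.lookup m (n, X1) = dx n \<and>
               Poly_Mapping.lookup m (n, Y0) + Poly_Mapping.lookup m (n, Y1) = dy n))"

definition tuple_coords :: "(nat \<times> var \<Rightarrow> 'k::field) \<Rightarrow> 'k point list \<Rightarrow> bool" where
  "tuple_coords a Ps \<longleftrightarrow>
     (\<forall>n<length Ps. coords (a (n, X0), a (n, X1)) (fst (Ps ! n)) \<and>
                    coords (a (n, Y0), a (n, Y1)) (snd (Ps ! n)))"

definition zariski_topology :: "nat \<Rightarrow> 'k::field point list topology" where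
  "zariski_topology s = topology_generated_by
     {{Ps. length Ps = s \<and> (\<forall>a. tuple_coords a Ps \<longrightarrow> poly_eval a f \<noteq> 0)} | f.
        multihomogeneous s f}"

section \<open>Sufficiently general position\<close>

definition generator_condition :: "'k::field point set \<Rightarrow> bool" where
  "generator_condition X \<longleftrightarrow>
     (let d = second_diff X; \<alpha> = num_min_generators X;
          R = (\<lambda>i j. d i j < 0 \<and> ((\<exists>t>j. d i t > 0) \<or> (\<exists>t>i. d t j > 0)))
      in (\<forall>i j. R i j \<longrightarrow> int (\<alpha> i j) = - d i j) \<and> (\<forall>i j. \<alpha> i j \<noteq> 0 \<longrightarrow> R i j))"

text \<open>The defining properties of the dense open set in the theorem of Giuffrida, Maggioni and
  Ragusa, which asserts that such a \<open>U\<close> exists for every \<open>s \<ge> 1\<close>. That theorem does not determine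
  \<open>U\<close>, so sufficiently general position is relative to a given \<open>U\<close>.\<close>

definition gmr_open_set :: "nat \<Rightarrow> 'k::field point list set \<Rightarrow> bool" where
  "gmr_open_set s U \<longleftrightarrow>
     openin (zariski_topology s) U \<and>
     zariski_topology s closure_of U = topspace (zariski_topology s) \<and>
     (\<forall>Ps\<in>U. distinct Ps \<and> generic_hilbert_function (set Ps) \<and> generator_condition (set Ps))"

definition sufficiently_general :: "'k::field point list set \<Rightarrow> 'k point set \<Rightarrow> bool" where
  "sufficiently_general U X \<longleftrightarrow> (\<exists>Ps\<in>U. X = set Ps)"

end

theory Submission
  imports Defs "HOL-Library.Product_Plus" "HOL-Library.Function_Algebras"
begin

text \<open>Write \<open>I\<close> for the ideal of \<open>X\<close>. Since \<open>|X| = (i + 1)(j + 1)\<close>, genericity forces the strips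
  \<open>A = I\<^bsub>(i,*)\<^esub>\<close> and \<open>A' = I\<^bsub>(i+1,*)\<^esub>\<close> to be free over \<open>k[y\<^sub>0, y\<^sub>1]\<close>: \<open>A\<close> on \<open>i + 1\<close> generators of
  \<open>y\<close>-degree \<open>j + 1\<close>, and \<open>A'\<close> on \<open>i + 2 - r\<close> generators of degree \<open>q\<close> and \<open>r\<close> of degree \<open>q + 1\<close>.
  The complex is
  \<open>S(-i-1) \<otimes> (k x\<^sub>0 \<oplus> k x\<^sub>1) \<otimes> A \<rightarrow> S(-i) \<otimes> A \<oplus> S(-i-1) \<otimes> A' \<rightarrow> S\<close>, the relations being
  \<open>x\<^sub>l [a] = [x\<^sub>l a]\<close>.

  Both the freeness and the exactness come from one argument, used once in \<open>y\<close> and once in \<open>x\<close>: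
  if \<open>v f + w g = 0\<close> for the two coordinates \<open>v, w\<close> of one factor, then \<open>f = w h\<close> and \<open>g = - v h\<close>,
  and \<open>h\<close> vanishes on \<open>X\<close> because \<open>f\<close> and \<open>g\<close> do; and if \<open>f = v g + w h\<close> vanishes on \<open>X\<close> then \<open>g\<close> and
  \<open>h\<close> can be corrected to vanish on \<open>X\<close> as soon as forms of bidegree lower by two can be
  prescribed on \<open>X\<close>. So the complex is exact in bidegrees with \<open>y\<close>-degree at least \<open>j\<close>, its left
  map is injective, and \<open>B\<^sup>j I\<close> lies in the ideal of the generators.\<close>

section \<open>Bihomogeneous polynomials\<close>

text \<open>Genericity enters through the two extreme values of the Hilbert function: where it is
  |X|, forms take arbitrary values on X; where it is the dimension of the space of forms, no nonzero
  form vanishes on X. At (i, j) both hold, so strip i starts in y-degree j + 1, with (i+1)(j+2) -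
  |X| = i + 1 forms. In strip i + 1 the switch occurs between y-degrees q - 1 and q; hence i + 2 - r
  forms in degree q and r new generators in degree q + 1. Both moves, splitting a form and splitting
  a syzygy, use information two degrees lower: values to be prescribed on X, or a form to be
  expressed by the generators. So every induction starts from two consecutive degrees. In the
  x-direction these are the strips i and i + 1, which is why two strips determine the complex.
  Independent conditions on strip i begin at y-degree j; below it no exactness is claimed, and a
  power of B bridges the gap. As i < j, the power B^j also lifts x-degrees up to i.\<close>

abbreviation "lookup \<equiv> Poly_Mapping.lookup"
abbreviation "keys \<equiv> Poly_Mapping.keys"
abbreviation "single \<equiv> Poly_Mapping.single"

lemma poly_mapping_sum_single: "p = (\<Sum>m\<in>keys p. single m (lookup p m))"
  by (rule poly_mapping_eqI) (auto simp: lookup_sum lookup_single when_def in_keys_iff)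

lemma lookup_single_mult:
  fixes p :: "('v \<Rightarrow>\<^sub>0 nat) \<Rightarrow>\<^sub>0 'k::comm_ring_1"
  shows "lookup (single a c * p) m =
    (if \<forall>v. lookup a v \<le> lookup m v then c * lookup p (m - a) else 0)"
proof -
  have "lookup (single a c * p) m = lookup (single a c * (\<Sum>k\<in>keys p. single k (lookup p k))) m"
    by (simp flip: poly_mapping_sum_single)
  also have "\<dots> = (\<Sum>k\<in>keys p. (c * lookup p k when a + k = m))"
    by (simp add: sum_distrib_left lookup_sum mult_single lookup_single)
  also have "\<dots> = (if \<forall>v. lookup a v \<le> lookup m v then c * lookup p (m - a) else 0)"
  proof (cases "\<forall>v. lookup a v \<le> lookup m v")
    case True
    then have "a + k = m \<longleftrightarrow> k = m - a" for k
      unfolding poly_mapping_eq_iff fun_eq_iff lookup_add lookup_minus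
      by (metis diff_add_inverse le_add_diff_inverse)
    then have "(\<Sum>k\<in>keys p. (c * lookup p k when a + k = m)) =
        (\<Sum>k\<in>keys p. if k = m - a then c * lookup p k else 0)"
      by (simp add: when_def)
    also have "\<dots> = c * lookup p (m - a)"
      by (auto simp: sum.delta in_keys_iff)
    finally show ?thesis using True by simp
  next
    case False
    then have "a + k \<noteq> m" for k by (auto simp: lookup_add)
    then show ?thesis using False by (simp only: when_def) simp
  qed
  finally show ?thesis .
qed

section \<open>Bidegrees and spaces of forms\<close>

lemma bideg_add [simp]: "bideg (m + m') = bideg m + bideg m'"
  by (simp add: bideg_def lookup_add)

lemma bideg_0 [simp]: "bideg 0 = 0"
  by (simp add: bideg_def zero_prod_def)

definition var_deg :: "var \<Rightarrow> int \<times> int" where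
  "var_deg v = bideg (single v 1)"

lemma var_deg_simps [simp]:
  "var_deg X0 = (1, 0)" "var_deg X1 = (1, 0)" "var_deg Y0 = (0, 1)" "var_deg Y1 = (0, 1)"
  by (simp_all add: var_deg_def bideg_def lookup_single)

lemma S_comp_0 [simp]: "0 \<in> S_comp e"
  by (simp add: S_comp_def)

lemma S_comp_lookup: "p \<in> S_comp e \<longleftrightarrow> (\<forall>m. lookup p m \<noteq> 0 \<longrightarrow> bideg m = e)"
  by (auto simp: S_comp_def in_keys_iff)

lemma S_comp_add: "p \<in> S_comp e \<Longrightarrow> q \<in> S_comp e \<Longrightarrow> p + q \<in> S_comp e"
  unfolding S_comp_lookup by (metis add.right_neutral lookup_add)

lemma S_comp_uminus: "p \<in> S_comp e \<Longrightarrow> - p \<in> S_comp e"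
  unfolding S_comp_lookup by simp

lemma S_comp_diff: "p \<in> S_comp e \<Longrightarrow> q \<in> S_comp e \<Longrightarrow> p - q \<in> S_comp e"
  unfolding S_comp_lookup by (metis diff_zero lookup_minus)

lemma S_comp_sum: "(\<And>x. x \<in> A \<Longrightarrow> f x \<in> S_comp e) \<Longrightarrow> sum f A \<in> S_comp e"
  by (induction A rule: infinite_finite_induct) (auto intro: S_comp_add)

lemma S_comp_mult: "p \<in> S_comp d \<Longrightarrow> q \<in> S_comp e \<Longrightarrow> p * q \<in> S_comp (d + e)"
  using keys_mult[of p q] by (fastforce simp: S_comp_def)

lemma Const_S_comp [simp]: "Const c \<in> S_comp 0"
  by (simp add: S_comp_def Const_def)

lemma Const_mult_S_comp: "p \<in> S_comp e \<Longrightarrow> Const c * p \<in> S_comp e"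
  using S_comp_mult[OF Const_S_comp] by fastforce

lemma Var_S_comp [simp]: "Var v \<in> S_comp (var_deg v)"
  by (simp add: S_comp_def Var_def var_deg_def)

lemma Var_mult_S_comp: "p \<in> S_comp (e - var_deg v) \<Longrightarrow> Var v * p \<in> S_comp e"
  using S_comp_mult[OF Var_S_comp, of p "e - var_deg v" v] by simp

text \<open>Bidegrees are integers, so differences of degrees are always defined; a coefficient that
  would need a negative degree vanishes by this lemma.\<close>

lemma S_comp_neg: "p \<in> S_comp e \<Longrightarrow> fst e < 0 \<or> snd e < 0 \<Longrightarrow> p = 0"
  by (rule poly_mapping_eqI) (force simp: S_comp_lookup bideg_def)

lemma Const_simps [simp]: "Const 0 = 0" "Const 1 = 1"
  by (simp_all add: Const_def)

lemma Const_add: "Const (a + b) = Const a + Const b"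
  by (simp add: Const_def single_add)

lemma Const_mult: "Const (a * b) = Const a * Const b"
  by (simp add: Const_def mult_single)

lemma Const_power: "Const (a ^ n) = Const a ^ n"
  by (induction n) (simp_all add: Const_mult)

lemma Const_sum: "Const (sum f A) = (\<Sum>x\<in>A. Const (f x))"
  by (induction A rule: infinite_finite_induct) (simp_all add: Const_add)

lemma lookup_Const_mult [simp]: "lookup (Const c * p) m = c * lookup p m"
  by (simp add: Const_def lookup_single_mult)

lemma lookup_Var_mult:
  "lookup (Var v * p) m = (if lookup m v > 0 then lookup p (m - single v 1) else 0)"
  unfolding Var_def by (subst lookup_single_mult) (auto simp: lookup_single when_def Suc_le_eq)

lemma S_comp_00: "p \<in> S_comp (0, 0) \<Longrightarrow> \<exists>c. p = Const c"
proof (rule exI[of _ "lookup p 0"], rule poly_mapping_eqI)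
  fix m assume p: "p \<in> S_comp (0, 0)"
  show "lookup p m = lookup (Const (lookup p 0)) m"
  proof (cases "m = 0")
    case False
    have "bideg m \<noteq> (0, 0)"
    proof
      assume "bideg m = (0, 0)"
      then have "lookup m v = 0" for v by (cases v) (auto simp: bideg_def)
      then have "m = 0" by (intro poly_mapping_eqI) simp
      with False show False by simp
    qed
    then show ?thesis using p False by (auto simp: S_comp_lookup Const_def lookup_single when_def)
  qed (simp add: Const_def)
qed

section \<open>Homogeneous parts\<close>

definition hpart :: "int \<times> int \<Rightarrow> 'k::field bipoly \<Rightarrow> 'k bipoly" where
  "hpart e p = Poly_Mapping.mapp (\<lambda>m c. if bideg m = e then c else 0) p"

lemma lookup_hpart: "lookup (hpart e p) m = (if bideg m = e then lookup p m else 0)"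
  by (simp add: hpart_def lookup_mapp when_def in_keys_iff)

lemma hpart_S_comp [simp]: "hpart e p \<in> S_comp e"
  by (simp add: S_comp_lookup lookup_hpart)

lemma hpart_0 [simp]: "hpart e 0 = 0"
  by (rule poly_mapping_eqI) (simp add: lookup_hpart)

lemma hpart_add: "hpart e (p + q) = hpart e p + hpart e q"
  by (rule poly_mapping_eqI) (simp only: lookup_hpart lookup_add split: if_split, simp)

lemma hpart_sum: "hpart e (sum f A) = (\<Sum>x\<in>A. hpart e (f x))"
  by (induction A rule: infinite_finite_induct) (simp_all add: hpart_add)

lemma hpart_diff: "hpart e (p - q) = hpart e p - hpart e q"
  by (rule poly_mapping_eqI) (simp add: lookup_hpart lookup_minus)

lemma hpart_of_S_comp: "p \<in> S_comp d \<Longrightarrow> hpart e p = (if e = d then p else 0)"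
  by (rule poly_mapping_eqI) (auto simp: lookup_hpart S_comp_lookup)

lemma hpart_outside: "e \<notin> bideg ` keys p \<Longrightarrow> hpart e p = 0"
  by (rule poly_mapping_eqI) (auto simp: lookup_hpart in_keys_iff)

lemma sum_hpart: "finite E \<Longrightarrow> bideg ` keys p \<subseteq> E \<Longrightarrow> (\<Sum>e\<in>E. hpart e p) = p"
proof (rule poly_mapping_eqI)
  fix m assume E: "finite E" "bideg ` keys p \<subseteq> E"
  have "lookup (\<Sum>e\<in>E. hpart e p) m = (\<Sum>e\<in>E. if bideg m = e then lookup p m else 0)"
    by (simp add: lookup_sum lookup_hpart)
  also have "\<dots> = (if bideg m \<in> E then lookup p m else 0)"
    using E(1) by (rule sum.delta')
  also have "\<dots> = lookup p m"
    using E(2) by (auto simp: image_subset_iff in_keys_iff)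
  finally show "lookup (\<Sum>e\<in>E. hpart e p) m = lookup p m" .
qed

lemma hpart_mult: 
  assumes "q \<in> S_comp d"
  shows "hpart e (p * q) = hpart (e - d) p * q"
proof -
  let ?E = "insert (e - d) (bideg ` keys p)"
  have "hpart e (p * q) = hpart e ((\<Sum>e'\<in>?E. hpart e' p) * q)"
    by (subst sum_hpart) auto
  also have "\<dots> = (\<Sum>e'\<in>?E. hpart e (hpart e' p * q))"
    by (simp only: sum_distrib_right hpart_sum)
  also have "\<dots> = (\<Sum>e'\<in>?E. if e - d = e' then hpart e' p * q else 0)"
    by (simp only: hpart_of_S_comp[OF S_comp_mult[OF hpart_S_comp assms]] diff_eq_eq)
  also have "\<dots> = hpart (e - d) p * q"
    by (subst sum.delta') simp_all
  finally show ?thesis .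
qed

lemma eq_0_if_hparts: "(\<And>e. hpart e p = 0) \<Longrightarrow> p = 0"
  using sum_hpart[of "bideg ` keys p" p] by simp

text \<open>The quotient in the division by a variable: multiples of \<open>Var v\<close> are
  divided, all other monomials dropped. It is total, and so can serve as a witness before
  divisibility is known.\<close>

definition var_quot :: "var \<Rightarrow> 'k::field bipoly \<Rightarrow> 'k bipoly" where
  "var_quot v p = Poly_Mapping.map_key (\<lambda>m. m + single v 1) p"

lemma lookup_var_quot [simp]: "lookup (var_quot v p) m = lookup p (m + single v 1)"
  unfolding var_quot_def by (subst map_key.rep_eq) (auto simp: inj_on_def)

lemma var_quot_S_comp: "p \<in> S_comp e \<Longrightarrow> var_quot v p \<in> S_comp (e - var_deg v)"
  by (auto simp: S_comp_lookup var_deg_def)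

lemma Var_mult_var_quot:
  "lookup (Var v * var_quot v p) m = (if lookup m v > 0 then lookup p m else 0)"
proof -
  have "m - single v 1 + single v 1 = m" if "lookup m v > 0"
    by (rule poly_mapping_eqI) (use that in \<open>auto simp: lookup_add lookup_minus lookup_single when_def\<close>)
  then show ?thesis by (simp add: lookup_Var_mult)
qed

lemma Var_mult_cancel: "Var v * p = Var v * q \<Longrightarrow> p = (q :: 'k::field bipoly)"
proof (rule poly_mapping_eqI)
  fix m assume "Var v * p = Var v * q"
  then have "lookup (Var v * p) (m + single v 1) = lookup (Var v * q) (m + single v 1)" by simp
  then show "lookup p m = lookup q m" by (simp add: lookup_Var_mult lookup_add)
qed

lemma Var_mult_eq_0: "Var v * p = 0 \<Longrightarrow> p = (0 :: 'k::field bipoly)"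
  using Var_mult_cancel[of v p 0] by simp

lemma var_quot_Var_mult [simp]: "var_quot v (Var v * p) = p"
  by (rule poly_mapping_eqI) (simp add: lookup_Var_mult lookup_add)

text \<open>Two distinct variables form a regular sequence. A monomial of \<open>f\<close> without
  \<open>w\<close> would reappear in \<open>Var v * f\<close>, still without \<open>w\<close>,
  whereas \<open>Var w * g\<close> has none; so \<open>Var w\<close> divides \<open>f\<close>, and
  cancelling it in the relation determines \<open>g\<close>.\<close>

lemma koszul:
  fixes f g :: "'k::field bipoly"
  assumes v: "v \<noteq> w" and eq: "Var v * f + Var w * g = 0"
  shows "f = Var w * var_quot w f \<and> g = - (Var v * var_quot w f)"
proof
  show f: "f = Var w * var_quot w f"
  proof (rule poly_mapping_eqI)
    fix m
    have "lookup f m = 0" if "lookup m w = 0"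
    proof -
      have "lookup f m = lookup (Var v * f) (m + single v 1)"
        by (simp add: lookup_Var_mult lookup_add)
      also have "Var v * f = - (Var w * g)"
        using eq by (simp add: eq_neg_iff_add_eq_0)
      finally show ?thesis
        using that v by (simp add: lookup_Var_mult lookup_add lookup_single)
    qed
    then show "lookup f m = lookup (Var w * var_quot w f) m"
      by (auto simp: Var_mult_var_quot)
  qed
  have "Var w * (Var v * var_quot w f + g) = Var v * (Var w * var_quot w f) + Var w * g"
    by (simp add: algebra_simps)
  also have "\<dots> = 0" using eq by (simp flip: f)
  finally show "g = - (Var v * var_quot w f)"
    using Var_mult_eq_0 eq_neg_iff_add_eq_0 by (metis add.commute)
qed

text \<open>Lets each later argument be stated once for \<open>v\<close>, \<open>w\<close>,
  \<open>d\<close> and be used for either projective line.\<close>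

inductive same_factor :: "var \<Rightarrow> var \<Rightarrow> int \<times> int \<Rightarrow> bool" where
  "same_factor X0 X1 (1, 0)"
| "same_factor Y0 Y1 (0, 1)"

lemma same_factorD: "same_factor v w d \<Longrightarrow> v \<noteq> w \<and> var_deg v = d \<and> var_deg w = d"
  by (auto elim: same_factor.cases)

text \<open>The inner product with \<open>d\<close> is the degree in the chosen factor. If it is not
  0, every monomial of \<open>p\<close> contains \<open>v\<close> or \<open>w\<close>:
  \<open>Var v\<close> takes all it divides, and what remains is divisible by
  \<open>Var w\<close>.\<close>

lemma split_vars:
  fixes p :: "'k::field bipoly"
  assumes "same_factor v w d" and p: "p \<in> S_comp e"
    and "fst d * fst e + snd d * snd e \<noteq> 0"
  obtains f g where "f \<in> S_comp (e - d)" "g \<in> S_comp (e - d)" "p = Var v * f + Var w * g"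
proof
  define g where "g = p - Var v * var_quot v p"
  show "var_quot v p \<in> S_comp (e - d)"
    using var_quot_S_comp[OF p] same_factorD[OF assms(1)] by metis
  have "g \<in> S_comp e"
    unfolding g_def using same_factorD[OF assms(1)]
    by (intro S_comp_diff p Var_mult_S_comp var_quot_S_comp)
  from var_quot_S_comp[OF this, of w] show "var_quot w g \<in> S_comp (e - d)"
    using same_factorD[OF assms(1)] by metis
  have "g = Var w * var_quot w g"
  proof (rule poly_mapping_eqI)
    fix m
    have g: "lookup g m = (if lookup m v > 0 then 0 else lookup p m)"
      by (simp only: g_def lookup_minus Var_mult_var_quot) simp
    have "lookup g m = 0" if m: "lookup m w = 0"
    proof (rule ccontr)
      assume "lookup g m \<noteq> 0"
      then have "lookup m v = 0" "lookup p m \<noteq> 0" by (auto simp: g split: if_splits)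
      with p have "bideg m = e" by (simp add: S_comp_lookup)
      with assms(1,3) m \<open>lookup m v = 0\<close> show False
        by (cases rule: same_factor.cases) (force simp: bideg_def)+
    qed
    then show "lookup g m = lookup (Var w * var_quot w g) m"
      by (auto simp: Var_mult_var_quot)
  qed
  then show "p = Var v * var_quot v p + Var w * var_quot w g"
    by (simp add: g_def)
qed

section \<open>Evaluation at coordinates\<close>

definition mon_eval :: "(var \<Rightarrow> 'k::field) \<Rightarrow> (var \<Rightarrow>\<^sub>0 nat) \<Rightarrow> 'k" where
  "mon_eval a m = a X0 ^ lookup m X0 * a X1 ^ lookup m X1 * a Y0 ^ lookup m Y0 * a Y1 ^ lookup m Y1"

definition eval_at :: "(var \<Rightarrow> 'k::field) \<Rightarrow> 'k bipoly \<Rightarrow> 'k" where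
  "eval_at a p = (\<Sum>m\<in>keys p. lookup p m * mon_eval a m)"

lemma mon_eval_add: "mon_eval a (m + m') = mon_eval a m * mon_eval a m'"
  by (simp add: mon_eval_def lookup_add power_add)

lemma mon_eval_0 [simp]: "mon_eval a 0 = 1"
  by (simp add: mon_eval_def)

lemma mon_eval_single [simp]: "mon_eval a (single v 1) = a v"
  by (cases v) (simp_all add: mon_eval_def lookup_single)

lemma eval_at_superset: "finite K \<Longrightarrow> keys p \<subseteq> K \<Longrightarrow> eval_at a p = (\<Sum>m\<in>K. lookup p m * mon_eval a m)"
  unfolding eval_at_def by (rule sum.mono_neutral_left) (auto simp: in_keys_iff)

lemma eval_at_add: "eval_at a (p + q) = eval_at a p + eval_at a q"
proof -
  let ?K = "keys p \<union> keys q"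
  have "keys (p + q) \<subseteq> ?K" by (rule Poly_Mapping.keys_add)
  then have "eval_at a (p + q) = (\<Sum>m\<in>?K. lookup (p + q) m * mon_eval a m)"
    by (intro eval_at_superset) auto
  also have "\<dots> = (\<Sum>m\<in>?K. lookup p m * mon_eval a m) + (\<Sum>m\<in>?K. lookup q m * mon_eval a m)"
    by (simp add: lookup_add distrib_right sum.distrib)
  also have "\<dots> = eval_at a p + eval_at a q"
    by (intro arg_cong2[where f = "(+)"] eval_at_superset[symmetric]) auto
  finally show ?thesis .
qed

lemma eval_at_0 [simp]: "eval_at a 0 = 0"
  by (simp add: eval_at_def)

lemma eval_at_single [simp]: "eval_at a (single m c) = c * mon_eval a m"
  by (simp add: eval_at_def)

lemma eval_at_sum: "eval_at a (sum f A) = (\<Sum>x\<in>A. eval_at a (f x))"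
  by (induction A rule: infinite_finite_induct) (simp_all add: eval_at_add)

lemma eval_at_mult: "eval_at a (p * q) = eval_at a p * eval_at a q"
proof -
  have s: "eval_at a (single k c * q) = c * mon_eval a k * eval_at a q" for k c
  proof -
    have "eval_at a (single k c * q) = eval_at a (single k c * (\<Sum>m\<in>keys q. single m (lookup q m)))"
      by (simp flip: poly_mapping_sum_single)
    also have "\<dots> = c * mon_eval a k * (\<Sum>m\<in>keys q. lookup q m * mon_eval a m)"
      by (simp add: sum_distrib_left eval_at_sum mult_single mon_eval_add mult_ac)
    finally show ?thesis by (simp add: eval_at_def)
  qed
  have "eval_at a (p * q) = eval_at a ((\<Sum>m\<in>keys p. single m (lookup p m)) * q)"
    by (simp flip: poly_mapping_sum_single)
  also have "\<dots> = (\<Sum>m\<in>keys p. lookup p m * mon_eval a m * eval_at a q)"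
    by (simp add: sum_distrib_right eval_at_sum s)
  finally show ?thesis by (simp add: eval_at_def sum_distrib_right)
qed

lemma eval_at_Const [simp]: "eval_at a (Const c) = c"
  by (simp add: Const_def)

lemma eval_at_Var [simp]: "eval_at a (Var v) = a v"
  using eval_at_single[of a "single v 1" 1] by (simp only: Var_def mon_eval_single mult_1)

lemma eval_at_uminus: "eval_at a (- p) = - eval_at a p"
  using eval_at_add[of a p "- p"] by (simp add: eq_neg_iff_add_eq_0 add.commute)

lemma eval_at_diff: "eval_at a (p - q) = eval_at a p - eval_at a q"
  using eval_at_add[of a p "- q"] by (simp add: eval_at_uminus)

section \<open>Forms vanishing at a set of points\<close>

text \<open>Points enter only through chosen homogeneous coordinates. Another choice changes the
  values of a form by nonzero factors, one for each point, which affects neither vanishing nor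
  independence of conditions.\<close>

locale points =
  fixes X :: "'p set" and c :: "'p \<Rightarrow> var \<Rightarrow> 'k::field"
  assumes finite_X: "finite X"
    and nonzero: "P \<in> X \<Longrightarrow> same_factor v w d \<Longrightarrow> c P v \<noteq> 0 \<or> c P w \<noteq> 0"
begin

definition van :: "int \<times> int \<Rightarrow> 'k bipoly set" where
  "van e = {f \<in> S_comp e. \<forall>P\<in>X. eval_at (c P) f = 0}"

text \<open>Surjectivity of evaluation from the forms of bidegree \<open>e\<close> onto the
  functions on \<open>X\<close>; in terms of the Hilbert function, its value there is
  \<open>card X\<close>.\<close>

definition imposes_independent :: "int \<times> int \<Rightarrow> bool" where
  "imposes_independent e \<longleftrightarrow> (\<forall>h. \<exists>f\<in>S_comp e. \<forall>P\<in>X. eval_at (c P) f = h P)"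

lemma van_S_comp: "f \<in> van e \<Longrightarrow> f \<in> S_comp e"
  by (simp add: van_def)

lemma van_0 [simp]: "0 \<in> van e"
  by (simp add: van_def)

lemma van_add: "f \<in> van e \<Longrightarrow> g \<in> van e \<Longrightarrow> f + g \<in> van e"
  by (simp add: van_def S_comp_add eval_at_add)

lemma van_uminus: "f \<in> van e \<Longrightarrow> - f \<in> van e"
  by (simp add: van_def S_comp_uminus eval_at_uminus)

lemma van_mult: "p \<in> S_comp d \<Longrightarrow> f \<in> van e \<Longrightarrow> p * f \<in> van (d + e)"
  by (simp add: van_def S_comp_mult eval_at_mult)

lemma van_mult': "p \<in> S_comp (d - e) \<Longrightarrow> f \<in> van e \<Longrightarrow> p * f \<in> van d"
  using van_mult[of p "d - e" f e] by simp

lemma van_sum: "(\<And>x. x \<in> A \<Longrightarrow> f x \<in> van e) \<Longrightarrow> sum f A \<in> van e"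
  by (induction A rule: infinite_finite_induct) (auto intro: van_add)

lemma van_Const: "f \<in> van e \<Longrightarrow> Const a * f \<in> van e"
  by (simp add: van_def Const_mult_S_comp eval_at_mult)

lemma van_Var_mult: "f \<in> van (e - var_deg v) \<Longrightarrow> Var v * f \<in> van e"
  using van_mult[OF Var_S_comp, of f "e - var_deg v" v] by simp

text \<open>At each point one of the two coordinates is nonzero and can be cancelled; this makes the
  Koszul quotient vanish on \<open>X\<close> again.\<close>

lemma van_cancel:
  assumes "same_factor v w d" "Var v * f \<in> van e" "Var w * f \<in> van e" "f \<in> S_comp (e - d)"
  shows "f \<in> van (e - d)"
  using assms nonzero[OF _ assms(1)] by (auto simp: van_def eval_at_mult)

text \<open>Separating forms suffice: the one of \<open>P\<close> is multiplied by a coordinate that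
  is nonzero at \<open>P\<close>, and a scalar compensates for the value of that coordinate.\<close>

lemma independent_mono:
  assumes vw: "same_factor v w d" and e: "imposes_independent e"
  shows "imposes_independent (e + d)"
  unfolding imposes_independent_def
proof
  fix h :: "'p \<Rightarrow> 'k"
  have "\<exists>f\<in>S_comp e. \<forall>Q\<in>X. eval_at (c Q) f = (if Q = P then 1 else 0)" for P
    using e by (auto simp: imposes_independent_def)
  then obtain s where s: "s P \<in> S_comp e" "\<And>Q. Q \<in> X \<Longrightarrow> eval_at (c Q) (s P) = (if Q = P then 1 else 0)" for P
    by metis
  define z where "z P = (if c P v \<noteq> 0 then v else w)" for P
  have z: "c P (z P) \<noteq> 0" if "P \<in> X" for P
    using nonzero[OF that vw] by (simp add: z_def)
  have zd: "var_deg (z P) = d" for P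
    using same_factorD[OF vw] by (simp add: z_def)
  let ?f = "\<Sum>P\<in>X. Const (h P / c P (z P)) * (Var (z P) * s P)"
  have "?f \<in> S_comp (e + d)"
    by (intro S_comp_sum Const_mult_S_comp Var_mult_S_comp) (simp add: zd s)
  moreover have "eval_at (c Q) ?f = h Q" if "Q \<in> X" for Q
  proof -
    have "eval_at (c Q) ?f = (\<Sum>P\<in>X. if Q = P then h P / c P (z P) * c P (z P) else 0)"
      by (simp add: eval_at_sum eval_at_mult s that) (rule sum.cong, auto)
    also have "\<dots> = h Q"
      using that z[OF that] finite_X by simp
    finally show ?thesis .
  qed
  ultimately show "\<exists>f\<in>S_comp (e + d). \<forall>P\<in>X. eval_at (c P) f = h P" by blast
qed

lemma independent_mono_pow:
  assumes "same_factor v w d" "imposes_independent e"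
  shows "imposes_independent (e + (int n * fst d, int n * snd d))"
proof (induction n)
  case 0
  then show ?case using assms(2) by (simp flip: zero_prod_def)
next
  case (Suc n)
  have "e + (int (Suc n) * fst d, int (Suc n) * snd d) = e + (int n * fst d, int n * snd d) + d"
    by (cases e; cases d) (simp add: algebra_simps)
  then show ?case using independent_mono[OF assms(1) Suc] by (simp only:)
qed

lemma independent_mono_le:
  assumes "imposes_independent (a, b)" "a \<le> a'" "b \<le> b'"
  shows "imposes_independent (a', b')"
proof -
  have "imposes_independent (a + int n, b)" for n
    using independent_mono_pow[OF same_factor.intros(1) assms(1), of n] by simp
  from this[of "nat (a' - a)"] have "imposes_independent (a', b)" using assms(2) by simp
  from independent_mono_pow[OF same_factor.intros(2) this, of "nat (b' - b)"]
  show ?thesis using assms(3) by simp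
qed

lemma koszul_van:
  assumes vw: "same_factor v w d" and f: "f \<in> van e" and g: "g \<in> van e"
    and eq: "Var v * f + Var w * g = 0"
  obtains h where "h \<in> van (e - d)" "f = Var w * h" "g = - (Var v * h)"
proof
  note sf = same_factorD[OF vw]
  show 1: "f = Var w * var_quot w f" "g = - (Var v * var_quot w f)"
    using koszul[OF _ eq] sf by blast+
  have "var_quot w f \<in> S_comp (e - d)"
    using var_quot_S_comp[OF van_S_comp[OF f], of w] sf by simp
  moreover have "Var w * var_quot w f \<in> van e" "Var v * var_quot w f \<in> van e"
    using f 1(1) van_uminus[OF g] 1(2) by simp_all
  ultimately show "var_quot w f \<in> van (e - d)"
    using van_cancel[OF vw] by blast
qed

lemma van_split:
  assumes vw: "same_factor v w d" and f: "f \<in> van e"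
    and e: "fst d * fst e + snd d * snd e \<noteq> 0" and ind: "imposes_independent (e - d - d)"
  obtains g h where "g \<in> van (e - d)" "h \<in> van (e - d)" "f = Var v * g + Var w * h"
proof -
  note sf = same_factorD[OF vw]
  obtain g h where gh: "g \<in> S_comp (e - d)" "h \<in> S_comp (e - d)" "f = Var v * g + Var w * h"
    using split_vars[OF vw van_S_comp[OF f] e] .
  \<comment> \<open>At a point \<open>v g + w h = 0\<close>, so one value of \<open>s\<close> makes
    both \<open>g + w s\<close> and \<open>h - v s\<close> vanish: \<open>- g / w\<close> if
    \<open>w\<close> is nonzero there, and otherwise \<open>h / v\<close>, in which case
    \<open>g\<close> is already 0.\<close>
  obtain s where s: "s \<in> S_comp (e - d - d)" "\<And>P. P \<in> X \<Longrightarrow> eval_at (c P) s =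
      (if c P w = 0 then eval_at (c P) h / c P v else - eval_at (c P) g / c P w)"
    using ind[unfolded imposes_independent_def, rule_format,
      of "\<lambda>P. if c P w = 0 then eval_at (c P) h / c P v else - eval_at (c P) g / c P w"] by blast
  have z: "c P v * eval_at (c P) g + c P w * eval_at (c P) h = 0" if "P \<in> X" for P
    using f that by (simp add: van_def gh eval_at_add eval_at_mult)
  have "g + Var w * s \<in> van (e - d)"
    unfolding van_def
  proof (safe intro!: S_comp_add gh Var_mult_S_comp)
    show "s \<in> S_comp (e - d - var_deg w)" using s sf by simp
    fix P assume P: "P \<in> X"
    show "eval_at (c P) (g + Var w * s) = 0"
      using z[OF P] s(2)[OF P] nonzero[OF P vw] by (auto simp: eval_at_add eval_at_mult)
  qed
  moreover have "h - Var v * s \<in> van (e - d)"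
    unfolding van_def
  proof (safe intro!: S_comp_diff gh Var_mult_S_comp)
    show "s \<in> S_comp (e - d - var_deg v)" using s sf by simp
    fix P assume P: "P \<in> X"
    show "eval_at (c P) (h - Var v * s) = 0"
      using z[OF P] s(2)[OF P] nonzero[OF P vw]
      by (auto simp: eval_at_diff eval_at_mult field_simps eq_neg_iff_add_eq_0)
  qed
  moreover have "f = Var v * (g + Var w * s) + Var w * (h - Var v * s)"
    by (simp add: gh algebra_simps)
  ultimately show ?thesis by (rule that)
qed

end

text \<open>An arbitrary finite family of forms vanishing on \<open>X\<close>; it is instantiated
  with the basis of a single strip and later with the generators from both strips.\<close>

locale forms = points X c for X :: "'p set" and c :: "'p \<Rightarrow> var \<Rightarrow> 'k::field" +
  fixes G :: "'g set" and g :: "'g \<Rightarrow> 'k bipoly" and \<epsilon> :: "'g \<Rightarrow> int \<times> int"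
  assumes finite_G: "finite G" and g_van: "m \<in> G \<Longrightarrow> g m \<in> van (\<epsilon> m)"
begin

definition coeffs :: "int \<times> int \<Rightarrow> ('g \<Rightarrow> 'k bipoly) \<Rightarrow> bool" where
  "coeffs e u \<longleftrightarrow> (\<forall>m\<in>G. u m \<in> S_comp (e - \<epsilon> m))"

definition generated :: "int \<times> int \<Rightarrow> bool" where
  "generated e \<longleftrightarrow> (\<forall>f\<in>van e. \<exists>u. coeffs e u \<and> f = (\<Sum>m\<in>G. u m * g m))"

definition syzygy :: "int \<times> int \<Rightarrow> ('g \<Rightarrow> 'k bipoly) \<Rightarrow> bool" where
  "syzygy e u \<longleftrightarrow> coeffs e u \<and> (\<Sum>m\<in>G. u m * g m) = 0"

lemma coeffs_van: "coeffs e u \<Longrightarrow> (\<Sum>m\<in>G. u m * g m) \<in> van e"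
  by (rule van_sum) (auto simp: coeffs_def intro: van_mult' g_van)

lemma coeffs_Var_mult: "coeffs (e - var_deg v) u \<Longrightarrow> coeffs e (\<lambda>m. Var v * u m)"
  by (auto simp: coeffs_def algebra_simps intro!: Var_mult_S_comp)

lemma coeffs_add: "coeffs e u \<Longrightarrow> coeffs e u' \<Longrightarrow> coeffs e (\<lambda>m. u m + u' m)"
  by (auto simp: coeffs_def intro: S_comp_add)

lemma coeffs_diff: "coeffs e u \<Longrightarrow> coeffs e u' \<Longrightarrow> coeffs e (\<lambda>m. u m - u' m)"
  by (auto simp: coeffs_def intro: S_comp_diff)

lemma generated_step:
  assumes vw: "same_factor v w d" and gen: "generated (e - d)"
    and e: "fst d * fst e + snd d * snd e \<noteq> 0" and ind: "imposes_independent (e - d - d)"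
  shows "generated e"
  unfolding generated_def
proof
  fix f assume "f \<in> van e"
  then obtain a b where ab: "a \<in> van (e - d)" "b \<in> van (e - d)" "f = Var v * a + Var w * b"
    using van_split[OF vw _ e ind] by blast
  from ab(1,2) gen obtain s t where s: "coeffs (e - d) s" "a = (\<Sum>m\<in>G. s m * g m)"
    and t: "coeffs (e - d) t" "b = (\<Sum>m\<in>G. t m * g m)"
    unfolding generated_def by meson
  have "coeffs e (\<lambda>m. Var v * s m + Var w * t m)"
    using s t same_factorD[OF vw] by (intro coeffs_add coeffs_Var_mult) simp_all
  moreover have "f = (\<Sum>m\<in>G. (Var v * s m + Var w * t m) * g m)"
    by (simp add: ab(3) s t sum_distrib_left sum.distrib distrib_right mult.assoc)
  ultimately show "\<exists>u. coeffs e u \<and> f = (\<Sum>m\<in>G. u m * g m)"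
    by (intro exI conjI)
qed

text \<open>Splitting the coefficients as \<open>v p + w q\<close> does not yet give syzygies. But
  the forms \<open>F\<close> and \<open>F'\<close> with coefficients \<open>p\<close> and
  \<open>q\<close> satisfy \<open>v F + w F' = 0\<close>, hence are \<open>w h\<close> and
  \<open>- v h\<close> with \<open>h\<close> vanishing on \<open>X\<close>. If \<open>h\<close> has
  coefficients \<open>r\<close> in the generators, then \<open>p - w r\<close> and
  \<open>q + v r\<close> are syzygies, and \<open>u\<close> is unchanged.\<close>

lemma syzygy_split:
  assumes vw: "same_factor v w d" and u: "syzygy e u" and gen: "generated (e - d - d)"
    and e: "\<And>m. m \<in> G \<Longrightarrow> fst d * fst (e - \<epsilon> m) + snd d * snd (e - \<epsilon> m) \<noteq> 0"
  obtains s t where "syzygy (e - d) s" "syzygy (e - d) t"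
    "\<And>m. m \<in> G \<Longrightarrow> u m = Var v * s m + Var w * t m"
proof -
  note sf = same_factorD[OF vw]
  have "\<exists>p q. p \<in> S_comp (e - d - \<epsilon> m) \<and> q \<in> S_comp (e - d - \<epsilon> m) \<and> u m = Var v * p + Var w * q"
    if "m \<in> G" for m
  proof -
    have "u m \<in> S_comp (e - \<epsilon> m)" using u that by (simp add: syzygy_def coeffs_def)
    from split_vars[OF vw this e[OF that]] show ?thesis
      by (metis diff_right_commute)
  qed
  then obtain p q where p: "coeffs (e - d) p" and q: "coeffs (e - d) q"
    and pq: "\<And>m. m \<in> G \<Longrightarrow> u m = Var v * p m + Var w * q m"
    unfolding coeffs_def by metis
  let ?f = "\<lambda>u. \<Sum>m\<in>G. u m * g m"
  have "Var v * ?f p + Var w * ?f q = ?f (\<lambda>m. Var v * p m + Var w * q m)"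
    by (simp add: sum_distrib_left sum.distrib distrib_right mult.assoc)
  also have "\<dots> = ?f u" by (simp add: pq)
  also have "\<dots> = 0" using u by (simp add: syzygy_def)
  finally obtain h where h: "h \<in> van (e - d - d)" "?f p = Var w * h" "?f q = - (Var v * h)"
    using koszul_van[OF vw coeffs_van[OF p] coeffs_van[OF q]] by blast
  from h(1) gen obtain r where r: "coeffs (e - d - d) r" "h = ?f r"
    by (auto simp: generated_def)
  show ?thesis
  proof
    show "syzygy (e - d) (\<lambda>m. p m - Var w * r m)"
      using p r sf h(2) unfolding syzygy_def
      by (auto intro!: coeffs_diff coeffs_Var_mult
          simp: left_diff_distrib sum_subtractf mult.assoc sum_distrib_left)
    show "syzygy (e - d) (\<lambda>m. q m + Var v * r m)"
      using q r sf h(3) unfolding syzygy_def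
      by (auto intro!: coeffs_add coeffs_Var_mult
          simp: distrib_right sum.distrib mult.assoc sum_distrib_left)
    show "u m = Var v * (p m - Var w * r m) + Var w * (q m + Var v * r m)" if "m \<in> G" for m
      by (simp add: pq[OF that] algebra_simps)
  qed
qed

end

section \<open>Dimensions of spaces of forms\<close>

text \<open>Relative to a subspace of a finite span, because the polynomial ring itself is
  infinite-dimensional. A basis of the kernel is extended to one of \<open>V\<close>; the images of
  the added vectors are a basis of the image.\<close>

lemma (in vector_space_pair) rank_nullity:
  assumes f: "Vector_Spaces.linear s1 s2 f" and V: "vs1.subspace V"
    and B: "finite B" "V \<subseteq> vs1.span B"
  shows "vs1.dim V = vs1.dim {x \<in> V. f x = 0} + vs2.dim (f ` V)"
proof -
  interpret f: Vector_Spaces.linear s1 s2 f by (rule f)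
  let ?K = "{x \<in> V. f x = 0}"
  obtain K where K: "K \<subseteq> ?K" "vs1.independent K" "?K \<subseteq> vs1.span K"
    by (rule vs1.maximal_independent_subset)
  from K(1) have "K \<subseteq> V" by auto
  then obtain C where C: "K \<subseteq> C" "C \<subseteq> V" "vs1.independent C" "V \<subseteq> vs1.span C"
    using vs1.maximal_independent_subset_extend[OF _ K(2)] by blast
  have fin: "finite C"
    using vs1.independent_span_bound[OF B(1) C(3)] C(2) B(2) by blast
  let ?L = "C - K"
  have spanV: "vs1.span C = V"
    using C(2,4) V by (rule vs1.span_subspace)
  \<comment> \<open>A vector of this span killed by \<open>f\<close> lies in the span of
    \<open>K\<close> as well; its coordinates are supported on two disjoint sets and so are all
    0.\<close>
  have "inj_on f (vs1.span ?L)"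
  proof (subst f.inj_on_iff_eq_0[OF vs1.subspace_span], safe)
    fix x assume x: "x \<in> vs1.span ?L" "f x = 0"
    have "x \<in> V" using x(1) vs1.span_mono[of ?L C] spanV by auto
    with x(2) K(3) have "x \<in> vs1.span K" by auto
    then have 1: "vs1.representation C x = vs1.representation K x"
      using C(1,3) by (intro vs1.representation_extend) auto
    have 2: "vs1.representation C x = vs1.representation ?L x"
      using x(1) C(3) by (intro vs1.representation_extend) auto
    have "vs1.representation C x b = 0" for b
      using vs1.representation_ne_zero[of K x b] vs1.representation_ne_zero[of ?L x b] 1 2 by auto
    then show "x = 0"
      using vs1.sum_nonzero_representation_eq[OF C(3), of x] \<open>x \<in> V\<close> spanV by simp
  qed
  moreover have "vs1.independent ?L" using C(3) by (rule vs1.independent_mono) auto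
  ultimately have "vs2.independent (f ` ?L)" "inj_on f ?L"
    using f.independent_injective_image[of ?L] inj_on_subset[OF _ vs1.span_superset[of ?L]] by simp_all
  moreover have "f ` V \<subseteq> vs2.span (f ` ?L)"
  proof -
    have "f ` C \<subseteq> insert 0 (f ` ?L)" using K(1) by auto
    then have "vs2.span (f ` C) \<subseteq> vs2.span (f ` ?L)"
      using vs2.span_mono[of "f ` C" "insert 0 (f ` ?L)"] by simp
    then show ?thesis using f.span_image[of C] spanV by simp
  qed
  moreover have "?L \<subseteq> V" using C(2) by auto
  ultimately have "vs2.dim (f ` V) = card ?L"
    using vs2.basis_card_eq_dim[OF image_mono[of ?L V f]] card_image[of f ?L] \<open>?L \<subseteq> V\<close> by simp
  moreover have "vs1.dim ?K = card K" "vs1.dim V = card C"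
    using K C by (auto simp: vs1.basis_card_eq_dim[symmetric])
  moreover have "card C = card K + card ?L"
    using fin C(1) by (metis card_Diff_subset card_mono finite_subset le_add_diff_inverse)
  ultimately show ?thesis by simp
qed

lemma sum_fun_apply: "(\<Sum>x\<in>A. f x) y = (\<Sum>x\<in>A. f x y)"
  by (induction A rule: infinite_finite_induct) auto

section \<open>Forms and functions on the points as vector spaces\<close>

global_interpretation bp: vector_space "\<lambda>(a::'k::field) p. Const a * p"
  by standard (simp_all add: algebra_simps Const_add Const_mult)

global_interpretation fn: vector_space "\<lambda>(a::'k::field) (h :: 'p \<Rightarrow> 'k) x. a * h x"
  by standard (simp_all add: algebra_simps fun_eq_iff)

global_interpretation bpfn: vector_space_pair "\<lambda>(a::'k::field) p. Const a * p"
  "\<lambda>(a::'k::field) (h :: 'p \<Rightarrow> 'k) x. a * h x" ..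

lemma subspace_S_comp: "bp.subspace (S_comp e)"
  by (auto simp: bp.subspace_def S_comp_add Const_mult_S_comp)

definition monomials :: "int \<times> int \<Rightarrow> 'k::field bipoly set" where
  "monomials e = (\<lambda>m. single m 1) ` {m. bideg m = e}"

lemma Const_mult_single: "Const a * single m b = single m (a * b)"
  by (simp add: Const_def mult_single)

lemma card_bideg: "card {m. bideg m = (int a, int b)} = (a + 1) * (b + 1)"
  and finite_bideg: "finite {m. bideg m = (int a, int b)}"
proof -
  let ?f = "\<lambda>(k, l). single X0 k + single X1 (a - k) + single Y0 l + single Y1 (b - l)"
  let ?g = "\<lambda>m. (lookup m X0, lookup m Y0)"
  have "bij_betw ?g {m. bideg m = (int a, int b)} ({..a} \<times> {..b})"
  proof (rule bij_betw_byWitness[where f' = ?f])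
    show "\<forall>m\<in>{m. bideg m = (int a, int b)}. ?f (?g m) = m"
    proof
      fix m assume "m \<in> {m. bideg m = (int a, int b)}"
      then have "lookup m X0 + lookup m X1 = a" "lookup m Y0 + lookup m Y1 = b"
        by (auto simp: bideg_def)
      then have "lookup (?f (?g m)) v = lookup m v" for v
        by (cases v) (auto simp: lookup_add lookup_single)
      then show "?f (?g m) = m" by (intro poly_mapping_eqI)
    qed
  qed (auto simp: lookup_add lookup_single bideg_def)
  then show "card {m. bideg m = (int a, int b)} = (a + 1) * (b + 1)"
    "finite {m. bideg m = (int a, int b)}"
    by (simp_all add: bij_betw_same_card bij_betw_finite)
qed

lemma finite_monomials: "finite (monomials (int a, int b))"
  by (simp add: monomials_def finite_bideg)

lemma S_comp_span_monomials: "S_comp e \<subseteq> bp.span (monomials e)"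
proof
  fix p :: "'a bipoly" assume p: "p \<in> S_comp e"
  have "(\<Sum>m\<in>keys p. Const (lookup p m) * single m 1) \<in> bp.span (monomials e)"
    using p by (intro bp.span_sum bp.span_scale bp.span_base) (auto simp: monomials_def S_comp_def)
  then show "p \<in> bp.span (monomials e)"
    by (simp add: Const_mult_single flip: poly_mapping_sum_single)
qed

lemma dim_S_comp: "bp.dim (S_comp (int a, int b) :: 'k::field bipoly set) = (a + 1) * (b + 1)"
proof (rule bp.dim_unique)
  let ?M = "{m. bideg m = (int a, int b)}" and ?e = "(int a, int b)"
  have inj: "inj_on (\<lambda>m. single m (1::'k)) ?M"
    by (rule inj_onI) (metis lookup_single_eq lookup_single_not_eq zero_neq_one)
  show "(monomials ?e :: 'k bipoly set) \<subseteq> S_comp ?e"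
    by (auto simp: monomials_def S_comp_def)
  show "S_comp ?e \<subseteq> bp.span (monomials ?e :: 'k bipoly set)"
    by (rule S_comp_span_monomials)
  show "bp.independent (monomials ?e :: 'k bipoly set)"
  proof (rule bp.independent_if_scalars_zero[OF finite_monomials])
    fix u and x :: "'k bipoly"
    assume u: "(\<Sum>x\<in>(monomials ?e :: 'k bipoly set). Const (u x) * x) = 0" and "x \<in> monomials ?e"
    then obtain m where m: "bideg m = ?e" "x = single m 1" by (auto simp: monomials_def)
    have "(\<Sum>x\<in>(monomials ?e :: 'k bipoly set). Const (u x) * x) = (\<Sum>n\<in>?M. single n (u (single n 1)))"
      unfolding monomials_def by (subst sum.reindex[OF inj]) (simp add: Const_mult_single)
    with u have "lookup (\<Sum>n\<in>?M. single n (u (single n 1))) m = 0" by simp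
    moreover have "lookup (\<Sum>n\<in>?M. single n (u (single n 1))) m = (\<Sum>n\<in>?M. if n = m then u (single n 1) else 0)"
      by (auto simp: lookup_sum lookup_single when_def intro!: sum.cong)
    ultimately show "u x = 0"
      using m finite_bideg by simp
  qed
  show "card (monomials ?e :: 'k bipoly set) = (a + 1) * (b + 1)"
    unfolding monomials_def by (simp add: card_image[OF inj] card_bideg)
qed

text \<open>Functions that are 0 off \<open>X\<close> stand for the functions on \<open>X\<close>,
  with the indicators of points as basis; they are the target of the evaluation map.\<close>

lemma dim_supported:
  fixes X :: "'p set"
  assumes "finite X"
  shows "fn.dim {h :: 'p \<Rightarrow> 'k::field. \<forall>P. P \<notin> X \<longrightarrow> h P = 0} = card X"
    and "{h :: 'p \<Rightarrow> 'k::field. \<forall>P. P \<notin> X \<longrightarrow> h P = 0} \<subseteq> fn.span ((\<lambda>P Q. if Q = P then 1 else 0) ` X)"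
proof -
  let ?F = "{h :: 'p \<Rightarrow> 'k. \<forall>P. P \<notin> X \<longrightarrow> h P = 0}"
  let ?e = "\<lambda>P Q. if Q = P then 1 else (0::'k)"
  have inj: "inj_on ?e X"
    by (rule inj_onI) (metis one_neq_zero)
  show sp: "?F \<subseteq> fn.span (?e ` X)"
  proof
    fix h assume h: "h \<in> ?F"
    have "(\<Sum>P\<in>X. (\<lambda>Q. h P * ?e P Q)) \<in> fn.span (?e ` X)"
      by (intro fn.span_sum fn.span_scale fn.span_base) auto
    also have "(\<Sum>P\<in>X. (\<lambda>Q. h P * ?e P Q)) = h"
    proof
      fix Q
      have "(\<Sum>P\<in>X. (\<lambda>Q. h P * ?e P Q)) Q = (\<Sum>P\<in>X. if Q = P then h P else 0)"
        by (subst sum_fun_apply) (auto intro: sum.cong)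
      also have "\<dots> = h Q" using h assms by auto
      finally show "(\<Sum>P\<in>X. (\<lambda>Q. h P * ?e P Q)) Q = h Q" .
    qed
    finally show "h \<in> fn.span (?e ` X)" .
  qed
  show "fn.dim ?F = card X"
  proof (rule fn.dim_unique[OF _ sp])
    show "fn.independent (?e ` X)"
    proof (rule fn.independent_if_scalars_zero)
      fix u and x :: "'p \<Rightarrow> 'k"
      assume u: "(\<Sum>x\<in>?e ` X. (\<lambda>Q. u x * x Q)) = 0" and "x \<in> ?e ` X"
      then obtain P where P: "P \<in> X" "x = ?e P" by auto
      have "(\<Sum>x\<in>?e ` X. (\<lambda>Q. u x * x Q)) P = (\<Sum>R\<in>X. if P = R then u (?e R) else 0)"
        by (subst sum_fun_apply, subst sum.reindex[OF inj]) (auto intro: sum.cong)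
      with u show "u x = 0" using P assms by simp
    qed (use assms in simp)
  qed (auto simp: card_image[OF inj])
qed

section \<open>Evaluation on the points as a linear map\<close>

context points
begin

definition eval_pts :: "'k bipoly \<Rightarrow> 'p \<Rightarrow> 'k" where
  "eval_pts f P = (if P \<in> X then eval_at (c P) f else 0)"

lemma linear_eval_pts:
  "Vector_Spaces.linear (\<lambda>a p. Const a * p) (\<lambda>a h P. a * h P) eval_pts"
  by (subst Vector_Spaces.linear_iff) (auto simp: bp.vector_space_axioms fn.vector_space_axioms eval_pts_def fun_eq_iff eval_at_add eval_at_mult)

lemma dim_van_eval_pts:
  "bp.dim (van (int a, int b)) + fn.dim (eval_pts ` S_comp (int a, int b)) = (a + 1) * (b + 1)"
proof -
  have "van e = {f \<in> S_comp e. eval_pts f = 0}" for e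
    by (auto simp: van_def eval_pts_def fun_eq_iff)
  then show ?thesis
    using bpfn.rank_nullity[OF linear_eval_pts subspace_S_comp finite_monomials S_comp_span_monomials, of a b]
    by (simp add: dim_S_comp)
qed

lemma eval_pts_S_comp_iff_independent:
  "imposes_independent e \<longleftrightarrow> eval_pts ` S_comp e = {h. \<forall>P. P \<notin> X \<longrightarrow> h P = 0}"
proof
  assume e: "imposes_independent e"
  show "eval_pts ` S_comp e = {h. \<forall>P. P \<notin> X \<longrightarrow> h P = 0}"
  proof (intro Set.set_eqI iffI)
    fix h assume h: "h \<in> {h. \<forall>P. P \<notin> X \<longrightarrow> h P = (0::'k)}"
    obtain f where "f \<in> S_comp e" "\<forall>P\<in>X. eval_at (c P) f = h P"
      using e unfolding imposes_independent_def by blast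
    moreover from this h have "h = eval_pts f" by (auto simp: eval_pts_def fun_eq_iff)
    ultimately show "h \<in> eval_pts ` S_comp e" by blast
  qed (auto simp: eval_pts_def)
next
  assume e: "eval_pts ` S_comp e = {h. \<forall>P. P \<notin> X \<longrightarrow> h P = 0}"
  show "imposes_independent e"
    unfolding imposes_independent_def
  proof
    fix h :: "'p \<Rightarrow> 'k"
    have "(\<lambda>P. if P \<in> X then h P else 0) \<in> eval_pts ` S_comp e" unfolding e by simp
    then obtain f where "f \<in> S_comp e" "(\<lambda>P. if P \<in> X then h P else 0) = eval_pts f" by blast
    then show "\<exists>f\<in>S_comp e. \<forall>P\<in>X. eval_at (c P) f = h P"
      unfolding eval_pts_def fun_eq_iff by metis
  qed
qed

lemma dim_van:
  "imposes_independent (int a, int b) \<Longrightarrow> bp.dim (van (int a, int b)) + card X = (a + 1) * (b + 1)"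
  using dim_van_eval_pts[of a b] dim_supported(1)[OF finite_X, where 'k = 'k]
  by (simp add: eval_pts_S_comp_iff_independent)

text \<open>A basis of the image extends to a basis of all functions on \<open>X\<close>; both have
  the same finite size, so nothing was added.\<close>

lemma imposes_independent_if_dim:
  assumes "fn.dim (eval_pts ` S_comp e) = card X"
  shows "imposes_independent e"
  unfolding eval_pts_S_comp_iff_independent
proof (rule antisym)
  let ?F = "{h. \<forall>P. P \<notin> X \<longrightarrow> h P = (0::'k)}"
  let ?W = "eval_pts ` S_comp e"
  show sub: "?W \<subseteq> ?F" by (auto simp: eval_pts_def)
  obtain B where B: "B \<subseteq> ?W" "fn.independent B" "?W \<subseteq> fn.span B" "card B = fn.dim ?W"
    by (rule fn.basis_exists)
  obtain C where C: "B \<subseteq> C" "C \<subseteq> ?F" "fn.independent C" "?F \<subseteq> fn.span C"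
    by (rule fn.maximal_independent_subset_extend[OF subset_trans[OF B(1) sub] B(2)])
  have "card C = card X"
    using fn.basis_card_eq_dim[OF C(2,4,3)] dim_supported(1)[OF finite_X, where 'k = 'k] by simp
  moreover have "finite C"
    using fn.independent_span_bound[OF _ C(3) subset_trans[OF C(2) dim_supported(2)[OF finite_X, where 'k = 'k]]]
      finite_X by simp
  ultimately have "B = C" using C(1) B(4) assms by (intro card_subset_eq) auto
  moreover have "fn.subspace ?W"
    using linear_eval_pts subspace_S_comp by (rule bpfn.linear_subspace_image)
  ultimately show "?F \<subseteq> ?W" using C(4) fn.span_minimal[OF B(1)] by auto
qed

lemma van_basis:
  obtains B where "B \<subseteq> van (int a, int b)" "bp.independent B" "van (int a, int b) \<subseteq> bp.span B"
    "finite B" "card B = bp.dim (van (int a, int b))"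
proof -
  obtain B where B: "B \<subseteq> van (int a, int b)" "bp.independent B" "van (int a, int b) \<subseteq> bp.span B"
    "card B = bp.dim (van (int a, int b))"
    by (rule bp.basis_exists)
  moreover have "finite B"
  proof (rule conjunct1[OF bp.independent_span_bound[OF finite_monomials B(2)]])
    have "B \<subseteq> S_comp (int a, int b)" using B(1) van_S_comp by auto
    then show "B \<subseteq> bp.span (monomials (int a, int b))"
      using S_comp_span_monomials by (rule subset_trans)
  qed
  ultimately show ?thesis using that by blast
qed

lemma van_trivial_if_dim:
  assumes "fn.dim (eval_pts ` S_comp (int a, int b)) = (a + 1) * (b + 1)"
  shows "van (int a, int b) = {0}"
proof -
  obtain B where B: "van (int a, int b) \<subseteq> bp.span B" "finite B" "card B = bp.dim (van (int a, int b))"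
    by (rule van_basis)
  then have "B = {}" using dim_van_eval_pts[of a b] assms by simp
  with B(1) show ?thesis by auto
qed

text \<open>Multiplication by \<open>y_0\<close> is injective from each y-degree to the next, so
  zero propagates downwards.\<close>

lemma van_trivial_mono:
  assumes "van (a, b) = {0}" "b' \<le> b"
  shows "van (a, b') = {0}"
proof -
  have "van (a, b - int n) = {0}" for n
  proof (induction n)
    case (Suc n)
    have "f = 0" if f: "f \<in> van (a, b - int (Suc n))" for f
    proof -
      have "Var Y0 * f \<in> van (a, b - int n)"
        using f by (intro van_Var_mult) (simp add: algebra_simps)
      with Suc show ?thesis using Var_mult_eq_0 by blast
    qed
    then show ?case by auto
  qed (use assms in simp)
  from this[of "nat (b - b')"] show ?thesis using assms(2) by simp
qed

end

text \<open>The subring \<open>k[y_0, y_1]\<close>, over which the strips are free modules.\<close>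

definition y_poly :: "'k::field bipoly \<Rightarrow> bool" where
  "y_poly p \<longleftrightarrow> (\<forall>m. lookup p m \<noteq> 0 \<longrightarrow> lookup m X0 = 0 \<and> lookup m X1 = 0)"

lemma y_poly_0 [simp]: "y_poly 0"
  by (simp add: y_poly_def)

lemma y_poly_add: "y_poly p \<Longrightarrow> y_poly q \<Longrightarrow> y_poly (p + q)"
  unfolding y_poly_def by (metis add.right_neutral lookup_add)

lemma y_poly_uminus: "y_poly p \<Longrightarrow> y_poly (- p)"
  by (simp add: y_poly_def)

lemma y_poly_diff: "y_poly p \<Longrightarrow> y_poly q \<Longrightarrow> y_poly (p - q)"
  using y_poly_add[of p "- q"] y_poly_uminus[of q] by simp

lemma y_poly_sum: "(\<And>x. x \<in> A \<Longrightarrow> y_poly (f x)) \<Longrightarrow> y_poly (sum f A)"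
  by (induction A rule: infinite_finite_induct) (auto intro: y_poly_add)

lemma y_poly_mult: "y_poly p \<Longrightarrow> y_poly q \<Longrightarrow> y_poly (p * q)"
  using keys_mult[of p q] unfolding y_poly_def in_keys_iff[symmetric]
  by (fastforce simp: lookup_add)

lemma y_poly_S_comp: "p \<in> S_comp (0, b) \<Longrightarrow> y_poly p"
  by (force simp: y_poly_def S_comp_lookup bideg_def)

lemma hpart_y_poly: "y_poly p \<Longrightarrow> a \<noteq> 0 \<Longrightarrow> hpart (a, b) p = 0"
  by (rule poly_mapping_eqI) (auto simp: lookup_hpart y_poly_def bideg_def)

lemma (in forms) syzygy_hpart:
  assumes "(\<Sum>m\<in>G. u m * g m) = 0"
  shows "syzygy e (\<lambda>m. hpart (e - \<epsilon> m) (u m))"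
proof -
  have "(\<Sum>m\<in>G. hpart (e - \<epsilon> m) (u m) * g m) = hpart e (\<Sum>m\<in>G. u m * g m)"
    unfolding hpart_sum by (intro sum.cong refl hpart_mult[symmetric] van_S_comp g_van)
  with assms show ?thesis by (simp add: syzygy_def coeffs_def)
qed

section \<open>Bases of the strips of fixed x-degree\<close>

context points
begin

text \<open>A homogeneous basis of the strip of x-degree \<open>a\<close> of the ideal over
  \<open>k[y_0, y_1]\<close>. Its rank is that of the same strip of \<open>S\<close>, since the
  quotient has dimension at most \<open>card X\<close> in each degree. Independence is asked for
  inhomogeneous coefficients too, because it is later applied to \<open>x_coeff\<close> of arbitrary
  polynomials.\<close>

definition strip_basis :: "nat \<Rightarrow> (nat \<Rightarrow> int) \<Rightarrow> (nat \<Rightarrow> 'k bipoly) \<Rightarrow> bool" where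
  "strip_basis a d g \<longleftrightarrow>
    (\<forall>m<a+1. g m \<in> van (int a, d m)) \<and>
    (\<forall>b. \<forall>f\<in>van (int a, b). \<exists>u. (\<forall>m<a+1. u m \<in> S_comp (0, b - d m)) \<and> f = (\<Sum>m<a+1. u m * g m)) \<and>
    (\<forall>u. (\<forall>m<a+1. y_poly (u m)) \<longrightarrow> (\<Sum>m<a+1. u m * g m) = 0 \<longrightarrow> (\<forall>m<a+1. u m = 0))"

text \<open>Let \<open>B\<close> be a basis of the ideal in bidegree (a, q), of size (a+1)(q+1) -
  |X| = a + 1 - r. As no nonzero form vanishes on X in y-degree q - 1, \<open>y_0 B\<close> and
  \<open>y_1 B\<close> together stay independent in y-degree q + 1, where the dimension (a+1)(q+2) -
  |X| exceeds 2|B| by r; this leaves r elements for \<open>C\<close>. Above q + 1 no generators or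
  relations are added.\<close>

lemma van_free_basis_set:
  fixes a q r :: nat
  assumes ind: "imposes_independent (int a, int q)" and triv: "van (int a, int q - 1) = {0}"
    and N: "card X = (a + 1) * q + r"
  obtains B C where "finite B" "finite C" "B \<inter> C = {}" "card B + r = a + 1" "card C = r"
    "B \<subseteq> van (int a, int q)" "C \<subseteq> van (int a, int q + 1)"
    "\<And>b. forms.generated X c (B \<union> C) (\<lambda>x. x) (\<lambda>x. (int a, if x \<in> B then int q else int q + 1)) (int a, b)"
    "\<And>b u x. forms.syzygy (B \<union> C) (\<lambda>x. x) (\<lambda>x. (int a, if x \<in> B then int q else int q + 1)) (int a, b) u
      \<Longrightarrow> x \<in> B \<union> C \<Longrightarrow> u x = 0"
proof -
  have ind': "imposes_independent (int a, b)" if "b \<ge> int q" for b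
    using ind that by (rule independent_mono_le[OF _ order_refl])
  have triv': "van (int a, b) = {0}" if "b < int q" for b
    using triv that by (intro van_trivial_mono[OF triv]) simp
  \<comment> \<open>A relation with coefficients \<open>y_0\<close> and \<open>y_1\<close> is
    Koszul, with quotient in y-degree q - 1, hence trivial.\<close>
  have kz: "f = 0 \<and> g = 0"
    if "f \<in> van (int a, int q)" "g \<in> van (int a, int q)" "Var Y0 * f + Var Y1 * g = 0" for f g
    using koszul_van[OF same_factor.intros(2) that] triv by auto
  obtain B where B: "B \<subseteq> van (int a, int q)" "bp.independent B" "van (int a, int q) \<subseteq> bp.span B"
    "finite B" "card B = bp.dim (van (int a, int q))"
    by (rule van_basis)
  have cardB: "card B + card X = (a + 1) * (q + 1)"
    using dim_van[OF ind] B(5) by simp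
  have B0: "0 \<notin> B" using B(2) bp.dependent_zero by blast
  define D0 where "D0 = (*) (Var Y0) ` B"
  define D1 where "D1 = (*) (Var Y1) ` B"
  have inj: "inj_on ((*) (Var v)) B" for v
    by (rule inj_onI) (rule Var_mult_cancel)
  have disj: "D0 \<inter> D1 = {}"
  proof (rule equals0I)
    fix x assume "x \<in> D0 \<inter> D1"
    then obtain f g where "f \<in> B" "g \<in> B" "Var Y0 * f = Var Y1 * g"
      by (auto simp: D0_def D1_def)
    with kz[of f "- g"] B(1) B0 show False by (auto intro: van_uminus)
  qed
  have fin: "finite D0" "finite D1" using B(4) by (simp_all add: D0_def D1_def)
  have sumD: "(\<Sum>x\<in>D0 \<union> D1. \<phi> x) = (\<Sum>b\<in>B. \<phi> (Var Y0 * b) + \<phi> (Var Y1 * b))" for \<phi> :: "'k bipoly \<Rightarrow> 'k bipoly"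
    using fin disj by (simp add: sum.union_disjoint D0_def D1_def sum.reindex[OF inj] sum.distrib)
  have lin: "(\<Sum>b\<in>B. Const (t b) * b) \<in> van (int a, int q)" for t
    using B(1) by (intro van_sum van_Const) auto
  have Bz: "t b = 0" if "(\<Sum>b\<in>B. Const (t b) * b) = 0" "b \<in> B" for t b
    using bp.independentD[OF B(2,4) order_refl that] .
  have "bp.independent (D0 \<union> D1)"
  proof (rule bp.independent_if_scalars_zero)
    fix t x assume t: "(\<Sum>x\<in>D0 \<union> D1. Const (t x) * x) = 0" and x: "x \<in> D0 \<union> D1"
    have "Var Y0 * (\<Sum>b\<in>B. Const (t (Var Y0 * b)) * b) + Var Y1 * (\<Sum>b\<in>B. Const (t (Var Y1 * b)) * b) = 0"
      using t unfolding sumD by (simp add: sum_distrib_left sum.distrib mult.left_commute)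
    from kz[OF lin lin this] have "t (Var Y0 * b) = 0" "t (Var Y1 * b) = 0" if "b \<in> B" for b
      using Bz[OF _ that, of "\<lambda>b. t (Var Y0 * b)"] Bz[OF _ that, of "\<lambda>b. t (Var Y1 * b)"] by auto
    then show "t x = 0" using x by (auto simp: D0_def D1_def)
  qed (use fin in simp)
  moreover have "D0 \<union> D1 \<subseteq> van (int a, int (q + 1))"
    using B(1) by (auto simp: D0_def D1_def intro!: van_Var_mult)
  ultimately obtain E where E: "D0 \<union> D1 \<subseteq> E" "E \<subseteq> van (int a, int (q + 1))" "bp.independent E"
    "van (int a, int (q + 1)) \<subseteq> bp.span E"
    using bp.maximal_independent_subset_extend by blast
  have finE: "finite E"
  proof (rule conjunct1[OF bp.independent_span_bound[OF finite_monomials E(3)]])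
    have "E \<subseteq> S_comp (int a, int (q + 1))" using E(2) van_S_comp by auto
    then show "E \<subseteq> bp.span (monomials (int a, int (q + 1)))"
      using S_comp_span_monomials by (rule subset_trans)
  qed
  have Ez: "t b = 0" if "(\<Sum>b\<in>E. Const (t b) * b) = 0" "b \<in> E" for t b
    using bp.independentD[OF E(3) finE order_refl that] .
  define C where "C = E - (D0 \<union> D1)"
  have finC: "finite C" using finE by (simp add: C_def)
  have C: "C \<subseteq> van (int a, int q + 1)" using E(2) by (auto simp: C_def add.commute)
  have E_eq: "E = (D0 \<union> D1) \<union> C" "(D0 \<union> D1) \<inter> C = {}" using E(1) by (auto simp: C_def)
  have sumE: "(\<Sum>x\<in>E. \<phi> x) = (\<Sum>b\<in>B. \<phi> (Var Y0 * b) + \<phi> (Var Y1 * b)) + (\<Sum>x\<in>C. \<phi> x)"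
    for \<phi> :: "'k bipoly \<Rightarrow> 'k bipoly"
    using fin finC E_eq by (simp add: sum.union_disjoint sumD)
  have "card E + card X = (a + 1) * (q + 2)"
    using dim_van[of a "q + 1"] bp.basis_card_eq_dim[OF E(2,4,3)] ind'[of "int (q + 1)"] by simp
  moreover have "card E = 2 * card B + card C"
    using fin finC disj E_eq by (simp add: card_Un_disjoint D0_def D1_def card_image[OF inj])
  ultimately have card: "card B + r = a + 1" "card C = r"
    using cardB N by (simp_all add: algebra_simps)
  have BC: "B \<inter> C = {}"
  proof (rule equals0I)
    fix x assume x: "x \<in> B \<inter> C"
    then have "x \<in> S_comp (int a, int q)" "x \<in> S_comp (int a, int q + 1)"
      using B(1) C van_S_comp by blast+
    then have "x = 0"
      using hpart_of_S_comp[of x "(int a, int q)" "(int a, int q)"]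
        hpart_of_S_comp[of x "(int a, int q + 1)" "(int a, int q)"] by simp
    with x B0 show False by simp
  qed
  define \<epsilon> where "\<epsilon> x = (int a, if x \<in> B then int q else int q + 1)" for x
  interpret F: forms X c "B \<union> C" "\<lambda>x. x" \<epsilon>
    by standard (use B C finC in \<open>auto simp: \<epsilon>_def\<close>)
  have notB: "x \<notin> B" if "x \<in> C" for x using BC that by auto
  have sumBC: "(\<Sum>x\<in>B \<union> C. \<phi> x) = (\<Sum>x\<in>B. \<phi> x) + (\<Sum>x\<in>C. \<phi> x)" for \<phi> :: "'k bipoly \<Rightarrow> 'k bipoly"
    using B(4) finC BC by (rule sum.union_disjoint)
  have gen0: "F.generated (int a, b)" if "b < int q" for b
    unfolding F.generated_def triv'[OF that]
    by (auto simp: F.coeffs_def intro!: exI[of _ "\<lambda>_. 0"])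
  \<comment> \<open>Degrees q and q + 1 are read off the bases \<open>B\<close> and
    \<open>E\<close>; from q + 2 on, the splitting needs independent conditions two degrees lower,
    that is, in degree at least q.\<close>
  have gen: "F.generated (int a, int q + int n)" for n
  proof (induction n rule: less_induct)
    case (less n)
    consider "n = 0" | "n = 1" | "n \<ge> 2" by linarith
    then show ?case
    proof cases
      case 1
      show ?thesis
        unfolding F.generated_def
      proof
        fix f assume "f \<in> van (int a, int q + int n)"
        with B(3) 1 have "f \<in> bp.span B" by auto
        then obtain t where t: "f = (\<Sum>b\<in>B. Const (t b) * b)"
          unfolding bp.span_finite[OF B(4)] by auto
        let ?u = "\<lambda>x. if x \<in> B then Const (t x) else 0"
        have "F.coeffs (int a, int q + int n) ?u"
          using 1 by (auto simp: F.coeffs_def \<epsilon>_def simp flip: zero_prod_def)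
        moreover have "f = (\<Sum>x\<in>B \<union> C. ?u x * x)"
          unfolding sumBC t by (simp add: notB)
        ultimately show "\<exists>u. F.coeffs (int a, int q + int n) u \<and> f = (\<Sum>m\<in>B \<union> C. u m * m)"
          by blast
      qed
    next
      case 2
      show ?thesis
        unfolding F.generated_def
      proof
        fix f assume "f \<in> van (int a, int q + int n)"
        with E(4) 2 have "f \<in> bp.span E" by (auto simp: add.commute)
        then obtain t where t: "f = (\<Sum>b\<in>E. Const (t b) * b)"
          unfolding bp.span_finite[OF finE] by auto
        \<comment> \<open>Each element of \<open>E\<close> is \<open>y_0 b\<close>,
          \<open>y_1 b\<close> or a member of \<open>C\<close>; its scalar enters the coefficient of
          \<open>b\<close> as a multiple of a variable, or is itself the coefficient of the member
          of \<open>C\<close>.\<close>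
        let ?u = "\<lambda>x. if x \<in> B then Var Y0 * Const (t (Var Y0 * x)) + Var Y1 * Const (t (Var Y1 * x))
          else Const (t x)"
        have "Var Y0 * Const s \<in> S_comp (0, 1)" "Var Y1 * Const s \<in> S_comp (0, 1)" for s :: 'k
          by (auto intro!: Var_mult_S_comp simp flip: zero_prod_def)
        then have "F.coeffs (int a, int q + int n) ?u"
          using 2 by (auto simp: F.coeffs_def \<epsilon>_def intro!: S_comp_add simp flip: zero_prod_def)
        moreover have "f = (\<Sum>x\<in>B \<union> C. ?u x * x)"
          unfolding sumBC t sumE
          by (intro arg_cong2[where f = "(+)"] sum.cong refl) (simp_all add: notB algebra_simps)
        ultimately show "\<exists>u. F.coeffs (int a, int q + int n) u \<and> f = (\<Sum>m\<in>B \<union> C. u m * m)"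
          by blast
      qed
    next
      case 3
      have e: "(int a, int q + int n) - (0, 1) = (int a, int q + int (n - 1))"
        "(int a, int q + int n) - (0, 1) - (0, 1) = (int a, int q + int (n - 2))"
        using 3 by simp_all
      have "fst (0::int, 1::int) * fst (int a, int q + int n) + snd (0::int, 1::int) * snd (int a, int q + int n) \<noteq> 0"
        using 3 by simp
      moreover have "F.generated ((int a, int q + int n) - (0, 1))"
        unfolding e by (rule less) (use 3 in simp)
      moreover have "imposes_independent ((int a, int q + int n) - (0, 1) - (0, 1))"
        unfolding e(2) by (rule ind') simp
      ultimately show ?thesis
        using F.generated_step[OF same_factor.intros(2)] by blast
    qed
  qed
  have gen_all: "F.generated (int a, b)" for b
    using gen0[of b] gen[of "nat (b - int q)"] by (cases "b < int q") simp_all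
  have syz0: "\<forall>x\<in>B \<union> C. u x = 0" if "F.syzygy (int a, b) u" "b < int q" for b u
  proof
    fix x assume x: "x \<in> B \<union> C"
    show "u x = 0"
    proof (rule S_comp_neg)
      show "u x \<in> S_comp ((int a, b) - \<epsilon> x)"
        using that(1) x unfolding F.syzygy_def F.coeffs_def by blast
      show "fst ((int a, b) - \<epsilon> x) < 0 \<or> snd ((int a, b) - \<epsilon> x) < 0"
        using that(2) by (simp add: \<epsilon>_def)
    qed
  qed
  \<comment> \<open>The same two starting degrees: a syzygy in degree q is a scalar relation in
    \<open>B\<close>, one in degree q + 1 a scalar relation in \<open>E\<close>. Higher ones split
    into syzygies one degree lower.\<close>
  have syz: "\<forall>x\<in>B \<union> C. u x = 0" if "F.syzygy (int a, int q + int n) u" for n u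
    using that
  proof (induction n arbitrary: u rule: less_induct)
    case (less n)
    have ux: "u x \<in> S_comp ((int a, int q + int n) - \<epsilon> x)" if "x \<in> B \<union> C" for x
      using less.prems that unfolding F.syzygy_def F.coeffs_def by blast
    have u: "u x \<in> S_comp (0, int n)" if "x \<in> B" for x
      using ux[of x] that by (simp add: \<epsilon>_def)
    have u': "u x \<in> S_comp (0, int n - 1)" if "x \<in> C" for x
      using ux[of x] that notB by (simp add: \<epsilon>_def)
    from less.prems have s: "(\<Sum>x\<in>B. u x * x) + (\<Sum>x\<in>C. u x * x) = 0"
      by (simp add: F.syzygy_def sumBC)
    consider "n = 0" | "n = 1" | "n \<ge> 2" by linarith
    then show ?case
    proof cases
      case 1
      have uC: "u x = 0" if "x \<in> C" for x
        using u'[OF that] 1 by (intro S_comp_neg) auto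
      have "\<exists>k. u x = Const k" if "x \<in> B" for x
        using S_comp_00[of "u x"] u[OF that] 1 by simp
      then obtain t where t: "\<And>x. x \<in> B \<Longrightarrow> u x = Const (t x)"
        by metis
      have "(\<Sum>x\<in>B. Const (t x) * x) = 0"
        using s by (simp add: uC t)
      from Bz[OF this] show ?thesis by (auto simp: uC t)
    next
      case 2
      have "\<exists>k l. u x = Var Y0 * Const k + Var Y1 * Const l" if "x \<in> B" for x
      proof -
        have "u x \<in> S_comp (0, 1)" using u[OF that] 2 by simp
        then obtain v w where "v \<in> S_comp ((0, 1) - (0, 1))" "w \<in> S_comp ((0, 1) - (0, 1))"
          "u x = Var Y0 * v + Var Y1 * w"
          by (rule split_vars[OF same_factor.intros(2)]) simp
        then show ?thesis using S_comp_00[of v] S_comp_00[of w] by (auto simp: zero_prod_def)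
      qed
      then obtain k l where kl: "\<And>x. x \<in> B \<Longrightarrow> u x = Var Y0 * Const (k x) + Var Y1 * Const (l x)"
        by metis
      have "\<exists>k. u x = Const k" if "x \<in> C" for x
        using S_comp_00[of "u x"] u'[OF that] 2 by simp
      then obtain t where t: "\<And>x. x \<in> C \<Longrightarrow> u x = Const (t x)"
        by metis
      \<comment> \<open>The scalar relation on \<open>E\<close> behind the syzygy;
        \<open>var_quot\<close> recovers \<open>b\<close> from \<open>y_0 b\<close> or
        \<open>y_1 b\<close>.\<close>
      define \<phi> where "\<phi> x = (if x \<in> C then t x else if x \<in> D0 then k (var_quot Y0 x)
        else l (var_quot Y1 x))" for x
      have \<phi>C: "\<phi> x = t x" if "x \<in> C" for x using that by (simp add: \<phi>_def)
      have \<phi>B: "\<phi> (Var Y0 * x) = k x" "\<phi> (Var Y1 * x) = l x" if "x \<in> B" for x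
      proof -
        have "Var Y0 * x \<in> D0" "Var Y1 * x \<in> D1" using that by (auto simp: D0_def D1_def)
        then show "\<phi> (Var Y0 * x) = k x" "\<phi> (Var Y1 * x) = l x"
          using E_eq(2) disj by (auto simp: \<phi>_def)
      qed
      have "(\<Sum>x\<in>E. Const (\<phi> x) * x) = (\<Sum>x\<in>B. u x * x) + (\<Sum>x\<in>C. u x * x)"
        unfolding sumE by (intro arg_cong2[where f = "(+)"] sum.cong refl)
          (simp_all only: \<phi>B \<phi>C kl t, simp add: algebra_simps)
      with s Ez have "\<phi> x = 0" if "x \<in> E" for x using that by simp
      then show ?thesis
        using \<phi>B \<phi>C E_eq(1) by (auto simp: kl t D0_def D1_def)
    next
      case 3
      have e: "(int a, int q + int n) - (0, 1) = (int a, int q + int (n - 1))"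
        "(int a, int q + int n) - (0, 1) - (0, 1) = (int a, int q + int (n - 2))"
        using 3 by simp_all
      have "F.generated ((int a, int q + int n) - (0, 1) - (0, 1))"
        unfolding e(2) by (rule gen)
      then obtain v w where "F.syzygy ((int a, int q + int n) - (0, 1)) v"
        "F.syzygy ((int a, int q + int n) - (0, 1)) w"
        and vw: "\<And>m. m \<in> B \<union> C \<Longrightarrow> u m = Var Y0 * v m + Var Y1 * w m"
        by (rule F.syzygy_split[OF same_factor.intros(2) less.prems]) (use 3 in \<open>auto simp: \<epsilon>_def\<close>)
      then have "F.syzygy (int a, int q + int (n - 1)) v" "F.syzygy (int a, int q + int (n - 1)) w"
        unfolding e by auto
      moreover have "n - 1 < n" using 3 by simp
      ultimately have "\<forall>x\<in>B \<union> C. v x = 0" "\<forall>x\<in>B \<union> C. w x = 0"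
        using less.IH by blast+
      then show ?thesis by (simp add: vw)
    qed
  qed
  have syz_all: "u x = 0" if "F.syzygy (int a, b) u" "x \<in> B \<union> C" for b u x
    using syz0[of b u] syz[of "nat (b - int q)" u] that by (cases "b < int q") auto
  show ?thesis
    using that[OF B(4) finC BC card B(1) C] gen_all syz_all unfolding \<epsilon>_def by blast
qed

text \<open>Enumerating \<open>B\<close> before \<open>C\<close> produces the list of degrees.
  Independence over inhomogeneous coefficients is reduced to syzygies by taking homogeneous
  parts.\<close>

lemma van_free_basis:
  fixes a q r :: nat
  assumes "imposes_independent (int a, int q)" "van (int a, int q - 1) = {0}"
    "card X = (a + 1) * q + r"
  shows "\<exists>g. strip_basis a (\<lambda>m. if m < a + 1 - r then int q else int q + 1) g"
proof -
  obtain B C where BC: "finite B" "finite C" "B \<inter> C = {}" "card B + r = a + 1" "card C = r"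
    "B \<subseteq> van (int a, int q)" "C \<subseteq> van (int a, int q + 1)"
    and gen: "\<And>b. forms.generated X c (B \<union> C) (\<lambda>x. x) (\<lambda>x. (int a, if x \<in> B then int q else int q + 1)) (int a, b)"
    and syz: "\<And>b u x. forms.syzygy (B \<union> C) (\<lambda>x. x) (\<lambda>x. (int a, if x \<in> B then int q else int q + 1)) (int a, b) u
      \<Longrightarrow> x \<in> B \<union> C \<Longrightarrow> u x = 0"
    using van_free_basis_set[OF assms] by metis
  define \<epsilon> where "\<epsilon> x = (int a, if x \<in> B then int q else int q + 1)" for x
  note gen = gen[folded \<epsilon>_def] and syz = syz[folded \<epsilon>_def]
  interpret F: forms X c "B \<union> C" "\<lambda>x. x" \<epsilon>
    by standard (use BC in \<open>auto simp: \<epsilon>_def\<close>)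
  let ?k = "a + 1 - r"
  have k: "card B = ?k" using BC(4) by simp
  obtain e0 where e0: "bij_betw e0 {..<?k} B"
    using BC(1) k by (metis ex_bij_betw_nat_finite lessThan_atLeast0)
  obtain e1 where e1: "bij_betw e1 {?k..<a+1} C"
  proof -
    have "card {?k..<a+1} = card C" using BC(4,5) by simp
    then show ?thesis using that BC(2) by (metis finite_same_card_bij finite_atLeastLessThan)
  qed
  define g where "g m = (if m < ?k then e0 m else e1 m)" for m
  have "bij_betw g {..<?k} B" "bij_betw g {?k..<a+1} C"
    using bij_betw_cong[THEN iffD1, OF _ e0, of g] bij_betw_cong[THEN iffD1, OF _ e1, of g]
    by (simp_all add: g_def)
  moreover have un: "{..<?k} \<union> {?k..<a+1} = {..<a+1}" by auto
  ultimately have bij: "bij_betw g {..<a+1} (B \<union> C)"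
    using bij_betw_combine[of g "{..<?k}" B "{?k..<a+1}" C] BC(3) by simp
  have gB: "g m \<in> B \<longleftrightarrow> m < ?k" if "m < a + 1" for m
  proof (cases "m < ?k")
    case True
    then show ?thesis using e0 by (auto simp: g_def bij_betw_def)
  next
    case False
    then have "g m \<in> C" using that e1 by (auto simp: g_def bij_betw_def)
    then show ?thesis using False BC(3) by auto
  qed
  then have \<epsilon>g: "\<epsilon> (g m) = (int a, if m < ?k then int q else int q + 1)" if "m < a + 1" for m
    using that by (simp add: \<epsilon>_def)
  have gBC: "g m \<in> B \<union> C" if "m < a + 1" for m
    using bij that by (auto simp: bij_betw_def)
  have sum_g: "(\<Sum>m<a+1. \<phi> (g m)) = (\<Sum>x\<in>B \<union> C. \<phi> x)" for \<phi> :: "'k bipoly \<Rightarrow> 'k bipoly"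
    using bij by (rule sum.reindex_bij_betw)
  show ?thesis
    unfolding strip_basis_def
  proof (rule exI[of _ g], intro conjI allI impI ballI)
    show "g m \<in> van (int a, if m < ?k then int q else int q + 1)" if "m < a + 1" for m
      using F.g_van[OF gBC[OF that]] \<epsilon>g[OF that] by simp
    show "\<exists>u. (\<forall>m<a+1. u m \<in> S_comp (0, b - (if m < ?k then int q else int q + 1))) \<and>
        f = (\<Sum>m<a+1. u m * g m)" if f: "f \<in> van (int a, b)" for b f
    proof -
      obtain u where u: "F.coeffs (int a, b) u" "f = (\<Sum>x\<in>B \<union> C. u x * x)"
        using gen f unfolding F.generated_def by blast
      have "u (g m) \<in> S_comp (0, b - (if m < ?k then int q else int q + 1))" if "m < a + 1" for m
      proof -
        have "u (g m) \<in> S_comp ((int a, b) - \<epsilon> (g m))"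
          using u(1) gBC[OF that] unfolding F.coeffs_def by blast
        then show ?thesis unfolding \<epsilon>g[OF that] by simp
      qed
      moreover have "f = (\<Sum>m<a+1. u (g m) * g m)"
        using u(2) sum_g[of "\<lambda>x. u x * x"] by simp
      ultimately show ?thesis by (intro exI[of _ "\<lambda>m. u (g m)"] conjI allI impI)
    qed
    show "u m = 0" if y: "\<forall>m<a+1. y_poly (u m)" and s: "(\<Sum>m<a+1. u m * g m) = 0"
      and m: "m < a + 1" for u m
    proof -
      define h where "h = the_inv_into {..<a+1} g"
      have h: "h (g n) = n" if "n < a + 1" for n
        using bij that unfolding h_def bij_betw_def by (intro the_inv_into_f_f) auto
      have "(\<Sum>x\<in>B \<union> C. u (h x) * x) = (\<Sum>m<a+1. u (h (g m)) * g m)"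
        by (rule sum_g[symmetric])
      also have "\<dots> = 0" using s h by simp
      finally have "(\<Sum>x\<in>B \<union> C. u (h x) * x) = 0" .
      \<comment> \<open>Syzygies of the strip reach only the parts of x-degree 0; the others vanish
        because \<open>u m\<close> is a polynomial in y.\<close>
      then have z: "hpart ((int a, b) - \<epsilon> (g m)) (u m) = 0" for b
        using syz[OF F.syzygy_hpart gBC[OF m], of "\<lambda>x. u (h x)" b] by (simp only: h[OF m])
      have "hpart (x, y) (u m) = 0" for x y
      proof (cases "x = 0")
        case True
        have "(int a, y + snd (\<epsilon> (g m))) - \<epsilon> (g m) = (x, y)"
          unfolding \<epsilon>g[OF m] True by simp
        then show ?thesis using z[of "y + snd (\<epsilon> (g m))"] by simp
      next
        case False
        then show ?thesis using hpart_y_poly[OF y[rule_format, OF m]] by simp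
      qed
      then show ?thesis using eq_0_if_hparts[of "u m"] by (simp only: split_paired_all)
    qed
  qed
qed

end

section \<open>The complex of two adjacent strips\<close>

lemma sum_lessThan_add:
  "(\<Sum>k<a + b. f k) = (\<Sum>k<a. f k) + (\<Sum>k<b. f (a + k :: nat) :: 'a::comm_monoid_add)"
  by (induction b) (simp_all add: add.assoc)

declare sum.lessThan_Suc [simp del]

section \<open>Coefficients of the monomials in x\<close>

definition x_exp :: "nat \<Rightarrow> nat \<Rightarrow> (var \<Rightarrow>\<^sub>0 nat)" where
  "x_exp s t = single X0 s + single X1 t"

text \<open>The coefficient of \<open>x_0^s x_1^t\<close> in \<open>p\<close>, seen as a polynomial
  in x over \<open>k[y_0, y_1]\<close>. After the shift of exponents, monomials that still contain x
  belong to other coefficients and are discarded.\<close>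

definition x_coeff :: "nat \<Rightarrow> nat \<Rightarrow> 'k::field bipoly \<Rightarrow> 'k bipoly" where
  "x_coeff s t p = Poly_Mapping.mapp (\<lambda>m c. if lookup m X0 = 0 \<and> lookup m X1 = 0 then c else 0)
     (Poly_Mapping.map_key (\<lambda>m. m + x_exp s t) p)"

lemma lookup_x_coeff:
  "lookup (x_coeff s t p) m =
    (if lookup m X0 = 0 \<and> lookup m X1 = 0 then lookup p (m + x_exp s t) else 0)"
proof -
  have "lookup (Poly_Mapping.map_key (\<lambda>m. m + x_exp s t) p) m = lookup p (m + x_exp s t)" for m
    by (subst map_key.rep_eq) (auto simp: inj_on_def)
  then show ?thesis
    by (simp add: x_coeff_def lookup_mapp when_def in_keys_iff)
qed

lemma y_poly_x_coeff: "y_poly (x_coeff s t p)"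
  by (auto simp: y_poly_def lookup_x_coeff split: if_splits)

lemma x_coeff_0 [simp]: "x_coeff s t 0 = 0"
  by (rule poly_mapping_eqI) (simp add: lookup_x_coeff)

lemma x_coeff_add: "x_coeff s t (p + q) = x_coeff s t p + x_coeff s t q"
  by (rule poly_mapping_eqI) (simp add: lookup_x_coeff lookup_add)

lemma x_coeff_sum: "x_coeff s t (sum f A) = (\<Sum>x\<in>A. x_coeff s t (f x))"
  by (induction A rule: infinite_finite_induct) (simp_all add: x_coeff_add)

lemma x_coeff_eq_0: "(\<And>s t. x_coeff s t p = 0) \<Longrightarrow> p = 0"
proof (rule poly_mapping_eqI)
  fix m :: "var \<Rightarrow>\<^sub>0 nat" assume z: "\<And>s t. x_coeff s t p = 0"
  let ?n = "single Y0 (lookup m Y0) + single Y1 (lookup m Y1)"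
  have "lookup (?n + x_exp (lookup m X0) (lookup m X1)) v = lookup m v" for v
    by (cases v) (simp_all add: lookup_add lookup_single x_exp_def)
  then have "?n + x_exp (lookup m X0) (lookup m X1) = m" by (rule poly_mapping_eqI)
  then have "lookup p m = lookup (x_coeff (lookup m X0) (lookup m X1) p) ?n"
    by (simp add: lookup_x_coeff lookup_add lookup_single)
  then show "lookup p m = lookup 0 m" by (simp add: z)
qed

lemma x_coeff_y_poly_mult:
  assumes "y_poly r"
  shows "x_coeff s t (p * r) = x_coeff s t p * r"
proof -
  have *: "x_coeff s t (single k a * p) = single k a * x_coeff s t p" if k: "lookup k X0 = 0" "lookup k X1 = 0" for k a
  proof (rule poly_mapping_eqI)
    fix m
    show "lookup (x_coeff s t (single k a * p)) m = lookup (single k a * x_coeff s t p) m"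
    proof (cases "lookup m X0 = 0 \<and> lookup m X1 = 0")
      case True
      have "(\<forall>v. lookup k v \<le> lookup (m + x_exp s t) v) \<longleftrightarrow> (\<forall>v. lookup k v \<le> lookup m v)"
        using k by (intro iff_allI, rename_tac v, case_tac v)
          (auto simp: lookup_add lookup_single x_exp_def)
      moreover have "m + x_exp s t - k = m - k + x_exp s t" if "\<forall>v. lookup k v \<le> lookup m v"
        by (rule poly_mapping_eqI) (use that in \<open>simp add: lookup_add lookup_minus\<close>)
      ultimately show ?thesis
        using True by (simp add: lookup_x_coeff lookup_single_mult lookup_minus)
    next
      case False
      then show ?thesis using k by (auto simp: lookup_x_coeff lookup_single_mult lookup_minus)
    qed
  qed
  have "x_coeff s t (r * p) = x_coeff s t ((\<Sum>m\<in>keys r. single m (lookup r m)) * p)"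
    by (simp flip: poly_mapping_sum_single)
  also have "\<dots> = (\<Sum>m\<in>keys r. single m (lookup r m) * x_coeff s t p)"
    unfolding sum_distrib_right x_coeff_sum
    by (intro sum.cong refl *) (use assms in \<open>auto simp: y_poly_def in_keys_iff\<close>)
  also have "\<dots> = r * x_coeff s t p"
    by (simp flip: poly_mapping_sum_single sum_distrib_right)
  finally show ?thesis by (simp add: mult.commute)
qed

lemma x_coeff_X1_mult: "x_coeff s (Suc t) (Var X1 * p) = x_coeff s t p"
proof (rule poly_mapping_eqI)
  fix m
  have "m + x_exp s (Suc t) - single X1 1 = m + x_exp s t"
  proof (rule poly_mapping_eqI)
    show "lookup (m + x_exp s (Suc t) - single X1 1) v = lookup (m + x_exp s t) v" for v
      by (cases v) (simp_all add: lookup_add lookup_minus lookup_single x_exp_def)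
  qed
  then show "lookup (x_coeff s (Suc t) (Var X1 * p)) m = lookup (x_coeff s t p) m"
    by (simp add: lookup_x_coeff lookup_Var_mult lookup_add x_exp_def lookup_single)
qed

lemma x_coeff_X0_mult: "x_coeff (Suc s) t (Var X0 * p) = x_coeff s t p"
proof (rule poly_mapping_eqI)
  fix m
  have "m + x_exp (Suc s) t - single X0 1 = m + x_exp s t"
  proof (rule poly_mapping_eqI)
    show "lookup (m + x_exp (Suc s) t - single X0 1) v = lookup (m + x_exp s t) v" for v
      by (cases v) (simp_all add: lookup_add lookup_minus lookup_single x_exp_def)
  qed
  then show "lookup (x_coeff (Suc s) t (Var X0 * p)) m = lookup (x_coeff s t p) m"
    by (simp add: lookup_x_coeff lookup_Var_mult lookup_add x_exp_def lookup_single)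
qed

text \<open>Starts the induction on the exponent of \<open>x_0\<close> in
  \<open>rel_independent\<close>.\<close>

lemma x_coeff_X0_mult_0: "x_coeff 0 t (Var X0 * p) = 0"
  by (rule poly_mapping_eqI) (simp add: lookup_x_coeff lookup_Var_mult lookup_add x_exp_def lookup_single)

text \<open>\<open>M\<close> is multiplication by x from one strip to the next in the bases
  \<open>A\<close> and \<open>B\<close>: row \<open>m\<close> belongs to \<open>x_0 A_m\<close>, row
  \<open>i + 1 + m\<close> to \<open>x_1 A_m\<close>. Its entries have x-degree 0, so they are
  scalars for the strips.\<close>

locale two_strips = points X c for X :: "'p set" and c :: "'p \<Rightarrow> var \<Rightarrow> 'k::field" +
  fixes i j :: nat and e :: "nat \<Rightarrow> int"
    and A B :: "nat \<Rightarrow> 'k bipoly" and M :: "nat \<Rightarrow> nat \<Rightarrow> 'k bipoly"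
  assumes ind: "imposes_independent (int i, int j)"
    and e_nonneg: "k < i + 2 \<Longrightarrow> 0 \<le> e k"
    and A: "strip_basis i (\<lambda>_. int j + 1) A"
    and B: "strip_basis (i + 1) e B"
    and M_deg: "m < 2 * i + 2 \<Longrightarrow> k < i + 2 \<Longrightarrow> M m k \<in> S_comp (0, int j + 1 - e k)"
    and M0: "m < i + 1 \<Longrightarrow> Var X0 * A m = (\<Sum>k<i+2. M m k * B k)"
    and M1: "m < i + 1 \<Longrightarrow> Var X1 * A m = (\<Sum>k<i+2. M (i + 1 + m) k * B k)"
begin

lemma A_van: "m < i + 1 \<Longrightarrow> A m \<in> van (int i, int j + 1)"
  and A_gen: "f \<in> van (int i, b) \<Longrightarrow>
    \<exists>u. (\<forall>m<i+1. u m \<in> S_comp (0, b - (int j + 1))) \<and> f = (\<Sum>m<i+1. u m * A m)"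
  and A_ind: "(\<And>m. m < i + 1 \<Longrightarrow> y_poly (u m)) \<Longrightarrow> (\<Sum>m<i+1. u m * A m) = 0 \<Longrightarrow> m < i + 1 \<Longrightarrow> u m = 0"
  using A unfolding strip_basis_def by blast+

lemma B_van: "k < i + 2 \<Longrightarrow> B k \<in> van (int i + 1, e k)"
  and B_gen: "f \<in> van (int i + 1, b) \<Longrightarrow>
    \<exists>u. (\<forall>k<i+2. u k \<in> S_comp (0, b - e k)) \<and> f = (\<Sum>k<i+2. u k * B k)"
  and B_ind: "(\<And>k. k < i + 2 \<Longrightarrow> y_poly (u k)) \<Longrightarrow> (\<Sum>k<i+2. u k * B k) = 0 \<Longrightarrow> k < i + 2 \<Longrightarrow> u k = 0"
proof -
  have eq: "int (i + 1) = int i + 1" "i + 1 + 1 = i + 2" by simp_all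
  show "k < i + 2 \<Longrightarrow> B k \<in> van (int i + 1, e k)"
    "f \<in> van (int i + 1, b) \<Longrightarrow>
      \<exists>u. (\<forall>k<i+2. u k \<in> S_comp (0, b - e k)) \<and> f = (\<Sum>k<i+2. u k * B k)"
    "(\<And>k. k < i + 2 \<Longrightarrow> y_poly (u k)) \<Longrightarrow> (\<Sum>k<i+2. u k * B k) = 0 \<Longrightarrow> k < i + 2 \<Longrightarrow> u k = 0"
    using B unfolding strip_basis_def eq by blast+
qed

definition gen :: "nat \<Rightarrow> 'k bipoly" where
  "gen m = (if m < i + 1 then A m else B (m - (i + 1)))"

definition gen_deg :: "nat \<Rightarrow> int \<times> int" where
  "gen_deg m = (if m < i + 1 then (int i, int j + 1) else (int i + 1, e (m - (i + 1))))"

text \<open>\<open>rel m\<close> expresses that \<open>x\<^sub>l [A\<^sub>m] = [x\<^sub>l A\<^sub>m]\<close>.\<close>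

definition rel :: "nat \<Rightarrow> nat \<Rightarrow> 'k bipoly" where
  "rel m k = (if k < i + 1 then (if k = m then Var X0 else if i + 1 + k = m then Var X1 else 0)
     else - M m (k - (i + 1)))"

text \<open>The image of the left map, tested on the entries that belong to the middle term and
  without regard to degrees.\<close>

definition boundary :: "(nat \<Rightarrow> 'k bipoly) \<Rightarrow> bool" where
  "boundary w \<longleftrightarrow> (\<exists>p. \<forall>k<2*i+3. w k = (\<Sum>m<2*i+2. p m * rel m k))"

sublocale forms X c "{..<2*i+3}" gen gen_deg
proof
  show "gen m \<in> van (gen_deg m)" if "m \<in> {..<2*i+3}" for m
    using that A_van B_van[of "m - (i + 1)"] by (auto simp: gen_def gen_deg_def)
qed simp

lemma sum_gens: "(\<Sum>k<2*i+3. f k) = (\<Sum>k<i+1. f k) + (\<Sum>k<i+2. f (i + 1 + k) :: 'k bipoly)"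
  using sum_lessThan_add[of f "i + 1" "i + 2"] by (simp add: eval_nat_numeral)

lemma sum_rels: "(\<Sum>m<2*i+2. f m) = (\<Sum>m<i+1. f m) + (\<Sum>m<i+1. f (i + 1 + m) :: 'k bipoly)"
  using sum_lessThan_add[of f "i + 1" "i + 1"] by (simp add: mult_2)

lemma sum_rel_left:
  assumes "k < i + 1"
  shows "(\<Sum>m<2*i+2. p m * rel m k) = p k * Var X0 + p (i + 1 + k) * Var X1"
proof -
  have "(\<Sum>m<i+1. p m * rel m k) = (\<Sum>m<i+1. if k = m then p m * Var X0 else 0)"
    using assms by (intro sum.cong) (auto simp: rel_def)
  moreover have "(\<Sum>m<i+1. p (i + 1 + m) * rel (i + 1 + m) k) =
      (\<Sum>m<i+1. if k = m then p (i + 1 + m) * Var X1 else 0)"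
    using assms by (intro sum.cong) (auto simp: rel_def)
  ultimately show ?thesis unfolding sum_rels using assms by simp
qed

lemma sum_rel_gen:
  assumes "m < 2 * i + 2"
  shows "(\<Sum>k<2*i+3. rel m k * gen k) = 0"
proof -
  have right: "(\<Sum>k<i+2. rel m (i + 1 + k) * gen (i + 1 + k)) = - (\<Sum>k<i+2. M m k * B k)"
    by (simp add: rel_def gen_def sum_negf)
  show ?thesis
  proof (cases "m < i + 1")
    case True
    have "(\<Sum>k<i+1. rel m k * gen k) = (\<Sum>k<i+1. if m = k then Var X0 * A k else 0)"
      using True by (intro sum.cong) (auto simp: rel_def gen_def)
    then show ?thesis using True right M0[OF True] by (simp add: sum_gens)
  next
    case False
    define n where "n = m - (i + 1)"
    have n: "m = i + 1 + n" "n < i + 1" using False assms by (auto simp: n_def)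
    have "(\<Sum>k<i+1. rel m k * gen k) = (\<Sum>k<i+1. if n = k then Var X1 * A k else 0)"
      by (intro sum.cong) (auto simp: rel_def gen_def n)
    then show ?thesis using n(2) right M1[OF n(2)] by (simp add: sum_gens n(1))
  qed
qed

lemma rel_deg: "m < 2 * i + 2 \<Longrightarrow> k < 2 * i + 3 \<Longrightarrow> rel m k \<in> S_comp ((int i + 1, int j + 1) - gen_deg k)"
  using M_deg[of m "k - (i + 1)"] Var_S_comp[of X0] Var_S_comp[of X1]
  by (auto simp: rel_def gen_deg_def intro!: S_comp_uminus)

lemma boundary_syzygy:
  assumes "\<And>k. k < 2 * i + 3 \<Longrightarrow> w k = (\<Sum>m<2*i+2. p m * rel m k)"
  shows "(\<Sum>k<2*i+3. w k * gen k) = 0"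
proof -
  have "(\<Sum>k<2*i+3. w k * gen k) = (\<Sum>k<2*i+3. \<Sum>m<2*i+2. p m * (rel m k * gen k))"
    using assms by (intro sum.cong) (simp_all add: sum_distrib_right mult.assoc)
  also have "\<dots> = (\<Sum>m<2*i+2. p m * (\<Sum>k<2*i+3. rel m k * gen k))"
    by (subst sum.swap) (simp only: sum_distrib_left)
  also have "\<dots> = 0" using sum_rel_gen by simp
  finally show ?thesis .
qed

lemma boundary_add: "boundary w \<Longrightarrow> boundary w' \<Longrightarrow> boundary (\<lambda>k. w k + w' k)"
  unfolding boundary_def
proof (elim exE)
  fix p p' assume "\<forall>k<2*i+3. w k = (\<Sum>m<2*i+2. p m * rel m k)"
    "\<forall>k<2*i+3. w' k = (\<Sum>m<2*i+2. p' m * rel m k)"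
  then show "\<exists>p. \<forall>k<2*i+3. w k + w' k = (\<Sum>m<2*i+2. p m * rel m k)"
    by (intro exI[of _ "\<lambda>m. p m + p' m"]) (simp add: distrib_right sum.distrib)
qed

lemma boundary_0: "boundary (\<lambda>_. 0)"
  unfolding boundary_def by (intro exI[of _ "\<lambda>_. 0"]) simp

lemma boundary_sum: "finite E \<Longrightarrow> (\<And>d. d \<in> E \<Longrightarrow> boundary (w d)) \<Longrightarrow> boundary (\<lambda>k. \<Sum>d\<in>E. w d k)"
  by (induction E rule: finite_induct) (simp_all add: boundary_0 boundary_add)

lemma boundary_mult: "boundary w \<Longrightarrow> boundary (\<lambda>k. a * w k)"
  unfolding boundary_def
proof (elim exE)
  fix p assume "\<forall>k<2*i+3. w k = (\<Sum>m<2*i+2. p m * rel m k)"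
  then show "\<exists>p. \<forall>k<2*i+3. a * w k = (\<Sum>m<2*i+2. p m * rel m k)"
    by (intro exI[of _ "\<lambda>m. a * p m"]) (simp add: sum_distrib_left mult.assoc)
qed

lemma boundary_cong: "(\<And>k. k < 2 * i + 3 \<Longrightarrow> w k = w' k) \<Longrightarrow> boundary w \<longleftrightarrow> boundary w'"
  by (simp add: boundary_def)

lemma sum_gen_split:
  "(\<Sum>k<2*i+3. w k * gen k) = (\<Sum>k<i+1. w k * A k) + (\<Sum>k<i+2. w (i + 1 + k) * B k)"
  unfolding sum_gens by (simp add: gen_def)

text \<open>The strips \<open>i\<close> and \<open>i + 1\<close> are generated by their bases; from
  \<open>i + 2\<close> on, the splitting in x needs independent conditions in bidegree
  \<open>(i + n - 2, b)\<close>, which those in \<open>(i, j)\<close> imply because \<open>b\<close>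
  is at least \<open>j\<close>.\<close>

lemma generated_strip:
  assumes "b \<ge> int j"
  shows "generated (int i + int n, b)"
proof (induction n rule: less_induct)
  case (less n)
  consider "n = 0" | "n = 1" | "n \<ge> 2" by linarith
  then show ?case
  proof cases
    case 1
    show ?thesis unfolding generated_def
    proof
      fix f assume "f \<in> van (int i + int n, b)"
      with A_gen[of f b] 1 obtain u where u: "\<And>m. m < i + 1 \<Longrightarrow> u m \<in> S_comp (0, b - (int j + 1))"
        "f = (\<Sum>m<i+1. u m * A m)" by auto
      let ?w = "\<lambda>k. if k < i + 1 then u k else 0"
      have "coeffs (int i + int n, b) ?w"
        using u(1) 1 by (auto simp: coeffs_def gen_deg_def)
      moreover have "f = (\<Sum>k<2*i+3. ?w k * gen k)"
        unfolding sum_gen_split u(2) by simp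
      ultimately show "\<exists>u. coeffs (int i + int n, b) u \<and> f = (\<Sum>m<2*i+3. u m * gen m)"
        by blast
    qed
  next
    case 2
    show ?thesis unfolding generated_def
    proof
      fix f assume "f \<in> van (int i + int n, b)"
      with B_gen[of f b] 2 obtain u where u: "\<And>k. k < i + 2 \<Longrightarrow> u k \<in> S_comp (0, b - e k)"
        "f = (\<Sum>k<i+2. u k * B k)" by auto
      let ?w = "\<lambda>k. if k < i + 1 then 0 else u (k - (i + 1))"
      have "coeffs (int i + int n, b) ?w"
        using u(1) 2 by (auto simp: coeffs_def gen_deg_def)
      moreover have "f = (\<Sum>k<2*i+3. ?w k * gen k)"
        unfolding sum_gen_split u(2) by simp
      ultimately show "\<exists>u. coeffs (int i + int n, b) u \<and> f = (\<Sum>m<2*i+3. u m * gen m)"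
        by blast
    qed
  next
    case 3
    have e: "(int i + int n, b) - (1, 0) = (int i + int (n - 1), b)"
      "(int i + int n, b) - (1, 0) - (1, 0) = (int i + int (n - 2), b)"
      using 3 by simp_all
    have "generated ((int i + int n, b) - (1, 0))"
      unfolding e by (rule less) (use 3 in simp)
    moreover have "imposes_independent ((int i + int n, b) - (1, 0) - (1, 0))"
      unfolding e(2) by (rule independent_mono_le[OF ind _ assms]) simp
    moreover have "fst (1::int, 0::int) * fst (int i + int n, b) + snd (1::int, 0::int) * snd (int i + int n, b) \<noteq> 0"
      using 3 by simp
    ultimately show ?thesis
      using generated_step[OF same_factor.intros(1)] by blast
  qed
qed

text \<open>Exactness in the middle, by induction on the excess \<open>n\<close> of the x-degree
  over \<open>i\<close>. For n = 0 only a relation in \<open>A\<close> is left, which is trivial;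
  for n = 1 a combination of the rows of \<open>rel\<close> removes the \<open>A\<close>-part and
  leaves a relation in \<open>B\<close>; for larger n the syzygy splits into two of lower
  x-degree.\<close>

lemma syzygy_boundary:
  assumes "syzygy (a, b) w" "b \<ge> int j"
  shows "boundary w"
proof -
  have "boundary w" if "syzygy (int i + int n, b) w" for n w
    using that
  proof (induction n arbitrary: w rule: less_induct)
    case (less n)
    have wA: "w k \<in> S_comp (int n, b - (int j + 1))" if "k < i + 1" for k
    proof -
      have "k < 2 * i + 3" using that by simp
      then have "w k \<in> S_comp ((int i + int n, b) - gen_deg k)"
        using less.prems unfolding syzygy_def coeffs_def by blast
      then show ?thesis using that by (simp add: gen_deg_def)
    qed
    have wB: "w (i + 1 + k) \<in> S_comp (int n - 1, b - e k)" if "k < i + 2" for k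
    proof -
      have "i + 1 + k < 2 * i + 3" using that by simp
      then have "w (i + 1 + k) \<in> S_comp ((int i + int n, b) - gen_deg (i + 1 + k))"
        using less.prems unfolding syzygy_def coeffs_def by blast
      then show ?thesis by (simp add: gen_deg_def)
    qed
    have s: "(\<Sum>k<i+1. w k * A k) + (\<Sum>k<i+2. w (i + 1 + k) * B k) = 0"
      using less.prems by (simp add: syzygy_def sum_gen_split)
    have wzero: "boundary w" if "\<And>k. k < i + 1 \<Longrightarrow> w k = 0" "\<And>k. k < i + 2 \<Longrightarrow> w (i + 1 + k) = 0"
    proof -
      have "w k = 0" if "k < 2 * i + 3" for k
        using \<open>\<And>k. k < i + 1 \<Longrightarrow> w k = 0\<close> \<open>\<And>k. k < i + 2 \<Longrightarrow> w (i + 1 + k) = 0\<close>[of "k - (i + 1)"] that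
        by (cases "k < i + 1") auto
      then show ?thesis using boundary_cong[of w "\<lambda>_. 0"] boundary_0 by simp
    qed
    consider "n = 0" | "n = 1" | "n \<ge> 2" by linarith
    then show ?case
    proof cases
      case 1
      have zB: "w (i + 1 + k) = 0" if "k < i + 2" for k
        using wB[OF that] 1 by (intro S_comp_neg) auto
      have "w k = 0" if "k < i + 1" for k
      proof (rule A_ind[OF _ _ that])
        show "y_poly (w m)" if "m < i + 1" for m
          using wA[OF that] 1 by (intro y_poly_S_comp) simp
        show "(\<Sum>m<i+1. w m * A m) = 0" using s zB by simp
      qed
      then show ?thesis using zB by (rule wzero)
    next
      case 2
      have "\<exists>s t. y_poly s \<and> y_poly t \<and> w k = s * Var X0 + t * Var X1" if "k < i + 1" for k
      proof -
        have "w k \<in> S_comp (1, b - (int j + 1))" using wA[OF that] 2 by simp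
        then obtain s t where "s \<in> S_comp ((1, b - (int j + 1)) - (1, 0))"
          "t \<in> S_comp ((1, b - (int j + 1)) - (1, 0))" "w k = Var X0 * s + Var X1 * t"
          by (rule split_vars[OF same_factor.intros(1)]) simp
        then show ?thesis using y_poly_S_comp
          by (intro exI[of _ s] exI[of _ t]) (auto simp: mult.commute)
      qed
      then obtain s t where st: "\<And>k. k < i + 1 \<Longrightarrow> y_poly (s k)" "\<And>k. k < i + 1 \<Longrightarrow> y_poly (t k)"
        "\<And>k. k < i + 1 \<Longrightarrow> w k = s k * Var X0 + t k * Var X1" by metis
      \<comment> \<open>\<open>s\<close> and \<open>t\<close> become the coefficients of the
        relations for \<open>x_0 A_m\<close> and \<open>x_1 A_m\<close>, so that \<open>v\<close>
        agrees with \<open>w\<close> on the entries of \<open>A\<close>.\<close>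
      define p where "p m = (if m < i + 1 then s m else t (m - (i + 1)))" for m
      define v where "v k = (\<Sum>m<2*i+2. p m * rel m k)" for k
      have py: "y_poly (p m)" if "m < 2 * i + 2" for m
        using st(1,2) that by (auto simp: p_def)
      have vA: "v k = w k" if "k < i + 1" for k
        unfolding v_def sum_rel_left[OF that] using st(3)[OF that] that by (simp add: p_def)
      have vs: "(\<Sum>k<2*i+3. v k * gen k) = 0"
        by (rule boundary_syzygy) (simp add: v_def)
      \<comment> \<open>The difference is a relation in \<open>B\<close> alone, and its coefficients
        are polynomials in y because the entries of \<open>M\<close> are.\<close>
      have vB: "w (i + 1 + k) - v (i + 1 + k) = 0" if "k < i + 2" for k
      proof (rule B_ind[where u = "\<lambda>k. w (i + 1 + k) - v (i + 1 + k)", OF _ _ that])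
        show "y_poly (w (i + 1 + k) - v (i + 1 + k))" if "k < i + 2" for k
        proof (rule y_poly_diff)
          show "y_poly (w (i + 1 + k))"
            using wB[OF that] 2 by (intro y_poly_S_comp) simp
          show "y_poly (v (i + 1 + k))"
            unfolding v_def
          proof (intro y_poly_sum y_poly_mult)
            fix m assume "m \<in> {..<2*i+2}"
            then have "m < 2 * i + 2" by simp
            then show "y_poly (p m)" "y_poly (rel m (i + 1 + k))"
              using py y_poly_uminus[OF y_poly_S_comp[OF M_deg[OF _ that]]] by (simp_all add: rel_def)
          qed
        qed
        have "(\<Sum>k<i+2. (w (i + 1 + k) - v (i + 1 + k)) * B k) =
            (\<Sum>k<2*i+3. w k * gen k) - (\<Sum>k<2*i+3. v k * gen k)"
          unfolding sum_gen_split by (simp add: left_diff_distrib sum_subtractf vA)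
        also have "\<dots> = 0" using vs less.prems by (simp add: syzygy_def)
        finally show "(\<Sum>k<i+2. (w (i + 1 + k) - v (i + 1 + k)) * B k) = 0" .
      qed
      have "w k = v k" if "k < 2 * i + 3" for k
        using vA[of k] vB[of "k - (i + 1)"] that by (cases "k < i + 1") auto
      then show ?thesis unfolding boundary_def v_def by blast
    next
      case 3
      have e: "(int i + int n, b) - (1, 0) = (int i + int (n - 1), b)"
        "(int i + int n, b) - (1, 0) - (1, 0) = (int i + int (n - 2), b)"
        using 3 by simp_all
      have "generated ((int i + int n, b) - (1, 0) - (1, 0))"
        unfolding e(2) by (rule generated_strip[OF assms(2)])
      then obtain s t where "syzygy ((int i + int n, b) - (1, 0)) s"
        "syzygy ((int i + int n, b) - (1, 0)) t"
        and st: "\<And>k. k \<in> {..<2*i+3} \<Longrightarrow> w k = Var X0 * s k + Var X1 * t k"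
        by (rule syzygy_split[OF same_factor.intros(1) less.prems])
          (use 3 in \<open>auto simp: gen_deg_def\<close>)
      then have "syzygy (int i + int (n - 1), b) s" "syzygy (int i + int (n - 1), b) t"
        unfolding e by auto
      moreover have "n - 1 < n" using 3 by simp
      ultimately have "boundary (\<lambda>k. Var X0 * s k + Var X1 * t k)"
        using less.IH by (intro boundary_add boundary_mult) auto
      then show ?thesis using st boundary_cong[of w] by simp
    qed
  qed
  from this[of "nat (a - int i)" w] assms(1) have "boundary w" if "a \<ge> int i" using that by simp
  moreover have "boundary w" if "a < int i"
  proof -
    have "w k = 0" if "k < 2 * i + 3" for k
    proof (rule S_comp_neg)
      show "w k \<in> S_comp ((a, b) - gen_deg k)"
        using assms(1) that by (simp add: syzygy_def coeffs_def)
      show "fst ((a, b) - gen_deg k) < 0 \<or> snd ((a, b) - gen_deg k) < 0"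
        using \<open>a < int i\<close> by (simp add: gen_deg_def)
    qed
    then show ?thesis using boundary_cong[of w "\<lambda>_. 0"] boundary_0 by simp
  qed
  ultimately show ?thesis by linarith
qed

text \<open>\<open>M\<close> restricted to its first half represents multiplication by
  \<open>x_0\<close>: a kernel vector over \<open>k[y_0, y_1]\<close> combines \<open>A\<close> to a
  polynomial killed by \<open>x_0\<close>, hence to 0, and \<open>A\<close> is independent.\<close>

lemma M_injective:
  assumes "\<And>k. k < i + 2 \<Longrightarrow> (\<Sum>m<i+1. x_coeff s t (w m) * M m k) = 0" and m: "m < i + 1"
  shows "x_coeff s t (w m) = 0"
proof (rule A_ind[where u = "\<lambda>m. x_coeff s t (w m)", OF y_poly_x_coeff _ m])
  have "Var X0 * (\<Sum>m<i+1. x_coeff s t (w m) * A m) = (\<Sum>m<i+1. x_coeff s t (w m) * (Var X0 * A m))"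
    by (simp add: sum_distrib_left mult.left_commute)
  also have "\<dots> = (\<Sum>m<i+1. \<Sum>k<i+2. x_coeff s t (w m) * M m k * B k)"
    by (intro sum.cong refl) (simp only: M0 lessThan_iff sum_distrib_left mult.assoc)
  also have "\<dots> = (\<Sum>k<i+2. (\<Sum>m<i+1. x_coeff s t (w m) * M m k) * B k)"
    by (subst sum.swap) (simp only: sum_distrib_right)
  also have "\<dots> = 0" using assms(1) by simp
  finally show "(\<Sum>m<i+1. x_coeff s t (w m) * A m) = 0" by (rule Var_mult_eq_0)
qed

lemma sum_hpart_shift:
  assumes "finite E" "(\<lambda>x. x + d) ` bideg ` keys p \<subseteq> E"
  shows "(\<Sum>x\<in>E. hpart (x - d) p) = p"
proof -
  have inj: "inj_on (\<lambda>x. x - d) E" by (simp add: inj_on_def)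
  have "(\<Sum>x\<in>E. hpart (x - d) p) = (\<Sum>x\<in>(\<lambda>x. x - d) ` E. hpart x p)"
    by (simp add: sum.reindex[OF inj])
  also have "\<dots> = p"
  proof (rule sum_hpart)
    show "bideg ` keys p \<subseteq> (\<lambda>x. x - d) ` E"
    proof
      fix x assume "x \<in> bideg ` keys p"
      then have "x + d \<in> E" using assms(2) by blast
      then have "x + d - d \<in> (\<lambda>x. x - d) ` E" by (rule imageI)
      then show "x \<in> (\<lambda>x. x - d) ` E" by simp
    qed
  qed (use assms in simp)
  finally show ?thesis .
qed

text \<open>Exactness is known only from y-degree \<open>j\<close> on, so a cycle is cut into
  homogeneous parts. A part of lower y-degree has coefficients of y-degree below \<open>j\<close>,
  as generators have nonnegative y-degree, and the second assumption excludes these.\<close>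

lemma cycle_boundary:
  assumes s: "(\<Sum>k<2*i+3. w k * gen k) = 0"
    and y: "\<And>k d. k < 2 * i + 3 \<Longrightarrow> snd d < int j \<Longrightarrow> hpart d (w k) = 0"
  shows "boundary w"
proof -
  define E where "E = (\<Union>k<2*i+3. (\<lambda>x. x + gen_deg k) ` bideg ` keys (w k))"
  have fin: "finite E" by (simp add: E_def)
  have b: "boundary (\<lambda>k. hpart (d - gen_deg k) (w k))" for d
  proof (cases "snd d < int j")
    case True
    have "hpart (d - gen_deg k) (w k) = 0" if "k < 2 * i + 3" for k
    proof (rule y[OF that])
      show "snd (d - gen_deg k) < int j"
      proof (cases "k < i + 1")
        case False
        then have "0 \<le> e (k - (i + 1))" using that by (intro e_nonneg) linarith
        then show ?thesis using True False by (simp add: gen_deg_def)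
      qed (use True in \<open>simp add: gen_deg_def\<close>)
    qed
    then show ?thesis using boundary_cong[of _ "\<lambda>_. 0"] boundary_0 by simp
  next
    case False
    have "syzygy (fst d, snd d) (\<lambda>k. hpart (d - gen_deg k) (w k))"
      using syzygy_hpart[OF s, of d] by simp
    then show ?thesis by (rule syzygy_boundary) (use False in simp)
  qed
  have "w k = (\<Sum>d\<in>E. hpart (d - gen_deg k) (w k))" if "k < 2 * i + 3" for k
  proof (rule sum_hpart_shift[symmetric, OF fin])
    show "(\<lambda>x. x + gen_deg k) ` bideg ` keys (w k) \<subseteq> E"
      unfolding E_def by (rule UN_upper) (use that in simp)
  qed
  then have "boundary w \<longleftrightarrow> boundary (\<lambda>k. \<Sum>d\<in>E. hpart (d - gen_deg k) (w k))"
    by (rule boundary_cong)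
  then show ?thesis using boundary_sum[OF fin b] by (rule iffD2)
qed

section \<open>The ideal of the generators\<close>

definition gen_ideal :: "'k bipoly set" where
  "gen_ideal = {f. \<exists>u. f = (\<Sum>k<2*i+3. u k * gen k)}"

lemma gen_ideal_add: "f \<in> gen_ideal \<Longrightarrow> g \<in> gen_ideal \<Longrightarrow> f + g \<in> gen_ideal"
  unfolding gen_ideal_def
proof safe
  fix u v show "\<exists>w. (\<Sum>k<2*i+3. u k * gen k) + (\<Sum>k<2*i+3. v k * gen k) = (\<Sum>k<2*i+3. w k * gen k)"
    by (rule exI[of _ "\<lambda>k. u k + v k"]) (simp add: distrib_right sum.distrib)
qed

lemma gen_ideal_0 [simp]: "0 \<in> gen_ideal"
  unfolding gen_ideal_def by (auto intro!: exI[of _ "\<lambda>_. 0"])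

lemma gen_ideal_mult: "f \<in> gen_ideal \<Longrightarrow> p * f \<in> gen_ideal"
  unfolding gen_ideal_def
proof safe
  fix u show "\<exists>w. p * (\<Sum>k<2*i+3. u k * gen k) = (\<Sum>k<2*i+3. w k * gen k)"
    by (rule exI[of _ "\<lambda>k. p * u k"]) (simp add: sum_distrib_left mult.assoc)
qed

lemma gen_ideal_sum: "(\<And>x. x \<in> E \<Longrightarrow> f x \<in> gen_ideal) \<Longrightarrow> sum f E \<in> gen_ideal"
  by (induction E rule: infinite_finite_induct) (auto intro: gen_ideal_add)

lemma van_gen_ideal:
  assumes van: "\<And>d. hpart d f \<in> van d"
    and x: "\<And>d. fst d < int i \<or> snd d < int j \<Longrightarrow> hpart d f = 0"
  shows "f \<in> gen_ideal"
proof -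
  have "hpart d f \<in> gen_ideal" for d
  proof (cases "fst d < int i \<or> snd d < int j")
    case False
    then have "generated (int i + int (nat (fst d - int i)), snd d)"
      by (intro generated_strip) simp
    moreover have "(int i + int (nat (fst d - int i)), snd d) = d"
      using False by (simp add: prod_eq_iff)
    ultimately show ?thesis using van[of d] unfolding generated_def gen_ideal_def by auto
  qed (use x in simp)
  then have "(\<Sum>d\<in>bideg ` keys f. hpart d f) \<in> gen_ideal" by (intro gen_ideal_sum)
  then show ?thesis using sum_hpart[of "bideg ` keys f" f] by simp
qed

text \<open>A combination of relations that vanishes has the form \<open>p = (x\<^sub>1 w, - x\<^sub>0 w)\<close> with
  \<open>x\<^sub>1 M w = x\<^sub>0 M' w\<close>, where \<open>M\<close> and \<open>M'\<close> are the two halves of the matrix, free of \<open>x\<close>.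
  Comparing coefficients of \<open>x\<^sub>0\<^sup>s x\<^sub>1\<^sup>t\<^sup>+\<^sup>1\<close> gives \<open>w = 0\<close> by induction on \<open>s\<close>, as \<open>M\<close> is injective.\<close>

lemma rel_independent:
  assumes z: "\<And>k. k < 2 * i + 3 \<Longrightarrow> (\<Sum>m<2*i+2. p m * rel m k) = 0"
    and m: "m < 2 * i + 2"
  shows "p m = 0"
proof -
  define w where "w k = var_quot X1 (p k)" for k
  have w: "p k = Var X1 * w k \<and> p (i + 1 + k) = - (Var X0 * w k)" if "k < i + 1" for k
  proof -
    have "Var X0 * p k + Var X1 * p (i + 1 + k) = 0"
      using z[of k] sum_rel_left[OF that, of p] that by (simp add: mult.commute)
    from koszul[OF _ this] show ?thesis by (simp add: w_def)
  qed
  have M: "y_poly (M m k)" if "m < 2 * i + 2" "k < i + 2" for m k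
    using M_deg[OF that] by (rule y_poly_S_comp)
  have xM: "x_coeff s t (p * M m k) = x_coeff s t p * M m k"
    "x_coeff s t (p * M (i + 1 + m) k) = x_coeff s t p * M (i + 1 + m) k"
    if "m \<in> {..<i+1}" "k < i + 2" for s t p m k
    by (rule x_coeff_y_poly_mult, rule M, use that in simp_all)+
  have rel: "(\<Sum>m<i+1. Var X1 * w m * M m k) = (\<Sum>m<i+1. Var X0 * w m * M (i + 1 + m) k)" if "k < i + 2" for k
  proof -
    have "i + 1 + k < 2 * i + 3" using that by simp
    from z[OF this] show ?thesis
      unfolding sum_rels by (simp add: rel_def w[simplified] sum_negf)
  qed
  have coeff: "x_coeff s t (w m) = 0" if "m < i + 1" for s t m
    using that
  proof (induction s arbitrary: t m)
    case step: (0 t m)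
    have "(\<Sum>m<i+1. x_coeff 0 t (w m) * M m k) = 0" if k: "k < i + 2" for k
    proof -
      have "(\<Sum>m<i+1. x_coeff 0 t (w m) * M m k) = x_coeff 0 (Suc t) (\<Sum>m<i+1. Var X1 * w m * M m k)"
        unfolding x_coeff_sum by (intro sum.cong refl) (simp only: xM k x_coeff_X1_mult)
      also have "\<dots> = (\<Sum>m<i+1. x_coeff 0 (Suc t) (Var X0 * w m * M (i + 1 + m) k))"
        unfolding rel[OF k] x_coeff_sum ..
      also have "\<dots> = 0"
        by (intro sum.neutral ballI) (simp only: xM k x_coeff_X0_mult_0 mult_zero_left)
      finally show ?thesis .
    qed
    from this step show ?case by (rule M_injective)
  next
    case (Suc s t m)
    have "(\<Sum>m<i+1. x_coeff (Suc s) t (w m) * M m k) = 0" if k: "k < i + 2" for k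
    proof -
      have "(\<Sum>m<i+1. x_coeff (Suc s) t (w m) * M m k) = x_coeff (Suc s) (Suc t) (\<Sum>m<i+1. Var X1 * w m * M m k)"
        unfolding x_coeff_sum by (intro sum.cong refl) (simp only: xM k x_coeff_X1_mult)
      also have "\<dots> = (\<Sum>m<i+1. x_coeff (Suc s) (Suc t) (Var X0 * w m * M (i + 1 + m) k))"
        unfolding rel[OF k] x_coeff_sum ..
      also have "\<dots> = 0"
        by (intro sum.neutral ballI) (simp only: xM k x_coeff_X0_mult Suc.IH lessThan_iff mult_zero_left)
      finally show ?thesis .
    qed
    from this Suc.prems show ?case by (rule M_injective)
  qed
  have "w k = 0" if "k < i + 1" for k
    using coeff[OF that] by (rule x_coeff_eq_0)
  then show ?thesis
    using w[of m] w[of "m - (i + 1)"] m by (cases "m < i + 1") auto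
qed

end

section \<open>Quotients of modules over the coordinate ring\<close>

lemma S_ring_simps [simp]:
  "carrier S_ring = UNIV" "mult S_ring = (*)" "one S_ring = 1" "zero S_ring = 0" "add S_ring = (+)"
  by (simp_all add: S_ring_def)

lemma S_ring_a_inv [simp]: "a_inv S_ring p = - (p :: 'k::field bipoly)"
proof -
  interpret cring "S_ring :: 'k bipoly ring" by (rule S_ring_cring)
  show ?thesis using minus_equality[of "- p" p] by simp
qed

text \<open>Stands in for \<open>B^(s+t) = B^s B^t\<close>. The induction on \<open>t\<close>
  generalises over \<open>Q\<close>: peeling off a last factor \<open>j\<close> replaces
  \<open>Q\<close> by the set of all \<open>i\<close> with \<open>i * j\<close> in
  \<open>Q\<close>.\<close>

lemma irrelevant_power_add_induct:
  fixes Q :: "'k::field bipoly set"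
  assumes "\<And>p q. p \<in> Q \<Longrightarrow> q \<in> Q \<Longrightarrow> p + q \<in> Q"
    and "\<And>b b'. b \<in> irrelevant_power s \<Longrightarrow> b' \<in> irrelevant_power t \<Longrightarrow> b * b' \<in> Q"
    and "p \<in> irrelevant_power (s + t)"
  shows "p \<in> Q"
  using assms
proof (induction t arbitrary: Q p)
  case 0
  have "p * 1 \<in> Q" using 0 by (intro "0.prems"(2)) auto
  then show ?case by simp
next
  case (Suc t)
  from Suc.prems(3) have "p \<in> ideal_prod S_ring (irrelevant_power (s + t)) irrelevant_ideal"
    by simp
  then show ?case
  proof (induction rule: ideal_prod.induct)
    case (prod i j)
    have "i \<in> {i. i * j \<in> Q}"
    proof (rule Suc.IH[OF _ _ prod(1)])
      show "p + q \<in> {i. i * j \<in> Q}" if "p \<in> {i. i * j \<in> Q}" "q \<in> {i. i * j \<in> Q}" for p q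
        using that Suc.prems(1) by (simp add: distrib_right)
      show "b * b' \<in> {i. i * j \<in> Q}" if "b \<in> irrelevant_power s" "b' \<in> irrelevant_power t" for b b'
        using Suc.prems(2)[OF that(1), of "b' * j"] ideal_prod.prod[OF that(2) prod(2), of S_ring]
        by (simp add: mult.assoc)
    qed
    then show ?case by simp
  next
    case (sum s1 s2)
    then show ?case using Suc.prems(1) by simp
  qed
qed

section \<open>The B-torsion of a module\<close>

locale gmod =
  fixes M :: "('k::field bipoly, 'm) gmodule"
  assumes module_M: "Module.module S_ring M"
begin

sublocale Module.module S_ring M
  by (rule module_M)

lemma smult_0 [simp]: "x \<in> carrier M \<Longrightarrow> 0 \<odot>\<^bsub>M\<^esub> x = \<zero>\<^bsub>M\<^esub>"
  and smult_1 [simp]: "x \<in> carrier M \<Longrightarrow> 1 \<odot>\<^bsub>M\<^esub> x = x"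
  and smult_zero [simp]: "p \<odot>\<^bsub>M\<^esub> \<zero>\<^bsub>M\<^esub> = \<zero>\<^bsub>M\<^esub>"
  and smult_carrier [simp]: "x \<in> carrier M \<Longrightarrow> p \<odot>\<^bsub>M\<^esub> x \<in> carrier M"
  using smult_l_null[of x] smult_one[of x] smult_r_null[of p] smult_closed[of p x] by simp_all

lemma smult_minus_1: "x \<in> carrier M \<Longrightarrow> (- 1) \<odot>\<^bsub>M\<^esub> x = \<ominus>\<^bsub>M\<^esub> x"
  using smult_l_minus[of 1 x] by simp

lemma submodule_Gamma_B: "submodule (Gamma_B M) S_ring M"
proof (rule submoduleI)
  show "Gamma_B M \<subseteq> carrier M" by (auto simp: Gamma_B_def)
  show "\<zero>\<^bsub>M\<^esub> \<in> Gamma_B M" by (auto simp: Gamma_B_def)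
next
  fix x assume x: "x \<in> Gamma_B M"
    then obtain t where t: "\<And>b. b \<in> irrelevant_power t \<Longrightarrow> b \<odot>\<^bsub>M\<^esub> x = \<zero>\<^bsub>M\<^esub>" and xc: "x \<in> carrier M"
      by (auto simp: Gamma_B_def)
    have "b \<odot>\<^bsub>M\<^esub> (\<ominus>\<^bsub>M\<^esub> x) = \<zero>\<^bsub>M\<^esub>" if "b \<in> irrelevant_power t" for b
      using t[OF that] xc smult_r_minus[of b x] by simp
    then show "\<ominus>\<^bsub>M\<^esub> x \<in> Gamma_B M" using xc by (auto simp: Gamma_B_def)
  next
    fix x y assume "x \<in> Gamma_B M" "y \<in> Gamma_B M"
    then obtain s t where s: "\<And>b. b \<in> irrelevant_power s \<Longrightarrow> b \<odot>\<^bsub>M\<^esub> x = \<zero>\<^bsub>M\<^esub>" and xc: "x \<in> carrier M"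
      and t: "\<And>b. b \<in> irrelevant_power t \<Longrightarrow> b \<odot>\<^bsub>M\<^esub> y = \<zero>\<^bsub>M\<^esub>" and yc: "y \<in> carrier M"
      by (auto simp: Gamma_B_def)
    \<comment> \<open>If \<open>B^s\<close> kills \<open>x\<close> and \<open>B^t\<close> kills
      \<open>y\<close>, products of their elements kill both.\<close>
    have "b \<in> {b. b \<odot>\<^bsub>M\<^esub> (x \<oplus>\<^bsub>M\<^esub> y) = \<zero>\<^bsub>M\<^esub>}" if "b \<in> irrelevant_power (s + t)" for b
    proof (rule irrelevant_power_add_induct[OF _ _ that])
      show "p + q \<in> {b. b \<odot>\<^bsub>M\<^esub> (x \<oplus>\<^bsub>M\<^esub> y) = \<zero>\<^bsub>M\<^esub>}"
        if "p \<in> {b. b \<odot>\<^bsub>M\<^esub> (x \<oplus>\<^bsub>M\<^esub> y) = \<zero>\<^bsub>M\<^esub>}" "q \<in> {b. b \<odot>\<^bsub>M\<^esub> (x \<oplus>\<^bsub>M\<^esub> y) = \<zero>\<^bsub>M\<^esub>}" for p q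
        using that xc yc smult_l_distr[of p q "x \<oplus>\<^bsub>M\<^esub> y"] by simp
      show "b * b' \<in> {b. b \<odot>\<^bsub>M\<^esub> (x \<oplus>\<^bsub>M\<^esub> y) = \<zero>\<^bsub>M\<^esub>}"
        if "b \<in> irrelevant_power s" "b' \<in> irrelevant_power t" for b b'
      proof -
        have "(b * b') \<odot>\<^bsub>M\<^esub> x = b' \<odot>\<^bsub>M\<^esub> (b \<odot>\<^bsub>M\<^esub> x)" "(b * b') \<odot>\<^bsub>M\<^esub> y = b \<odot>\<^bsub>M\<^esub> (b' \<odot>\<^bsub>M\<^esub> y)"
          using smult_assoc1[of b' b x] smult_assoc1[of b b' y] xc yc by (simp_all add: mult.commute)
        then show ?thesis
          using s[OF that(1)] t[OF that(2)] xc yc smult_r_distr[of "b * b'" x y] by simp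
      qed
    qed
    then show "x \<oplus>\<^bsub>M\<^esub> y \<in> Gamma_B M" using xc yc by (auto simp: Gamma_B_def)
next
  show "p \<odot>\<^bsub>M\<^esub> x \<in> Gamma_B M" if "p \<in> carrier S_ring" and x: "x \<in> Gamma_B M" for p x
  proof -
    from x obtain t where t: "\<And>b. b \<in> irrelevant_power t \<Longrightarrow> b \<odot>\<^bsub>M\<^esub> x = \<zero>\<^bsub>M\<^esub>" and xc: "x \<in> carrier M"
      by (auto simp: Gamma_B_def)
    have "b \<odot>\<^bsub>M\<^esub> (p \<odot>\<^bsub>M\<^esub> x) = \<zero>\<^bsub>M\<^esub>" if "b \<in> irrelevant_power t" for b
      using smult_assoc1[of b p x] smult_assoc1[of p b x] xc t[OF that] by (simp add: mult.commute)
    then show ?thesis using xc by (auto simp: Gamma_B_def)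
  qed
qed

end

section \<open>Quotient modules and saturation\<close>

locale gquot = gmod M for M :: "('k::field bipoly, 'm) gmodule" +
  fixes N :: "'m set"
  assumes submodule_N: "submodule N S_ring M"
begin

sublocale N: submodule N S_ring M
  by (rule submodule_N)

sublocale abelian_subgroup N M
  by (rule abelian_subgroupI3) (auto intro: additive_subgroupI N.subgroup_axioms abelian_group_axioms)

abbreviation Q where "Q \<equiv> quot_gmodule M N"

abbreviation cls where "cls x \<equiv> N +>\<^bsub>M\<^esub> x"

lemma cls_eq_iff:
  assumes "x \<in> carrier M" "y \<in> carrier M"
  shows "cls x = cls y \<longleftrightarrow> x \<oplus>\<^bsub>M\<^esub> \<ominus>\<^bsub>M\<^esub> y \<in> N"
proof -
  have "cls x = cls y \<longleftrightarrow> x \<in> cls y"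
    using a_rcos_self[OF assms(1)] a_repr_independence'[OF _ assms(2)] by blast
  then show ?thesis using a_rcos_module[OF assms(2,1)] by simp
qed

lemma carrier_Q: "carrier Q = cls ` carrier M"
  by (auto simp: quot_gmodule_def A_RCOSETS_def')

lemma cls_Q [simp]: "x \<in> carrier M \<Longrightarrow> cls x \<in> carrier Q"
  by (simp add: carrier_Q)

lemma add_Q: "x \<in> carrier M \<Longrightarrow> y \<in> carrier M \<Longrightarrow> cls x \<oplus>\<^bsub>Q\<^esub> cls y = cls (x \<oplus>\<^bsub>M\<^esub> y)"
  by (simp add: quot_gmodule_def a_rcos_sum)

lemma zero_Q: "\<zero>\<^bsub>Q\<^esub> = cls \<zero>\<^bsub>M\<^esub>"
  by (simp add: quot_gmodule_def a_subset)

text \<open>The definition unites the cosets of \<open>p y\<close> over all representatives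
  \<open>y\<close>; they coincide since \<open>N\<close> is a submodule.\<close>

lemma smult_Q:
  assumes x: "x \<in> carrier M"
  shows "p \<odot>\<^bsub>Q\<^esub> cls x = cls (p \<odot>\<^bsub>M\<^esub> x)"
proof -
  have "cls (p \<odot>\<^bsub>M\<^esub> y) = cls (p \<odot>\<^bsub>M\<^esub> x)" if y: "y \<in> cls x" for y
  proof -
    have yc: "y \<in> carrier M" using y x by (rule a_elemrcos_carrier[rotated])
    have "y \<oplus>\<^bsub>M\<^esub> \<ominus>\<^bsub>M\<^esub> x \<in> N" using a_rcos_module[OF x yc] y by simp
    then have "p \<odot>\<^bsub>M\<^esub> (y \<oplus>\<^bsub>M\<^esub> \<ominus>\<^bsub>M\<^esub> x) \<in> N" by (intro N.smult_closed) simp_all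
    then show ?thesis
      using x yc smult_r_distr[of p y "\<ominus>\<^bsub>M\<^esub> x"] smult_r_minus[of p x] by (simp add: cls_eq_iff)
  qed
  then have "(\<Union>y\<in>cls x. cls (p \<odot>\<^bsub>M\<^esub> y)) = (\<Union>y\<in>cls x. cls (p \<odot>\<^bsub>M\<^esub> x))"
    by simp
  also have "\<dots> = cls (p \<odot>\<^bsub>M\<^esub> x)" using a_rcos_self[OF x] by blast
  finally show ?thesis by (simp add: quot_gmodule_def)
qed

lemma hcomp_Q: "hcomp Q e = cls ` hcomp M e"
  by (simp add: quot_gmodule_def)

lemma module_Q: "Module.module S_ring Q"
proof (rule moduleI)
  show "cring S_ring" by (rule S_ring_cring)
  show "abelian_group Q"
  proof (rule abelian_groupI)
    show "\<exists>y\<in>carrier Q. y \<oplus>\<^bsub>Q\<^esub> x = \<zero>\<^bsub>Q\<^esub>" if "x \<in> carrier Q" for x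
    proof -
      from that obtain z where z: "x = cls z" "z \<in> carrier M" by (auto simp: carrier_Q)
      have "cls (\<ominus>\<^bsub>M\<^esub> z) \<oplus>\<^bsub>Q\<^esub> x = \<zero>\<^bsub>Q\<^esub>" using z by (simp add: add_Q zero_Q l_neg)
      then show ?thesis using z by auto
    qed
  qed (auto simp: carrier_Q add_Q zero_Q a_ac)
qed (use smult_l_distr smult_r_distr smult_assoc1 in \<open>auto simp: carrier_Q add_Q smult_Q\<close>)

sublocale Q: gmod Q
  by (rule gmod.intro[OF module_Q])

lemma a_inv_Q: "x \<in> carrier M \<Longrightarrow> \<ominus>\<^bsub>Q\<^esub> cls x = cls (\<ominus>\<^bsub>M\<^esub> x)"
  using Q.smult_minus_1[of "cls x"] smult_minus_1[of x] by (simp add: smult_Q)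

lemma finsum_Q: "finite E \<Longrightarrow> s \<in> E \<rightarrow> carrier M \<Longrightarrow> finsum Q (\<lambda>e. cls (s e)) E = cls (finsum M s E)"
proof (induction E rule: finite_induct)
  case (insert e E)
  then have "(\<lambda>e. cls (s e)) \<in> E \<rightarrow> carrier Q" by (auto simp: Pi_iff)
  with insert show ?case by (simp add: add_Q)
qed (simp add: zero_Q)

text \<open>The saturation of \<open>N\<close> with respect to \<open>B\<close>. Dividing
  \<open>M / N\<close> by its B-torsion amounts to dividing \<open>M\<close> by this
  submodule.\<close>

definition sat :: "'m set" where
  "sat = {x \<in> carrier M. \<exists>t. \<forall>b\<in>irrelevant_power t. b \<odot>\<^bsub>M\<^esub> x \<in> N}"

lemma cls_in_Gamma_B: "x \<in> carrier M \<Longrightarrow> cls x \<in> Gamma_B Q \<longleftrightarrow> x \<in> sat"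
  using cls_eq_iff[of _ "\<zero>\<^bsub>M\<^esub>"] minus_equality[of "\<zero>\<^bsub>M\<^esub>" "\<zero>\<^bsub>M\<^esub>"] by (simp add: Gamma_B_def sat_def smult_Q zero_Q)

lemma gquot_Gamma_B: "gquot Q (Gamma_B Q)"
  by (intro gquot.intro Q.gmod_axioms gquot_axioms.intro Q.submodule_Gamma_B)

interpretation QQ: gquot Q "Gamma_B Q"
  by (rule gquot_Gamma_B)

abbreviation ccls where "ccls x \<equiv> Gamma_B Q +>\<^bsub>Q\<^esub> cls x"

lemma ccls_eq_iff:
  "x \<in> carrier M \<Longrightarrow> y \<in> carrier M \<Longrightarrow> ccls x = ccls y \<longleftrightarrow> x \<oplus>\<^bsub>M\<^esub> \<ominus>\<^bsub>M\<^esub> y \<in> sat"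
  by (simp add: QQ.cls_eq_iff a_inv_Q add_Q cls_in_Gamma_B)

lemma carrier_QQ: "carrier QQ.Q = ccls ` carrier M"
  by (auto simp: QQ.carrier_Q carrier_Q)

lemma hcomp_QQ: "hcomp QQ.Q e = ccls ` hcomp M e"
  by (auto simp: QQ.hcomp_Q hcomp_Q)

end

text \<open>An isomorphism of the ambient modules that matches the two saturations descends to the
  double quotients. The submodules themselves may differ, as may the ideal of the generators and the
  ideal of the points.\<close>

lemma graded_iso_mod_Gamma:
  fixes M1 :: "('k::field bipoly, 'm) gmodule" and M2 :: "('k bipoly, 'n) gmodule"
  assumes "gquot M1 N1" "gquot M2 N2"
    and bij: "bij_betw \<phi> (carrier M1) (carrier M2)"
    and add: "\<And>x y. x \<in> carrier M1 \<Longrightarrow> y \<in> carrier M1 \<Longrightarrow> \<phi> (x \<oplus>\<^bsub>M1\<^esub> y) = \<phi> x \<oplus>\<^bsub>M2\<^esub> \<phi> y"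
    and smult: "\<And>p x. x \<in> carrier M1 \<Longrightarrow> \<phi> (p \<odot>\<^bsub>M1\<^esub> x) = p \<odot>\<^bsub>M2\<^esub> \<phi> x"
    and graded: "\<And>e. hcomp M1 e \<subseteq> carrier M1 \<and> \<phi> ` hcomp M1 e \<subseteq> hcomp M2 e"
    and sat: "\<And>x. x \<in> carrier M1 \<Longrightarrow> x \<in> gquot.sat M1 N1 \<longleftrightarrow> \<phi> x \<in> gquot.sat M2 N2"
  shows "graded_iso (quot_gmodule (quot_gmodule M1 N1) (Gamma_B (quot_gmodule M1 N1)))
    (quot_gmodule (quot_gmodule M2 N2) (Gamma_B (quot_gmodule M2 N2)))"
proof -
  interpret A: gquot M1 N1 by fact
  interpret B: gquot M2 N2 by fact
  interpret Q1: gquot "quot_gmodule M1 N1" "Gamma_B (quot_gmodule M1 N1)" by (rule A.gquot_Gamma_B)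
  interpret Q2: gquot "quot_gmodule M2 N2" "Gamma_B (quot_gmodule M2 N2)" by (rule B.gquot_Gamma_B)
  have closed: "\<phi> x \<in> carrier M2" if "x \<in> carrier M1" for x
    using bij that by (auto simp: bij_betw_def)
  have eq: "A.ccls x = A.ccls y \<longleftrightarrow> B.ccls (\<phi> x) = B.ccls (\<phi> y)"
    if "x \<in> carrier M1" "y \<in> carrier M1" for x y
  proof -
    have "\<phi> (x \<oplus>\<^bsub>M1\<^esub> \<ominus>\<^bsub>M1\<^esub> y) = \<phi> x \<oplus>\<^bsub>M2\<^esub> \<ominus>\<^bsub>M2\<^esub> \<phi> y"
      using that smult[of y "- 1"] by (simp add: add A.smult_minus_1 B.smult_minus_1 closed)
    then show ?thesis using that by (simp add: A.ccls_eq_iff B.ccls_eq_iff closed sat)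
  qed
  \<comment> \<open>Defined through a chosen representative; \<open>eq\<close> gives both
    well-definedness and injectivity.\<close>
  define f where "f C = B.ccls (\<phi> (SOME x. x \<in> carrier M1 \<and> A.ccls x = C))" for C
  have f: "f (A.ccls x) = B.ccls (\<phi> x)" if x: "x \<in> carrier M1" for x
  proof -
    let ?y = "SOME y. y \<in> carrier M1 \<and> A.ccls y = A.ccls x"
    have "?y \<in> carrier M1 \<and> A.ccls ?y = A.ccls x" by (rule someI[of _ x]) (use x in simp)
    then show ?thesis using eq[of ?y x] x by (simp add: f_def)
  qed
  have "graded_hom Q1.Q Q2.Q f"
    unfolding graded_hom_def A.carrier_QQ
  proof (intro conjI ballI allI)
    show "f \<in> A.ccls ` carrier M1 \<rightarrow> carrier Q2.Q"
      by (auto simp: f closed B.carrier_QQ)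
    show "f (C \<oplus>\<^bsub>Q1.Q\<^esub> D) = f C \<oplus>\<^bsub>Q2.Q\<^esub> f D" if "C \<in> A.ccls ` carrier M1" "D \<in> A.ccls ` carrier M1" for C D
      using that by (auto simp: f closed Q1.add_Q A.add_Q Q2.add_Q B.add_Q add)
    show "f (p \<odot>\<^bsub>Q1.Q\<^esub> C) = p \<odot>\<^bsub>Q2.Q\<^esub> f C" if "C \<in> A.ccls ` carrier M1" for p C
      using that by (auto simp: f closed Q1.smult_Q A.smult_Q Q2.smult_Q B.smult_Q smult)
    show "f ` hcomp Q1.Q e \<subseteq> hcomp Q2.Q e" for e
      using graded[of e] by (auto simp: f A.hcomp_QQ B.hcomp_QQ subset_iff)
  qed
  moreover have "bij_betw f (carrier Q1.Q) (carrier Q2.Q)"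
    unfolding bij_betw_def
  proof
    show "inj_on f (carrier Q1.Q)"
      by (auto simp: inj_on_def A.carrier_QQ f eq)
    have "f ` carrier Q1.Q = B.ccls ` \<phi> ` carrier M1"
      by (simp add: A.carrier_QQ image_image f)
    then show "f ` carrier Q1.Q = carrier Q2.Q"
      using bij by (simp add: bij_betw_def B.carrier_QQ)
  qed
  ultimately show ?thesis unfolding graded_iso_def by blast
qed

section \<open>Free modules and homology\<close>

lemma S_gmodule_simps [simp]:
  "carrier S_gmodule = UNIV" "add S_gmodule = (+)" "zero S_gmodule = 0"
  "smult S_gmodule = (*)" "hcomp S_gmodule = S_comp"
  by (simp_all add: S_gmodule_def)

lemma module_S_gmodule: "Module.module S_ring (S_gmodule :: ('k::field bipoly, 'k bipoly) gmodule)"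
proof (rule moduleI)
  show "abelian_group (S_gmodule :: ('k bipoly, 'k bipoly) gmodule)"
  proof (rule abelian_groupI)
    show "\<exists>y\<in>carrier S_gmodule. y \<oplus>\<^bsub>S_gmodule\<^esub> x = \<zero>\<^bsub>S_gmodule\<^esub>" for x :: "'k bipoly"
      by (auto intro: exI[of _ "- x"])
  qed (auto simp: add_ac)
qed (auto simp: S_ring_cring algebra_simps)

lemma S_a_inv [simp]: "\<ominus>\<^bsub>S_gmodule\<^esub> p = - (p :: 'k::field bipoly)"
proof -
  interpret Module.module S_ring "S_gmodule :: ('k bipoly, 'k bipoly) gmodule" by (rule module_S_gmodule)
  show ?thesis using M.minus_equality[of "- p" p] by simp
qed

lemma S_finsum [simp]: "finite E \<Longrightarrow> finsum S_gmodule f E = (sum f E :: 'k::field bipoly)"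
proof (induction E rule: finite_induct)
  interpret Module.module S_ring "S_gmodule :: ('k bipoly, 'k bipoly) gmodule" by (rule module_S_gmodule)
  case empty
  show ?case by simp
next
  interpret Module.module S_ring "S_gmodule :: ('k bipoly, 'k bipoly) gmodule" by (rule module_S_gmodule)
  case (insert x E)
  then show ?case by simp
qed

lemma free_gmodule_simps [simp]:
  "carrier (free_gmodule ds) = {v. \<forall>n\<ge>length ds. v n = 0}"
  "v \<oplus>\<^bsub>free_gmodule ds\<^esub> w = (\<lambda>n. v n + w n)"
  "\<zero>\<^bsub>free_gmodule ds\<^esub> = (\<lambda>_. 0)"
  "p \<odot>\<^bsub>free_gmodule ds\<^esub> v = (\<lambda>n. p * v n)"
  by (simp_all add: free_gmodule_def)

lemma hcomp_free_gmodule: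
  "v \<in> hcomp (free_gmodule ds) e \<longleftrightarrow>
    (\<forall>n\<ge>length ds. v n = 0) \<and> (\<forall>n<length ds. v n \<in> S_comp (e - ds ! n))"
  by (simp add: free_gmodule_def minus_prod_def)

lemma module_free_gmodule: "Module.module S_ring (free_gmodule ds :: ('k::field bipoly, _) gmodule)"
proof (rule moduleI)
  show "abelian_group (free_gmodule ds :: ('k bipoly, _) gmodule)"
  proof (rule abelian_groupI)
    fix x :: "nat \<Rightarrow> 'k bipoly" assume "x \<in> carrier (free_gmodule ds)"
    then have "(\<lambda>n. - x n) \<in> carrier (free_gmodule ds)"
      "(\<lambda>n. - x n) \<oplus>\<^bsub>free_gmodule ds\<^esub> x = \<zero>\<^bsub>free_gmodule ds\<^esub>" by simp_all
    then show "\<exists>y\<in>carrier (free_gmodule ds). y \<oplus>\<^bsub>free_gmodule ds\<^esub> x = \<zero>\<^bsub>free_gmodule ds\<^esub>" by blast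
  qed (auto simp: add_ac)
qed (auto simp: S_ring_cring algebra_simps)

section \<open>Maps given by matrices, and the homology of a complex\<close>

definition matrix_map ::
  "(nat \<Rightarrow> nat \<Rightarrow> 'k::field bipoly) \<Rightarrow> nat \<Rightarrow> nat \<Rightarrow> (nat \<Rightarrow> 'k bipoly) \<Rightarrow> nat \<Rightarrow> 'k bipoly" where
  "matrix_map A m n v = (\<lambda>k. if k < n then \<Sum>l<m. v l * A l k else 0)"

lemma graded_hom_matrix_map:
  assumes "\<And>l k. l < length ds \<Longrightarrow> k < length ds' \<Longrightarrow> A l k \<in> S_comp (ds ! l - ds' ! k)"
  shows "graded_hom (free_gmodule ds) (free_gmodule ds') (matrix_map A (length ds) (length ds'))"
  unfolding graded_hom_def
proof (intro conjI ballI allI)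
  show "matrix_map A (length ds) (length ds') ` hcomp (free_gmodule ds) e \<subseteq> hcomp (free_gmodule ds') e" for e
  proof safe
    fix v :: "nat \<Rightarrow> 'a bipoly" assume v: "v \<in> hcomp (free_gmodule ds) e"
    have "(\<Sum>l<length ds. v l * A l k) \<in> S_comp (e - ds' ! k)" if "k < length ds'" for k
    proof (rule S_comp_sum)
      fix l assume "l \<in> {..<length ds}"
      then have "v l * A l k \<in> S_comp ((e - ds ! l) + (ds ! l - ds' ! k))"
        using v assms[of l k] that by (intro S_comp_mult) (auto simp: hcomp_free_gmodule)
      then show "v l * A l k \<in> S_comp (e - ds' ! k)" by simp
    qed
    then show "matrix_map A (length ds) (length ds') v \<in> hcomp (free_gmodule ds') e"
      by (simp add: hcomp_free_gmodule matrix_map_def)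
  qed
qed (auto simp: matrix_map_def fun_eq_iff distrib_right sum.distrib sum_distrib_left mult.assoc)

lemma graded_hom_zero: "graded_hom (free_gmodule ds) (free_gmodule ds') (\<lambda>_ _. 0)"
  by (auto simp: graded_hom_def hcomp_free_gmodule)

lemma homology_0:
  fixes \<delta> :: "nat \<Rightarrow> (nat \<Rightarrow> 'k::field bipoly) \<Rightarrow> nat \<Rightarrow> 'k bipoly"
  assumes "F 0 = [(0, 0)]"
  shows "homology F \<delta> 0 = quot_gmodule (free_gmodule [(0, 0)]) (\<delta> (Suc 0) ` carrier (free_gmodule (F (Suc 0))))"
proof -
  have "cycles F \<delta> 0 = carrier (free_gmodule [(0, 0)])"
    by (simp add: cycles_def assms)
  moreover have "sub_gmodule (free_gmodule ds) (carrier (free_gmodule ds)) =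
      (free_gmodule ds :: ('k bipoly, nat \<Rightarrow> 'k bipoly) gmodule)" for ds
  proof -
    have "(\<lambda>e. hcomp (free_gmodule ds) e \<inter> carrier (free_gmodule ds)) =
        hcomp (free_gmodule ds :: ('k bipoly, nat \<Rightarrow> 'k bipoly) gmodule)"
      by (auto simp: hcomp_free_gmodule fun_eq_iff)
    then show ?thesis by (simp add: sub_gmodule_def del: free_gmodule_simps)
  qed
  ultimately show ?thesis by (simp only: homology_def assms)
qed

text \<open>A homology class is a translate \<open>N + z\<close> of the image \<open>N\<close>. With
  \<open>b z\<close> in \<open>N\<close>, every translate in the union that defines
  \<open>b h\<close> is \<open>N\<close> itself, the zero class.\<close>

lemma homology_killed:
  fixes \<delta> :: "nat \<Rightarrow> (nat \<Rightarrow> 'k::field bipoly) \<Rightarrow> nat \<Rightarrow> 'k bipoly"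
  assumes hom: "graded_hom (free_gmodule (F (Suc n))) (free_gmodule (F n)) (\<delta> (Suc n))"
    and kill: "\<And>z. z \<in> cycles F \<delta> n \<Longrightarrow> (\<lambda>k. b * z k) \<in> \<delta> (Suc n) ` carrier (free_gmodule (F (Suc n)))"
    and h: "h \<in> carrier (homology F \<delta> n)"
  shows "b \<odot>\<^bsub>homology F \<delta> n\<^esub> h = \<zero>\<^bsub>homology F \<delta> n\<^esub>"
proof -
  let ?Fn = "free_gmodule (F n) :: ('k bipoly, nat \<Rightarrow> 'k bipoly) gmodule"
    and ?F1 = "free_gmodule (F (Suc n)) :: ('k bipoly, nat \<Rightarrow> 'k bipoly) gmodule"
  define N where "N = \<delta> (Suc n) ` carrier ?F1"
  have cos: "N +>\<^bsub>sub_gmodule ?Fn C\<^esub> x = (\<lambda>v k. v k + x k) ` N" for C and x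
    by (auto simp: a_r_coset_def' sub_gmodule_def)
  have add: "(\<lambda>k. v k + w k) \<in> N" if "v \<in> N" "w \<in> N" for v w
  proof -
    from that obtain v' w' where "v' \<in> carrier ?F1" "v = \<delta> (Suc n) v'"
      "w' \<in> carrier ?F1" "w = \<delta> (Suc n) w'" by (auto simp: N_def)
    then have "v' \<oplus>\<^bsub>?F1\<^esub> w' \<in> carrier ?F1" "(\<lambda>k. v k + w k) = \<delta> (Suc n) (v' \<oplus>\<^bsub>?F1\<^esub> w')"
      using hom by (simp_all add: graded_hom_def)
    then show ?thesis by (auto simp: N_def)
  qed
  have smult: "(\<lambda>k. p * v k) \<in> N" if "v \<in> N" for p v
  proof -
    from that obtain v' where "v' \<in> carrier ?F1" "v = \<delta> (Suc n) v'" by (auto simp: N_def)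
    then have "p \<odot>\<^bsub>?F1\<^esub> v' \<in> carrier ?F1" "(\<lambda>k. p * v k) = \<delta> (Suc n) (p \<odot>\<^bsub>?F1\<^esub> v')"
      using hom by (simp_all add: graded_hom_def)
    then show ?thesis by (auto simp: N_def)
  qed
  have coset_N: "(\<lambda>v k. v k + x k) ` N = N" if "x \<in> N" for x
  proof
    show "(\<lambda>v k. v k + x k) ` N \<subseteq> N" using add that by auto
    show "N \<subseteq> (\<lambda>v k. v k + x k) ` N"
    proof
      fix v assume v: "v \<in> N"
      have "(\<lambda>k. v k + (- 1) * x k) \<in> N" using add[OF v smult[OF that, of "- 1"]] .
      then show "v \<in> (\<lambda>v k. v k + x k) ` N"
        by (rule rev_image_eqI) simp
    qed
  qed
  have "carrier (homology F \<delta> n) =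
      (\<Union>z\<in>carrier (sub_gmodule ?Fn (cycles F \<delta> n)). {(\<lambda>v k. v k + z k) ` N})"
    unfolding homology_def quot_gmodule_def A_RCOSETS_def' N_def[symmetric] cos by simp
  then obtain z where z: "z \<in> cycles F \<delta> n" "h = (\<lambda>v k. v k + z k) ` N"
    using h by (auto simp: sub_gmodule_def)
  have "(\<lambda>k. b * x k) \<in> N" if "x \<in> h" for x
  proof -
    from that z obtain v where v: "v \<in> N" "x = (\<lambda>k. v k + z k)" by auto
    then have "(\<lambda>k. b * x k) = (\<lambda>k. b * v k + b * z k)" by (simp add: distrib_left)
    then show ?thesis using add[OF smult[OF v(1)] kill[OF z(1), folded N_def], of b] by simp
  qed
  then have "(\<Union>x\<in>h. (\<lambda>v k. v k + b * x k) ` N) = (\<Union>x\<in>h. N)"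
    using coset_N by (intro SUP_cong) auto
  also have "\<dots> = N"
  proof -
    have "(\<lambda>_. 0) \<in> carrier ?F1" by simp
    then have "N \<noteq> {}" by (auto simp: N_def)
    then show ?thesis using z(2) by auto
  qed
  finally have "(\<Union>x\<in>h. (\<lambda>v k. v k + b * x k) ` N) = N" .
  moreover have "p \<odot>\<^bsub>sub_gmodule ?Fn C\<^esub> x = (\<lambda>k. p * x k)" for p x and C
    by (simp add: sub_gmodule_def)
  ultimately show ?thesis
    unfolding homology_def quot_gmodule_def N_def[symmetric] by (simp add: cos)
qed

section \<open>Ideals of the coordinate ring and powers of \<open>B\<close>\<close>

lemma ideal_S_ringI:
  fixes I :: "'k::field bipoly set"
  assumes "0 \<in> I" "\<And>p q. p \<in> I \<Longrightarrow> q \<in> I \<Longrightarrow> p + q \<in> I" "\<And>p q. q \<in> I \<Longrightarrow> p * q \<in> I"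
  shows "ideal I S_ring"
proof (rule idealI)
  interpret cring "S_ring :: 'k bipoly ring" by (rule S_ring_cring)
  show "ring (S_ring :: 'k bipoly ring)" by (rule cring.axioms(1)[OF S_ring_cring])
  show "subgroup I (add_monoid S_ring)"
  proof (rule add.subgroupI)
    show "\<ominus>\<^bsub>S_ring\<^esub> a \<in> I" if "a \<in> I" for a
      using assms(3)[OF that, of "- 1"] by simp
  qed (use assms in auto)
qed (use assms(3) in \<open>auto simp: mult.commute\<close>)

lemma ideal_S_ringD:
  fixes I :: "'k::field bipoly set"
  assumes "ideal I S_ring"
  shows "0 \<in> I" "p \<in> I \<Longrightarrow> q \<in> I \<Longrightarrow> p + q \<in> I" "q \<in> I \<Longrightarrow> p * q \<in> I"
    "p \<in> I \<Longrightarrow> q \<in> I \<Longrightarrow> p - q \<in> I"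
proof -
  interpret ideal I S_ring by fact
  have 0: "0 \<in> I" using additive_subgroup.zero_closed[OF additive_subgroup_axioms] by simp
  have 1: "p + q \<in> I" if "p \<in> I" "q \<in> I" for p q
    using additive_subgroup.a_closed[OF additive_subgroup_axioms that] by simp
  have 2: "p * q \<in> I" if "q \<in> I" for p q using S_ideal_mult[OF assms that] .
  show "0 \<in> I" "p \<in> I \<Longrightarrow> q \<in> I \<Longrightarrow> p + q \<in> I" "q \<in> I \<Longrightarrow> p * q \<in> I"
    using 0 1 2 by blast+
  show "p \<in> I \<Longrightarrow> q \<in> I \<Longrightarrow> p - q \<in> I"
    using 1[of p "(- 1) * q"] 2[of q "- 1"] by simp
qed

lemma genideal_pair:
  fixes l l' :: "'k::field bipoly"
  shows "Idl\<^bsub>S_ring\<^esub> {l, l'} = {p * l + q * l' | p q. True}" (is "_ = ?J")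
proof
  interpret cring "S_ring :: 'k bipoly ring" by (rule S_ring_cring)
  have "ideal ?J S_ring"
  proof (rule ideal_S_ringI)
    show "0 \<in> ?J" by (auto intro!: exI[of _ 0])
    show "a + b \<in> ?J" if "a \<in> ?J" "b \<in> ?J" for a b
    proof -
      from that obtain p q p' q' where "a = p * l + q * l'" "b = p' * l + q' * l'" by auto
      then have "a + b = (p + p') * l + (q + q') * l'" by (simp add: algebra_simps)
      then show ?thesis by blast
    qed
    show "c * a \<in> ?J" if "a \<in> ?J" for c a
    proof -
      from that obtain p q where "a = p * l + q * l'" by auto
      then have "c * a = (c * p) * l + (c * q) * l'" by (simp add: algebra_simps)
      then show ?thesis by blast
    qed
  qed
  moreover have "l \<in> ?J" "l' \<in> ?J"
    by (auto intro: exI[of _ 1] exI[of _ 0])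
      (metis add.left_neutral add.right_neutral mult_1 mult_zero_left)+
  ultimately show "Idl\<^bsub>S_ring\<^esub> {l, l'} \<subseteq> ?J"
    by (intro genideal_minimal) auto
  have "{l, l'} \<subseteq> Idl\<^bsub>S_ring\<^esub> {l, l'}" "ideal (Idl\<^bsub>S_ring\<^esub> {l, l'}) S_ring"
    using genideal_self[of "{l, l'}"] genideal_ideal[of "{l, l'}"] by simp_all
  then show "?J \<subseteq> Idl\<^bsub>S_ring\<^esub> {l, l'}"
    by (auto intro!: ideal_S_ringD(2,3))
qed

text \<open>Every monomial of an element of \<open>B\<close> has both degrees at least 1, hence at
  least \<open>t\<close> for \<open>B^t\<close>, and multiplication by \<open>p\<close> can only
  raise them. This is how a power of \<open>B\<close> moves everything into the range where the
  complex is under control.\<close>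

lemma irrelevant_power_degrees:
  assumes "b \<in> irrelevant_power t" "fst d < int t \<or> snd d < int t"
  shows "hpart d (b * p) = (0 :: 'k::field bipoly)"
proof -
  have keys_vars: "lookup m v > 0 \<or> lookup m w > 0"
    if "f \<in> Idl\<^bsub>S_ring\<^esub> {Var v, Var w}" "lookup f m \<noteq> 0" for f :: "'k bipoly" and v w m
  proof -
    from that(1) obtain p q where "f = Var v * p + Var w * q"
      by (auto simp: genideal_pair mult.commute)
    with that(2) show ?thesis
      by (auto simp: lookup_add lookup_Var_mult split: if_splits)
  qed
  have irr: "fst (bideg m) \<ge> 1 \<and> snd (bideg m) \<ge> 1" if f: "f \<in> irrelevant_ideal" "lookup f m \<noteq> 0" for f :: "'k bipoly" and m
    using keys_vars[of f X0 X1 m] keys_vars[of f Y0 Y1 m] f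
    by (auto simp: irrelevant_ideal_def bideg_def)
  have "\<forall>m. lookup b m \<noteq> 0 \<longrightarrow> fst (bideg m) \<ge> int t \<and> snd (bideg m) \<ge> int t"
    using assms(1)
  proof (induction t arbitrary: b)
    case 0
    then show ?case by (simp add: bideg_def)
  next
    case (Suc t)
    from Suc.prems have "b \<in> ideal_prod S_ring (irrelevant_power t) irrelevant_ideal" by simp
    then show ?case
    proof (induction rule: ideal_prod.induct)
      case (prod i j)
      show ?case
      proof safe
        fix m assume "lookup (i \<otimes>\<^bsub>S_ring\<^esub> j) m \<noteq> 0"
        then obtain a c where "lookup i a \<noteq> 0" "lookup j c \<noteq> 0" "m = a + c"
          using keys_mult[of i j] by (auto simp: in_keys_iff[symmetric] subset_iff)
        then show "fst (bideg m) \<ge> int (Suc t)" "snd (bideg m) \<ge> int (Suc t)"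
          using Suc.IH[OF prod(1)] irr[OF prod(2)] by fastforce+
      qed
    next
      case (sum s1 s2)
      show ?case
      proof safe
        fix m assume "lookup (s1 \<oplus>\<^bsub>S_ring\<^esub> s2) m \<noteq> 0"
        then have "lookup s1 m \<noteq> 0 \<or> lookup s2 m \<noteq> 0" by (auto simp: lookup_add)
        then show "fst (bideg m) \<ge> int (Suc t)" "snd (bideg m) \<ge> int (Suc t)"
          using sum.IH by blast+
      qed
    qed
  qed
  moreover have "\<exists>a c. lookup b a \<noteq> 0 \<and> lookup p c \<noteq> 0 \<and> m = a + c" if "lookup (b * p) m \<noteq> 0" for m
    using that keys_mult[of b p] unfolding in_keys_iff[symmetric] by blast
  moreover have "fst (bideg m) \<ge> 0" "snd (bideg m) \<ge> 0" for m by (simp_all add: bideg_def)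
  ultimately have "fst (bideg m) \<ge> int t \<and> snd (bideg m) \<ge> int t" if "lookup (b * p) m \<noteq> 0" for m
    using that by (metis add_increasing2 bideg_add fst_add snd_add)
  then show ?thesis
    using assms(2) by (intro poly_mapping_eqI) (force simp: lookup_hpart)
qed

section \<open>Ideals of points\<close>

definition linear_ideal :: "(var \<Rightarrow> 'k::field) \<Rightarrow> 'k bipoly set" where
  "linear_ideal c = Idl\<^bsub>S_ring\<^esub> {linear_form X0 X1 (c X0, c X1), linear_form Y0 Y1 (c Y0, c Y1)}"

lemma ideal_linear_ideal: "ideal (linear_ideal c) S_ring"
proof -
  interpret cring "S_ring :: 'a bipoly ring" by (rule S_ring_cring)
  show ?thesis unfolding linear_ideal_def by (rule genideal_ideal) simp
qed

lemma linear_form_in_linear_ideal: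
  "linear_form X0 X1 (c X0, c X1) \<in> linear_ideal c" "linear_form Y0 Y1 (c Y0, c Y1) \<in> linear_ideal c"
proof -
  interpret cring "S_ring :: 'a bipoly ring" by (rule S_ring_cring)
  show "linear_form X0 X1 (c X0, c X1) \<in> linear_ideal c" "linear_form Y0 Y1 (c Y0, c Y1) \<in> linear_ideal c"
    unfolding linear_ideal_def
    using genideal_self[of "{linear_form X0 X1 (c X0, c X1), linear_form Y0 Y1 (c Y0, c Y1)}"] by simp_all
qed

lemma linear_form_S_comp:
  "linear_form X0 X1 a \<in> S_comp (1, 0)" "linear_form Y0 Y1 a \<in> S_comp (0, 1)"
  using Var_S_comp[of X0] Var_S_comp[of X1] Var_S_comp[of Y0] Var_S_comp[of Y1]
  by (auto simp: linear_form_def intro!: S_comp_diff Const_mult_S_comp)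

lemma hpart_linear_ideal: "f \<in> linear_ideal c \<Longrightarrow> hpart e f \<in> linear_ideal c"
proof -
  assume "f \<in> linear_ideal c"
  then obtain p q where f: "f = p * linear_form X0 X1 (c X0, c X1) + q * linear_form Y0 Y1 (c Y0, c Y1)"
    by (auto simp: linear_ideal_def genideal_pair)
  note D = ideal_S_ringD[OF ideal_linear_ideal[of c]]
  show "hpart e f \<in> linear_ideal c"
    unfolding f hpart_add hpart_mult[OF linear_form_S_comp(1)] hpart_mult[OF linear_form_S_comp(2)]
    by (intro D(2) D(3) linear_form_in_linear_ideal)
qed

lemma eval_at_linear_ideal: "f \<in> linear_ideal c \<Longrightarrow> eval_at c f = 0"
  by (auto simp: linear_ideal_def genideal_pair linear_form_def eval_at_add eval_at_diff eval_at_mult)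

lemma Var_power: "Var v ^ n = single (single v n) (1 :: 'k::field)"
  by (induction n) (simp_all add: Var_def mult_single flip: single_add)

lemma single_eq_Vars:
  "single m (1 :: 'k::field) = Var X0 ^ lookup m X0 * Var X1 ^ lookup m X1 * Var Y0 ^ lookup m Y0 * Var Y1 ^ lookup m Y1"
proof -
  have "lookup (single X0 (lookup m X0) + single X1 (lookup m X1) + single Y0 (lookup m Y0) + single Y1 (lookup m Y1)) v
      = lookup m v" for v
    by (cases v) (simp_all add: lookup_add lookup_single)
  then have "single X0 (lookup m X0) + single X1 (lookup m X1) + single Y0 (lookup m Y0) + single Y1 (lookup m Y1) = m"
    by (rule poly_mapping_eqI)
  then show ?thesis by (simp add: Var_power mult_single)
qed

text \<open>Modulo the ideal of a point every form of bidegree \<open>(a, b)\<close> is a multiple of one monomial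
  \<open>z\<^sup>a y\<^sup>b\<close> in variables not vanishing at the point, and the factor is the value of the form.\<close>

lemma linear_ideal_if_eval_at_0:
  fixes c :: "var \<Rightarrow> 'k::field"
  assumes x: "c X0 \<noteq> 0 \<or> c X1 \<noteq> 0" and y: "c Y0 \<noteq> 0 \<or> c Y1 \<noteq> 0"
    and f: "f \<in> S_comp e" "eval_at c f = 0"
  shows "f \<in> linear_ideal c"
proof -
  let ?J = "linear_ideal c"
  note D = ideal_S_ringD[OF ideal_linear_ideal[of c]]
  define z where "z = (if c X0 \<noteq> 0 then X0 else X1)"
  define w where "w = (if c Y0 \<noteq> 0 then Y0 else Y1)"
  have zw: "c z \<noteq> 0" "c w \<noteq> 0" using x y by (simp_all add: z_def w_def)
  have lin: "Const (c u) * Var v - Const (c v) * Var u \<in> ?J"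
    if "{u, v} \<subseteq> {X0, X1} \<or> {u, v} \<subseteq> {Y0, Y1}" for u v
  proof -
    have "- (Const (c X1) * Var X0 - Const (c X0) * Var X1) \<in> ?J" "- (Const (c Y1) * Var Y0 - Const (c Y0) * Var Y1) \<in> ?J"
      using D(3)[OF linear_form_in_linear_ideal(1), of "- 1"] D(3)[OF linear_form_in_linear_ideal(2), of "- 1"]
      by (simp_all add: linear_form_def)
    then show ?thesis
      using that linear_form_in_linear_ideal[of c] D(1) by (cases u; cases v) (auto simp: linear_form_def)
  qed
  have mult: "p * q - p' * q' \<in> ?J" if "p - p' \<in> ?J" "q - q' \<in> ?J" for p q p' q'
  proof -
    have "p * q - p' * q' = q * (p - p') + p' * (q - q')" by (simp add: algebra_simps)
    then show ?thesis using that D(2,3) by simp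
  qed
  have pow: "p ^ n - q ^ n \<in> ?J" if "p - q \<in> ?J" for p q n
    by (induction n) (use D(1) in \<open>auto intro: mult that\<close>)
  \<comment> \<open>Division is avoided by carrying the unit \<open>c z ^ a * c w ^ b\<close> along,
    with (a, b) = e; \<open>Const_unit_mem\<close> removes it at the end.\<close>
  have mon: "Const (c z ^ nat (fst e) * c w ^ nat (snd e)) * single m 1 -
      Const (mon_eval c m) * (Var z ^ nat (fst e) * Var w ^ nat (snd e)) \<in> ?J"
    if m: "bideg m = e" for m
  proof -
    have e: "nat (fst e) = lookup m X0 + lookup m X1" "nat (snd e) = lookup m Y0 + lookup m Y1"
      using m by (auto simp: bideg_def)
    let ?l = "\<lambda>u v. (Const (c u) * Var v) ^ lookup m v" and ?r = "\<lambda>u v. (Const (c v) * Var u) ^ lookup m v"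
    have "?l z X0 * ?l z X1 * ?l w Y0 * ?l w Y1 - ?r z X0 * ?r z X1 * ?r w Y0 * ?r w Y1 \<in> ?J"
      by (intro mult pow lin) (auto simp: z_def w_def)
    moreover have "?l z X0 * ?l z X1 * ?l w Y0 * ?l w Y1 =
        Const (c z ^ nat (fst e) * c w ^ nat (snd e)) * single m 1"
      by (simp add: e single_eq_Vars Const_mult Const_power power_mult_distrib power_add mult_ac)
    moreover have "?r z X0 * ?r z X1 * ?r w Y0 * ?r w Y1 =
        Const (mon_eval c m) * (Var z ^ nat (fst e) * Var w ^ nat (snd e))"
      by (simp add: e mon_eval_def Const_mult Const_power power_mult_distrib power_add mult_ac)
    ultimately show ?thesis by simp
  qed
  have J_sum: "sum h A \<in> ?J" if "\<And>a. a \<in> A \<Longrightarrow> h a \<in> ?J" for h and A :: "(var \<Rightarrow>\<^sub>0 nat) set"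
    using that by (induction A rule: infinite_finite_induct) (use D(1,2) in auto)
  let ?C = "c z ^ nat (fst e) * c w ^ nat (snd e)" and ?m = "Var z ^ nat (fst e) * Var w ^ nat (snd e)"
  have "(\<Sum>m\<in>keys f. Const (lookup f m) * (Const ?C * single m 1 - Const (mon_eval c m) * ?m)) \<in> ?J"
    using f(1) by (intro J_sum D(3) mon) (simp add: S_comp_def)
  also have "(\<Sum>m\<in>keys f. Const (lookup f m) * (Const ?C * single m 1 - Const (mon_eval c m) * ?m)) =
      (\<Sum>m\<in>keys f. Const ?C * single m (lookup f m) - Const (lookup f m * mon_eval c m) * ?m)"
  proof (rule sum.cong[OF refl])
    fix m
    have "Const (lookup f m) * (Const ?C * single m 1) = Const ?C * single m (lookup f m)"
      by (simp only: Const_mult_single) (simp add: mult.commute)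
    then show "Const (lookup f m) * (Const ?C * single m 1 - Const (mon_eval c m) * ?m) =
        Const ?C * single m (lookup f m) - Const (lookup f m * mon_eval c m) * ?m"
      by (simp only: right_diff_distrib Const_mult[of "lookup f m"] mult.assoc)
  qed
  also have "\<dots> = Const ?C * (\<Sum>m\<in>keys f. single m (lookup f m)) - Const (eval_at c f) * ?m"
    by (simp only: sum_subtractf eval_at_def Const_sum sum_distrib_left sum_distrib_right)
  also have "\<dots> = Const ?C * f"
    using f(2) by (simp flip: poly_mapping_sum_single)
  finally show ?thesis
    using Const_unit_mem[OF ideal_linear_ideal, of ?C] zw by simp
qed

lemma point_coords:
  fixes u v :: "'k::field p1"
  shows "\<exists>c. (c X0 \<noteq> 0 \<or> c X1 \<noteq> 0) \<and> (c Y0 \<noteq> 0 \<or> c Y1 \<noteq> 0) \<and> point_ideal u v = linear_ideal c"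
proof -
  have rep: "\<exists>a. proj_rel a a \<and> u = abs_p1 a" for u :: "'k p1"
    by (induction u rule: p1.abs_induct) auto
  obtain a where a: "proj_rel a a" "u = abs_p1 a" using rep by blast
  obtain b where b: "proj_rel b b" "v = abs_p1 b" using rep by blast
  define c where "c = (\<lambda>w. case w of X0 \<Rightarrow> fst a | X1 \<Rightarrow> snd a | Y0 \<Rightarrow> fst b | Y1 \<Rightarrow> snd b)"
  have "point_ideal u v = linear_ideal c"
    using a b by (simp add: point_ideal.abs_eq linear_ideal_def c_def)
  moreover have "c X0 \<noteq> 0 \<or> c X1 \<noteq> 0" "c Y0 \<noteq> 0 \<or> c Y1 \<noteq> 0"
    using a(1) b(1) by (auto simp: proj_rel_def c_def prod_eq_iff)
  ultimately show ?thesis by blast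
qed

section \<open>The coordinate ring of the points as a graded module\<close>

locale point_set = points X c for X :: "'k::field point set" and c :: "'k point \<Rightarrow> var \<Rightarrow> 'k" +
  assumes point_ideal: "P \<in> X \<Longrightarrow> point_ideal (fst P) (snd P) = linear_ideal (c P)"
begin

abbreviation I where "I \<equiv> vanishing_ideal X"

lemma I_eq: "I = (\<Inter>P\<in>X. linear_ideal (c P))"
  unfolding vanishing_ideal_def case_prod_beta by (rule INF_cong[OF refl point_ideal])

lemma ideal_I: "ideal I S_ring"
  unfolding I_eq by (rule ideal_S_ringI) (auto intro: ideal_S_ringD[OF ideal_linear_ideal])

text \<open>Restricted to forms: a polynomial such as \<open>x_0 - 1\<close> may vanish at the
  chosen coordinates without lying in the ideal of the point.\<close>

lemma I_homogeneous: "f \<in> S_comp e \<Longrightarrow> f \<in> I \<longleftrightarrow> f \<in> van e"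
proof -
  assume f: "f \<in> S_comp e"
  have "f \<in> linear_ideal (c P) \<longleftrightarrow> eval_at (c P) f = 0" if "P \<in> X" for P
    using linear_ideal_if_eval_at_0[OF nonzero[OF that same_factor.intros(1)]
      nonzero[OF that same_factor.intros(2)] f] eval_at_linear_ideal by blast
  then show ?thesis using f by (simp add: I_eq van_def)
qed

lemma hpart_I: "f \<in> I \<Longrightarrow> hpart e f \<in> van e"
proof -
  assume "f \<in> I"
  then have "hpart e f \<in> I" using hpart_linear_ideal unfolding I_eq by blast
  then show ?thesis using I_homogeneous[OF hpart_S_comp] by blast
qed

lemma van_subset_I: "van e \<subseteq> I"
  using I_homogeneous van_S_comp by blast

sublocale gquot S_gmodule I
proof (rule gquot.intro, rule gmod.intro, rule module_S_gmodule, rule gquot_axioms.intro)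
  interpret Module.module S_ring "S_gmodule :: ('k bipoly, 'k bipoly) gmodule" by (rule module_S_gmodule)
  note D = ideal_S_ringD[OF ideal_I]
  show "submodule I S_ring S_gmodule"
    by (rule submoduleI) (use D D(3)[of _ "- 1"] in auto)
qed

lemma coord_gmodule_eq: "coord_gmodule X = Q"
  by (simp add: coord_gmodule_def)

lemma cls_eq: "cls p = cls q \<longleftrightarrow> p - q \<in> I"
  using cls_eq_iff[of p q] by simp

text \<open>The decomposition of a class is given by the homogeneous parts of a representative; it
  is unique because \<open>I\<close> contains the parts of its elements.\<close>

lemma graded_module_coord: "graded_module (coord_gmodule X)"
  unfolding graded_module_def coord_gmodule_eq
proof (intro conjI allI ballI)
  note D = ideal_S_ringD[OF ideal_I]
  show "Module.module S_ring Q" by (rule module_Q)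
  show "subgroup (hcomp Q e) (add_monoid Q)" for e
  proof (rule Q.add.subgroupI)
    show "hcomp Q e \<subseteq> carrier Q" by (auto simp: hcomp_Q)
    show "hcomp Q e \<noteq> {}" using S_comp_0[of e] by (auto simp: hcomp_Q simp del: S_comp_0)
    show "\<ominus>\<^bsub>Q\<^esub> a \<in> hcomp Q e" if "a \<in> hcomp Q e" for a
      using that by (auto simp: hcomp_Q a_inv_Q intro!: imageI S_comp_uminus)
    show "a \<oplus>\<^bsub>Q\<^esub> b \<in> hcomp Q e" if "a \<in> hcomp Q e" "b \<in> hcomp Q e" for a b
      using that by (auto simp: hcomp_Q add_Q intro!: imageI S_comp_add)
  qed
  show "p \<odot>\<^bsub>Q\<^esub> x \<in> hcomp Q (a + a', b + b')" if "p \<in> S_comp (a, b)" "x \<in> hcomp Q (a', b')" for a b a' b' p x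
    using that S_comp_mult[of p "(a, b)" _ "(a', b')"] by (auto simp: hcomp_Q smult_Q)
  show "\<exists>!s. (\<forall>e. s e \<in> hcomp Q e) \<and> finite {e. s e \<noteq> \<zero>\<^bsub>Q\<^esub>} \<and> x = finsum Q s {e. s e \<noteq> \<zero>\<^bsub>Q\<^esub>}"
    if "x \<in> carrier Q" for x
  proof -
    from that obtain f where f: "x = cls f" by (auto simp: carrier_Q)
    have finsum: "finsum Q (\<lambda>e. cls (t e)) {e. cls (t e) \<noteq> \<zero>\<^bsub>Q\<^esub>} = cls (\<Sum>e\<in>E. t e)"
      if "finite E" "{e. cls (t e) \<noteq> \<zero>\<^bsub>Q\<^esub>} \<subseteq> E" for t :: "int \<times> int \<Rightarrow> 'k bipoly" and E
    proof -
      have "finsum Q (\<lambda>e. cls (t e)) {e. cls (t e) \<noteq> \<zero>\<^bsub>Q\<^esub>} = finsum Q (\<lambda>e. cls (t e)) E"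
        using that by (intro Q.add.finprod_mono_neutral_cong_left) auto
      also have "\<dots> = cls (finsum S_gmodule t E)" by (rule finsum_Q) (use that in auto)
      also have "\<dots> = cls (\<Sum>e\<in>E. t e)" using that(1) by simp
      finally show ?thesis .
    qed
    show ?thesis
    proof (rule ex1I)
      let ?E = "bideg ` keys f"
      have sub: "{e. cls (hpart e f) \<noteq> \<zero>\<^bsub>Q\<^esub>} \<subseteq> ?E"
        using hpart_outside[of _ f] by (auto simp: zero_Q)
      have "x = finsum Q (\<lambda>e. cls (hpart e f)) {e. cls (hpart e f) \<noteq> \<zero>\<^bsub>Q\<^esub>}"
        by (subst finsum[OF _ sub]) (simp_all add: sum_hpart f)
      then show "(\<forall>e. cls (hpart e f) \<in> hcomp Q e) \<and> finite {e. cls (hpart e f) \<noteq> \<zero>\<^bsub>Q\<^esub>} \<and>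
          x = finsum Q (\<lambda>e. cls (hpart e f)) {e. cls (hpart e f) \<noteq> \<zero>\<^bsub>Q\<^esub>}"
        using finite_subset[OF sub] by (simp add: hcomp_Q)
    next
      fix s assume s: "(\<forall>e. s e \<in> hcomp Q e) \<and> finite {e. s e \<noteq> \<zero>\<^bsub>Q\<^esub>} \<and> x = finsum Q s {e. s e \<noteq> \<zero>\<^bsub>Q\<^esub>}"
      then have "\<forall>e. \<exists>p. p \<in> S_comp e \<and> s e = cls p" unfolding hcomp_Q S_gmodule_simps by blast
      then obtain t where t: "\<And>e. t e \<in> S_comp e" "\<And>e. s e = cls (t e)" by metis
      let ?E = "{e. s e \<noteq> \<zero>\<^bsub>Q\<^esub>}"
      have "cls f = cls (\<Sum>e\<in>?E. t e)"
      proof -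
        have s_eq: "s = (\<lambda>e. cls (t e))" by (rule ext) (rule t(2))
        show ?thesis
          using s[unfolded s_eq] finsum[of "{e. cls (t e) \<noteq> \<zero>\<^bsub>Q\<^esub>}" t] f unfolding s_eq by simp
      qed
      then have "hpart d (f - (\<Sum>e\<in>?E. t e)) \<in> I" for d
        unfolding cls_eq using hpart_I van_subset_I by blast
      moreover have "hpart d (\<Sum>e\<in>?E. t e) = (if d \<in> ?E then t d else 0)" for d
        using s by (simp add: hpart_sum hpart_of_S_comp[OF t(1)])
      ultimately have "hpart d f - (if d \<in> ?E then t d else 0) \<in> I" for d
        by (simp only: hpart_diff)
      then have d: "cls (hpart d f) = cls (if d \<in> ?E then t d else 0)" for d
        by (simp only: cls_eq)
      show "s = (\<lambda>e. cls (hpart e f))"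
      proof
        fix e
        show "s e = cls (hpart e f)"
        proof (cases "e \<in> ?E")
          case True
          then show ?thesis using d[of e] t(2)[of e] by simp
        next
          case False
          then show ?thesis using d[of e] by (simp add: zero_Q)
        qed
      qed
    qed
  qed
qed

lemma fin_gen_coord: "fin_gen_module (coord_gmodule X)"
  unfolding fin_gen_module_def coord_gmodule_eq
proof (intro exI[of _ "{cls 1}"] conjI ballI)
  show "finite {cls 1}" "{cls 1} \<subseteq> carrier Q" by (auto simp: carrier_Q)
  fix x assume "x \<in> carrier Q"
  then obtain f where f: "x = cls f" by (auto simp: carrier_Q)
  have "finsum Q (\<lambda>a. f \<odot>\<^bsub>Q\<^esub> a) {cls 1} = f \<odot>\<^bsub>Q\<^esub> cls 1"
    using Q.finsum_insert[of "{}" "cls 1" "\<lambda>a. f \<odot>\<^bsub>Q\<^esub> a"] by (simp add: smult_Q)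
  then show "\<exists>c. x = finsum Q (\<lambda>a. c a \<odot>\<^bsub>Q\<^esub> a) {cls 1}"
    by (intro exI[of _ "\<lambda>_. f"]) (simp add: f smult_Q)
qed

end

section \<open>The Hilbert function\<close>

lemma unique_combination_iff_basis:
  fixes w :: "'a \<Rightarrow> 'p \<Rightarrow> 'k::field"
  assumes A: "finite A" and inj: "inj_on w A" and W: "w ` A \<subseteq> W" "fn.subspace W"
  shows "(\<forall>h\<in>W. \<exists>!k. (\<forall>a. a \<notin> A \<longrightarrow> k a = 0) \<and> h = (\<Sum>a\<in>A. (\<lambda>P. k a * w a P))) \<longleftrightarrow>
    fn.independent (w ` A) \<and> W \<subseteq> fn.span (w ` A)" (is "?L \<longleftrightarrow> ?R")
proof -
  have reindex: "(\<Sum>x\<in>w ` A. (\<lambda>P. u x * x P)) = (\<Sum>a\<in>A. (\<lambda>P. u (w a) * w a P))" for u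
    by (simp add: sum.reindex[OF inj])
  have span: "fn.span (w ` A) = range (\<lambda>u. \<Sum>x\<in>w ` A. (\<lambda>P. u x * x P))"
    using A by (intro fn.span_finite) simp
  show ?thesis
  proof
    assume L: ?L
    have "fn.independent (w ` A)"
    proof (rule fn.independent_if_scalars_zero)
      fix u x assume u: "(\<Sum>x\<in>w ` A. (\<lambda>P. u x * x P)) = 0" and "x \<in> w ` A"
      then obtain b where b: "b \<in> A" "x = w b" by auto
      let ?k = "\<lambda>a. if a \<in> A then u (w a) else 0"
      have "0 \<in> W" using W(2) by (rule fn.subspace_0)
      with L have E: "\<exists>!k. (\<forall>a. a \<notin> A \<longrightarrow> k a = 0) \<and> 0 = (\<Sum>a\<in>A. (\<lambda>P. k a * w a P))"
        by (rule bspec)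
      define p where "p k \<longleftrightarrow> (\<forall>a. a \<notin> A \<longrightarrow> k a = 0) \<and> 0 = (\<Sum>a\<in>A. (\<lambda>P. k a * w a P))" for k
      have "p ?k" using u unfolding reindex p_def by simp
      moreover have "p (\<lambda>_. 0)" by (simp add: p_def fun_eq_iff sum_fun_apply)
      ultimately have "?k = (\<lambda>_. 0)" using E unfolding p_def[symmetric] by blast
      then have "?k b = 0" by (rule fun_cong)
      then show "u x = 0" using b by simp
    qed (use A in simp)
    moreover have "W \<subseteq> fn.span (w ` A)"
    proof
      fix h assume "h \<in> W"
      with L obtain k where "h = (\<Sum>a\<in>A. (\<lambda>P. k a * w a P))" by blast
      also have "\<dots> \<in> fn.span (w ` A)"
        by (intro fn.span_sum fn.span_scale fn.span_base) auto
      finally show "h \<in> fn.span (w ` A)" .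
    qed
    ultimately show ?R by blast
  next
    assume R: ?R
    show ?L
    proof
      fix h assume "h \<in> W"
      with R span obtain u where "h = (\<Sum>x\<in>w ` A. (\<lambda>P. u x * x P))" by auto
      then have u: "h = (\<Sum>a\<in>A. (\<lambda>P. u (w a) * w a P))" by (simp only: reindex)
      show "\<exists>!k. (\<forall>a. a \<notin> A \<longrightarrow> k a = 0) \<and> h = (\<Sum>a\<in>A. (\<lambda>P. k a * w a P))"
      proof (rule ex_ex1I)
        show "\<exists>k. (\<forall>a. a \<notin> A \<longrightarrow> k a = 0) \<and> h = (\<Sum>a\<in>A. (\<lambda>P. k a * w a P))"
          by (rule exI[of _ "\<lambda>a. if a \<in> A then u (w a) else 0"]) (simp add: u)
      next
        fix k l
        assume k: "(\<forall>a. a \<notin> A \<longrightarrow> k a = 0) \<and> h = (\<Sum>a\<in>A. (\<lambda>P. k a * w a P))"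
          and l: "(\<forall>a. a \<notin> A \<longrightarrow> l a = 0) \<and> h = (\<Sum>a\<in>A. (\<lambda>P. l a * w a P))"
        define v where "v = the_inv_into A w"
        have v: "v (w a) = a" if "a \<in> A" for a
          unfolding v_def using inj that by (rule the_inv_into_f_f)
        have "(\<Sum>x\<in>w ` A. (\<lambda>P. (k (v x) - l (v x)) * x P)) = (\<Sum>a\<in>A. (\<lambda>P. (k a - l a) * w a P))"
          unfolding reindex by (intro sum.cong refl) (simp add: v)
        also have "\<dots> = (\<Sum>a\<in>A. (\<lambda>P. k a * w a P)) - (\<Sum>a\<in>A. (\<lambda>P. l a * w a P))"
          by (simp add: fun_eq_iff sum_fun_apply left_diff_distrib sum_subtractf)
        also have "\<dots> = 0" using k l by simp
        finally have "k (v x) - l (v x) = 0" if "x \<in> w ` A" for x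
          using fn.independentD[of "w ` A" "w ` A" "\<lambda>x. k (v x) - l (v x)" x] R A that by simp
        then have "k a = l a" if "a \<in> A" for a
          using v[OF that] that by force
        then show "k = l" using k l by (metis ext)
      qed
    qed
  qed
qed

context point_set
begin

text \<open>On forms of one bidegree, evaluation has the part of \<open>I\<close> as kernel, so
  \<open>\<Phi>\<close> identifies the graded piece of the coordinate ring with the image of
  evaluation. As \<open>k_dim\<close> is a definite description, both a finite basis and the equal
  size of all finite bases have to be shown.\<close>

lemma hilbert_function_eq:
  "hilbert_function X a b = fn.dim (eval_pts ` S_comp (int a, int b))"
proof -
  let ?e = "(int a, int b)"
  let ?S = "S_comp ?e :: 'k bipoly set"
  let ?W = "eval_pts ` ?S"
  have H: "hcomp Q ?e = cls ` ?S" by (simp add: hcomp_Q)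
  have eq: "cls s = cls t \<longleftrightarrow> eval_pts s = eval_pts t" if "s \<in> ?S" "t \<in> ?S" for s t
  proof -
    have "s - t \<in> ?S" using that by (rule S_comp_diff)
    then have "cls s = cls t \<longleftrightarrow> s - t \<in> van ?e"
      by (simp add: cls_eq I_homogeneous)
    also have "\<dots> \<longleftrightarrow> eval_pts s = eval_pts t"
      using \<open>s - t \<in> ?S\<close> by (auto simp: van_def eval_pts_def fun_eq_iff eval_at_diff)
    finally show ?thesis .
  qed
  define \<Phi> where "\<Phi> C = eval_pts (SOME s. s \<in> ?S \<and> cls s = C)" for C
  have \<Phi>: "\<Phi> (cls s) = eval_pts s" if s: "s \<in> ?S" for s
  proof -
    let ?t = "SOME t. t \<in> ?S \<and> cls t = cls s"
    have "?t \<in> ?S \<and> cls ?t = cls s" by (rule someI[of _ s]) (use s in simp)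
    then show ?thesis using eq[of ?t s] s by (simp add: \<Phi>_def)
  qed
  have inj: "inj_on \<Phi> (hcomp Q ?e)" unfolding H by (auto simp: inj_on_def \<Phi> eq)
  have im: "\<Phi> ` hcomp Q ?e = ?W" unfolding H by (auto simp: \<Phi> image_iff)
  have sub: "fn.subspace ?W"
    using linear_eval_pts subspace_S_comp by (rule bpfn.linear_subspace_image)
  interpret lin: Vector_Spaces.linear "\<lambda>a p. Const a * p" "\<lambda>a h P. a * h P" eval_pts
    by (rule linear_eval_pts)
  have comb: "cls s = finsum Q (\<lambda>a. Const (k a) \<odot>\<^bsub>Q\<^esub> a) A \<longleftrightarrow>
      eval_pts s = (\<Sum>a\<in>A. (\<lambda>P. k a * \<Phi> a P))"
    if A: "finite A" "A \<subseteq> hcomp Q ?e" and s: "s \<in> ?S" for A k s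
  proof -
    have "\<forall>a\<in>A. \<exists>p\<in>?S. a = cls p" using A(2) unfolding H by blast
    then obtain \<rho> where \<rho>: "\<And>a. a \<in> A \<Longrightarrow> \<rho> a \<in> ?S" "\<And>a. a \<in> A \<Longrightarrow> a = cls (\<rho> a)" by metis
    have "finsum Q (\<lambda>a. Const (k a) \<odot>\<^bsub>Q\<^esub> a) A = finsum Q (\<lambda>a. cls (Const (k a) * \<rho> a)) A"
    proof (rule Q.finsum_cong')
      fix a assume a: "a \<in> A"
      show "Const (k a) \<odot>\<^bsub>Q\<^esub> a = cls (Const (k a) * \<rho> a)"
        by (subst \<rho>(2)[OF a]) (simp add: smult_Q)
    qed auto
    also have "\<dots> = cls (finsum S_gmodule (\<lambda>a. Const (k a) * \<rho> a) A)"
      by (rule finsum_Q[OF A(1)]) simp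
    also have "\<dots> = cls (\<Sum>a\<in>A. Const (k a) * \<rho> a)" using A(1) by simp
    finally have "cls s = finsum Q (\<lambda>a. Const (k a) \<odot>\<^bsub>Q\<^esub> a) A \<longleftrightarrow>
        eval_pts s = eval_pts (\<Sum>a\<in>A. Const (k a) * \<rho> a)"
      using eq[OF s, of "\<Sum>a\<in>A. Const (k a) * \<rho> a"] \<rho>(1)
      by (simp add: S_comp_sum Const_mult_S_comp)
    also have "eval_pts (\<Sum>a\<in>A. Const (k a) * \<rho> a) = (\<Sum>a\<in>A. (\<lambda>P. k a * \<Phi> a P))"
      unfolding lin.sum lin.scale
    proof (rule sum.cong[OF refl])
      fix a assume a: "a \<in> A"
      have "\<Phi> a = eval_pts (\<rho> a)" by (subst \<rho>(2)[OF a]) (rule \<Phi>[OF \<rho>(1)[OF a]])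
      then show "(\<lambda>P. k a * eval_pts (\<rho> a) P) = (\<lambda>P. k a * \<Phi> a P)" by simp
    qed
    finally show ?thesis .
  qed
  have basis: "is_basis Q (hcomp Q ?e) A \<longleftrightarrow> fn.independent (\<Phi> ` A) \<and> ?W \<subseteq> fn.span (\<Phi> ` A)"
    if A: "finite A" "A \<subseteq> hcomp Q ?e" for A
  proof -
    have "is_basis Q (hcomp Q ?e) A \<longleftrightarrow>
        (\<forall>s\<in>?S. \<exists>!k. (\<forall>a. a \<notin> A \<longrightarrow> k a = 0) \<and> eval_pts s = (\<Sum>a\<in>A. (\<lambda>P. k a * \<Phi> a P)))"
      using A comb[OF A] unfolding is_basis_def H by simp
    also have "\<dots> \<longleftrightarrow> (\<forall>h\<in>?W. \<exists>!k. (\<forall>a. a \<notin> A \<longrightarrow> k a = 0) \<and> h = (\<Sum>a\<in>A. (\<lambda>P. k a * \<Phi> a P)))"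
      by simp
    also have "\<dots> \<longleftrightarrow> fn.independent (\<Phi> ` A) \<and> ?W \<subseteq> fn.span (\<Phi> ` A)"
      by (rule unique_combination_iff_basis[OF A(1) inj_on_subset[OF inj A(2)] _ sub])
        (use A(2) im in blast)
    finally show ?thesis .
  qed
  have card: "card A = fn.dim ?W" if A: "finite A" "is_basis Q (hcomp Q ?e) A" for A
  proof -
    have sub: "A \<subseteq> hcomp Q ?e" using A(2) by (simp add: is_basis_def)
    have "card (\<Phi> ` A) = fn.dim ?W"
      using basis[OF A(1) sub] A(2) sub im by (intro fn.basis_card_eq_dim) auto
    then show ?thesis using card_image[OF inj_on_subset[OF inj sub]] by simp
  qed
  obtain D where D: "D \<subseteq> ?W" "fn.independent D" "?W \<subseteq> fn.span D"
    by (rule fn.maximal_independent_subset)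
  have "?W \<subseteq> fn.span ((\<lambda>P Q. if Q = P then 1 else 0) ` X)"
    using dim_supported(2)[OF finite_X, where 'k = 'k] by (auto simp: eval_pts_def)
  then have "finite D"
    using fn.independent_span_bound[OF _ D(2)] D(1) finite_X by (meson finite_imageI subset_trans)
  define A where "A = {C \<in> hcomp Q ?e. \<Phi> C \<in> D}"
  have A: "A \<subseteq> hcomp Q ?e" by (auto simp: A_def)
  have \<Phi>A: "\<Phi> ` A = D" using D(1) im by (auto simp: A_def)
  then have "finite A" using \<open>finite D\<close> finite_imageD[OF _ inj_on_subset[OF inj A]] by simp
  moreover from this have "is_basis Q (hcomp Q ?e) A" using basis[OF _ A] D(2,3) \<Phi>A by simp
  ultimately show ?thesis
    unfolding hilbert_function_def k_dim_def coord_gmodule_eq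
    using card by (intro the_equality) blast+
qed

end

section \<open>The virtual resolution\<close>

text \<open>With \<open>i \<le> j\<close> the single power \<open>B^j\<close> raises the x-degree to
  at least \<open>i\<close> and the y-degree to at least \<open>j\<close>, the range covered by
  \<open>generated_strip\<close>.\<close>

locale strip_resolution = point_set X c + two_strips X c i j e A B M
  for X :: "'k::field point set" and c i j e A B M +
  assumes i_le_j: "i \<le> j"
begin

definition gen_degs :: "(int \<times> int) list" where
  "gen_degs = map gen_deg [0..<2*i+3]"

definition rel_degs :: "(int \<times> int) list" where
  "rel_degs = replicate (2*i+2) (int i + 1, int j + 1)"

lemma length_degs [simp]: "length gen_degs = 2*i+3" "length rel_degs = 2*i+2"
  by (simp_all add: gen_degs_def rel_degs_def del: replicate.simps)

lemma nth_degs: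
  "k < 2*i+3 \<Longrightarrow> gen_degs ! k = gen_deg k"
  "m < 2*i+2 \<Longrightarrow> rel_degs ! m = (int i + 1, int j + 1)"
proof -
  show "gen_degs ! k = gen_deg k" if "k < 2*i+3"
    unfolding gen_degs_def using that by (subst nth_map) (simp_all del: upt_Suc)
  show "rel_degs ! m = (int i + 1, int j + 1)" if "m < 2*i+2"
    unfolding rel_degs_def using that by (rule List.nth_replicate)
qed

definition res_degs :: "nat \<Rightarrow> (int \<times> int) list" where
  "res_degs n = (if n = 0 then [(0, 0)] else if n = 1 then gen_degs else if n = 2 then rel_degs else [])"

definition res_map :: "nat \<Rightarrow> (nat \<Rightarrow> 'k bipoly) \<Rightarrow> nat \<Rightarrow> 'k bipoly" where
  "res_map n = (if n = 1 then matrix_map (\<lambda>l k. gen l) (2*i+3) 1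
     else if n = 2 then matrix_map rel (2*i+2) (2*i+3) else (\<lambda>_ _. 0))"

lemma res_degs_simps [simp]:
  "res_degs 0 = [(0, 0)]" "res_degs (Suc 0) = gen_degs" "res_degs 2 = rel_degs"
  "res_degs (Suc (Suc 0)) = rel_degs" "n \<ge> 3 \<Longrightarrow> res_degs n = []"
  by (simp_all add: res_degs_def)

lemma res_map_simps [simp]:
  "res_map (Suc 0) = matrix_map (\<lambda>l k. gen l) (2*i+3) 1"
  "res_map 2 = matrix_map rel (2*i+2) (2*i+3)"
  "res_map (Suc (Suc 0)) = matrix_map rel (2*i+2) (2*i+3)"
  "n \<ge> 3 \<Longrightarrow> res_map n = (\<lambda>_ _. 0)"
  by (simp_all add: res_map_def)

lemma graded_hom_res_map:
  "graded_hom (free_gmodule (res_degs (Suc n))) (free_gmodule (res_degs n)) (res_map (Suc n))"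
proof -
  consider "n = 0" | "n = 1" | "n \<ge> 2" by linarith
  then show ?thesis
  proof cases
    case 1
    have "gen l \<in> S_comp (gen_degs ! l - [(0, 0)] ! k)"
      if "l < length gen_degs" "k < length [(0::int, 0::int)]" for l k
      using that van_S_comp[OF g_van[of l]] by (simp add: nth_degs flip: zero_prod_def)
    from graded_hom_matrix_map[of gen_degs "[(0, 0)]" "\<lambda>l k. gen l", OF this]
    show ?thesis using 1 by simp
  next
    case 2
    have "rel l k \<in> S_comp (rel_degs ! l - gen_degs ! k)"
      if "l < length rel_degs" "k < length gen_degs" for l k
    proof -
      have lk: "l < 2 * i + 2" "k < 2 * i + 3" using that by simp_all
      show ?thesis unfolding nth_degs(2)[OF lk(1)] nth_degs(1)[OF lk(2)] by (rule rel_deg[OF lk])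
    qed
    from graded_hom_matrix_map[of rel_degs gen_degs rel, OF this]
    show ?thesis using 2 by simp
  next
    case 3
    then show ?thesis by (simp add: graded_hom_zero)
  qed
qed

lemma free_complex_res: "free_complex res_degs res_map"
  unfolding free_complex_def
proof (intro conjI allI ballI graded_hom_res_map)
  fix n and v :: "nat \<Rightarrow> 'k bipoly"
  assume "v \<in> carrier (free_gmodule (res_degs (Suc (Suc n))))"
  show "res_map (Suc n) (res_map (Suc (Suc n)) v) = (\<lambda>_. 0)"
  proof (cases "n = 0")
    case True
    have "(\<Sum>k<2*i+3. (matrix_map rel (2*i+2) (2*i+3) v) k * gen k) = 0"
      by (rule boundary_syzygy[of _ v]) (simp add: matrix_map_def)
    then show ?thesis using True by (auto simp: matrix_map_def[of _ _ "Suc 0"])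
  next
    case False
    then have "Suc (Suc n) \<ge> 3" by simp
    then have "res_map (Suc (Suc n)) v = (\<lambda>_. 0)" by simp
    moreover have "res_map (Suc n) (\<lambda>_. 0) = (\<lambda>_. 0)"
      by (simp add: res_map_def matrix_map_def fun_eq_iff)
    ultimately show ?thesis by simp
  qed
qed

lemma image_res_map_1:
  "res_map (Suc 0) ` carrier (free_gmodule (res_degs (Suc 0))) =
    {v. v 0 \<in> gen_ideal \<and> (\<forall>n\<ge>1. v n = 0)}"
proof (intro equalityI subsetI)
  fix v :: "nat \<Rightarrow> 'k bipoly" assume "v \<in> {v. v 0 \<in> gen_ideal \<and> (\<forall>n\<ge>1. v n = 0)}"
  then obtain u where u: "v 0 = (\<Sum>k<2*i+3. u k * gen k)" and z: "\<And>n. n \<ge> 1 \<Longrightarrow> v n = 0"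
    by (auto simp: gen_ideal_def)
  let ?u = "\<lambda>k. if k < 2*i+3 then u k else 0"
  have "v = res_map (Suc 0) ?u"
    by (rule ext) (use u z in \<open>auto simp: matrix_map_def\<close>)
  moreover have "?u \<in> carrier (free_gmodule (res_degs (Suc 0)))" by simp
  ultimately show "v \<in> res_map (Suc 0) ` carrier (free_gmodule (res_degs (Suc 0)))" by blast
qed (auto simp: matrix_map_def gen_ideal_def)

text \<open>One power serves all n. For n = 1 it moves the coefficients of a cycle to y-degree at
  least \<open>j\<close>, where cycles are boundaries; for n = 2 the left map is injective, and
  beyond that the complex is 0.\<close>

lemma homology_res_killed:
  assumes n: "n > 0" and b: "b \<in> irrelevant_power j" and h: "h \<in> carrier (homology res_degs res_map n)"
  shows "b \<odot>\<^bsub>homology res_degs res_map n\<^esub> h = \<zero>\<^bsub>homology res_degs res_map n\<^esub>"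
proof (rule homology_killed[OF graded_hom_res_map _ h])
  fix z assume z: "z \<in> cycles res_degs res_map n"
  consider "n = 1" | "n = 2" | "n \<ge> 3" using n by linarith
  then show "(\<lambda>k. b * z k) \<in> res_map (Suc n) ` carrier (free_gmodule (res_degs (Suc n)))"
  proof cases
    case 1
    have z0: "z k = 0" if "k \<ge> 2*i+3" for k using z 1 that by (simp add: cycles_def)
    have "matrix_map (\<lambda>l k. gen l) (2*i+3) 1 z 0 = 0"
      using z 1 by (simp add: cycles_def)
    then have zs: "(\<Sum>k<2*i+3. z k * gen k) = 0" by (simp add: matrix_map_def)
    have "boundary (\<lambda>k. b * z k)"
    proof (rule cycle_boundary)
      have "(\<Sum>k<2*i+3. b * z k * gen k) = b * (\<Sum>k<2*i+3. z k * gen k)"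
        by (simp only: sum_distrib_left mult.assoc)
      then show "(\<Sum>k<2*i+3. b * z k * gen k) = 0" by (simp only: zs mult_zero_right)
      show "hpart d (b * z k) = 0" if "snd d < int j" for k d
        by (rule irrelevant_power_degrees[OF b]) (use that in simp)
    qed
    then obtain p where p: "\<And>k. k < 2*i+3 \<Longrightarrow> b * z k = (\<Sum>m<2*i+2. p m * rel m k)"
      unfolding boundary_def by blast
    let ?p = "\<lambda>m. if m < 2*i+2 then p m else 0"
    have "(\<lambda>k. b * z k) = res_map (Suc n) ?p"
    proof
      fix k
      show "b * z k = res_map (Suc n) ?p k"
        using p[of k] z0[of k] 1 by (cases "k < 2*i+3") (simp_all add: matrix_map_def)
    qed
    moreover have "?p \<in> carrier (free_gmodule (res_degs (Suc n)))" using 1 by simp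
    ultimately show ?thesis by blast
  next
    case 2
    have "z = (\<lambda>_. 0)"
    proof
      fix m
      have E: "matrix_map rel (2*i+2) (2*i+3) z = (\<lambda>_. 0)" and z0: "\<forall>m\<ge>2*i+2. z m = 0"
        using z unfolding cycles_def 2 by simp_all
      have "(\<Sum>m<2*i+2. z m * rel m k) = 0" if "k < 2*i+3" for k
        using that fun_cong[OF E, of k] by (simp add: matrix_map_def)
      then show "z m = 0" using rel_independent[of z m] z0 by (cases "m < 2*i+2") auto
    qed
    moreover have "(\<lambda>_. 0) = res_map (Suc n) (\<lambda>_. 0)" using 2 by simp
    ultimately show ?thesis by auto
  next
    case 3
    then have "z = (\<lambda>_. 0)" using z by (auto simp: cycles_def)
    moreover have "(\<lambda>_. 0) = res_map (Suc n) (\<lambda>_. 0)" using 3 by simp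
    ultimately show ?thesis by auto
  qed
qed

lemma gen_ideal_subset_I: "gen_ideal \<subseteq> I"
proof
  note D = ideal_S_ringD[OF ideal_I]
  have sum: "(\<And>k. k \<in> K \<Longrightarrow> f k \<in> I) \<Longrightarrow> sum f K \<in> I" for f and K :: "nat set"
    by (induction K rule: infinite_finite_induct) (auto intro: D)
  fix f assume "f \<in> gen_ideal"
  then obtain u where f: "f = (\<Sum>k<2*i+3. u k * gen k)" by (auto simp: gen_ideal_def)
  have "gen k \<in> I" if "k \<in> {..<2*i+3}" for k
    using g_van[OF that] van_subset_I by blast
  then show "f \<in> I" unfolding f by (intro sum D(3))
qed

lemma irrelevant_I_gen_ideal: "b \<in> irrelevant_power j \<Longrightarrow> f \<in> I \<Longrightarrow> b * f \<in> gen_ideal"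
proof (rule van_gen_ideal)
  note D = ideal_S_ringD[OF ideal_I]
  assume b: "b \<in> irrelevant_power j" and f: "f \<in> I"
  show "hpart d (b * f) \<in> van d" for d using hpart_I D(3)[OF f] .
  show "hpart d (b * f) = 0" if "fst d < int i \<or> snd d < int j" for d
    by (rule irrelevant_power_degrees[OF b]) (use that i_le_j in auto)
qed

text \<open>The saturations agree because \<open>B\<^sup>j I \<subseteq> J \<subseteq> I\<close> for the ideal \<open>J\<close> of the generators.\<close>

lemma saturation_eq:
  "(\<exists>t. \<forall>b\<in>irrelevant_power t. b * f \<in> gen_ideal) \<longleftrightarrow> (\<exists>t. \<forall>b\<in>irrelevant_power t. b * f \<in> I)"
proof
  assume "\<exists>t. \<forall>b\<in>irrelevant_power t. b * f \<in> I"
  then obtain t where t: "\<And>b. b \<in> irrelevant_power t \<Longrightarrow> b * f \<in> I" by blast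
  have "b \<in> {b. b * f \<in> gen_ideal}" if "b \<in> irrelevant_power (j + t)" for b
  proof (rule irrelevant_power_add_induct[OF _ _ that])
    show "p + q \<in> {b. b * f \<in> gen_ideal}" if "p \<in> {b. b * f \<in> gen_ideal}" "q \<in> {b. b * f \<in> gen_ideal}" for p q
      using that by (simp add: distrib_right gen_ideal_add)
    show "a * b \<in> {b. b * f \<in> gen_ideal}" if "a \<in> irrelevant_power j" "b \<in> irrelevant_power t" for a b
      using irrelevant_I_gen_ideal[OF that(1) t[OF that(2)]] by (simp add: mult.assoc)
  qed
  then show "\<exists>t. \<forall>b\<in>irrelevant_power t. b * f \<in> gen_ideal" by blast
qed (use gen_ideal_subset_I in blast)

text \<open>Reading an element of the free module of rank one as its entry 0 turns
  \<open>H_0\<close> into \<open>S\<close> modulo the ideal of the generators, which has the same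
  saturation as \<open>I\<close>.\<close>

lemma graded_iso_homology_0:
  "graded_iso (quot_gmodule (homology res_degs res_map 0) (Gamma_B (homology res_degs res_map 0)))
    (quot_gmodule (coord_gmodule X) (Gamma_B (coord_gmodule X)))"
proof -
  define N where "N = {v :: nat \<Rightarrow> 'k bipoly. v 0 \<in> gen_ideal \<and> (\<forall>n\<ge>1. v n = 0)}"
  let ?F = "free_gmodule [(0, 0)] :: ('k bipoly, nat \<Rightarrow> 'k bipoly) gmodule"
  have "gquot ?F N"
  proof (intro gquot.intro gmod.intro module_free_gmodule gquot_axioms.intro)
    interpret F: gmod ?F by (rule gmod.intro[OF module_free_gmodule])
    have neg: "- f \<in> gen_ideal" if "f \<in> gen_ideal" for f
      using gen_ideal_mult[OF that, of "- 1"] by simp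
    show "submodule N S_ring ?F"
    proof (rule F.submoduleI)
      fix v :: "nat \<Rightarrow> 'k bipoly" assume v: "v \<in> N"
      then have "v \<in> carrier ?F" by (simp add: N_def)
      then have "\<ominus>\<^bsub>?F\<^esub> v = (\<lambda>n. (- 1) * v n)"
        using F.smult_minus_1[of v] by simp
      then show "\<ominus>\<^bsub>?F\<^esub> v \<in> N" using v by (simp add: N_def neg)
    qed (auto simp: N_def gen_ideal_add gen_ideal_mult)
  qed
  moreover have "gquot S_gmodule I" by (rule gquot_axioms)
  ultimately have "graded_iso (quot_gmodule (quot_gmodule ?F N) (Gamma_B (quot_gmodule ?F N)))
      (quot_gmodule Q (Gamma_B Q))"
  proof (rule graded_iso_mod_Gamma[where \<phi> = "\<lambda>v. v 0"])
    show "bij_betw (\<lambda>v. v 0) (carrier ?F) (carrier S_gmodule)"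
    proof (rule bij_betwI[where g = "\<lambda>f n. if n = 0 then f else 0"])
      show "(\<lambda>n. if n = 0 then v 0 else 0) = v" if "v \<in> carrier ?F" for v
        using that by (auto simp: fun_eq_iff Suc_le_eq)
    qed auto
    show "hcomp ?F d \<subseteq> carrier ?F \<and> (\<lambda>v. v 0) ` hcomp ?F d \<subseteq> hcomp S_gmodule d" for d
      by (auto simp: hcomp_free_gmodule simp flip: zero_prod_def)
    show "v \<in> gquot.sat ?F N \<longleftrightarrow> v 0 \<in> gquot.sat S_gmodule I" if "v \<in> carrier ?F" for v
      unfolding gquot.sat_def[OF \<open>gquot ?F N\<close>] gquot.sat_def[OF gquot_axioms]
      using that saturation_eq[of "v 0"] by (simp add: N_def)
  qed auto
  moreover have "homology res_degs res_map 0 = quot_gmodule ?F N"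
    using homology_0[of res_degs res_map] image_res_map_1 by (simp add: N_def)
  ultimately show ?thesis by (simp add: coord_gmodule_eq)
qed

lemma virtual_resolution_res: "virtual_resolution res_degs res_map (coord_gmodule X)"
  unfolding virtual_resolution_def
  using graded_module_coord fin_gen_coord free_complex_res graded_iso_homology_0 homology_res_killed
  by blast

lemma has_length_res: "has_length res_degs 2"
proof -
  have "rel_degs \<noteq> []" by (simp add: rel_degs_def)
  then show ?thesis by (auto simp: has_length_def res_degs_def)
qed

end

section \<open>From the Hilbert function to the resolution\<close>

lemma generic_virtual_resolution:
  fixes X :: "'k::field point set"
  assumes "finite X" and generic: "generic_hilbert_function X" and ij: "i < j"
    and N: "card X = (i + 1) * (j + 1)" and q: "card X = (i + 2) * q + r" and r: "r < i + 2"
  shows "\<exists>F \<delta>. virtual_resolution F \<delta> (coord_gmodule X) \<and> has_length F 2 \<and>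
    F 0 = [(0, 0)] \<and>
    F 1 = replicate (i + 1) (int i, int j + 1) @
          replicate (i + 2 - r) (int i + 1, int q) @
          replicate r (int i + 1, int q + 1) \<and>
    F 2 = replicate (2 * i + 2) (int i + 1, int j + 1)"
proof -
  obtain c :: "'k point \<Rightarrow> var \<Rightarrow> 'k" where c: "\<And>P. c P X0 \<noteq> 0 \<or> c P X1 \<noteq> 0" "\<And>P. c P Y0 \<noteq> 0 \<or> c P Y1 \<noteq> 0"
    "\<And>P. point_ideal (fst P) (snd P) = linear_ideal (c P)"
  proof -
    have "\<forall>P. \<exists>c. (c X0 \<noteq> 0 \<or> c X1 \<noteq> 0) \<and> (c Y0 \<noteq> 0 \<or> c Y1 \<noteq> 0) \<and>
        point_ideal (fst P) (snd P) = linear_ideal (c :: var \<Rightarrow> 'k)"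
      using point_coords by blast
    from choice[OF this] obtain f where "\<forall>P. (f P X0 \<noteq> 0 \<or> f P X1 \<noteq> 0) \<and> (f P Y0 \<noteq> 0 \<or> f P Y1 \<noteq> 0) \<and>
        point_ideal (fst P) (snd P) = linear_ideal (f P :: var \<Rightarrow> 'k)" ..
    then show ?thesis by (intro that[of f]) blast+
  qed
  interpret point_set X c
    by standard (use assms(1) c in \<open>auto elim: same_factor.cases\<close>)
  have dim: "fn.dim (eval_pts ` S_comp (int a, int b)) = min (card X) ((a + 1) * (b + 1))" for a b
    using generic by (simp add: generic_hilbert_function_def flip: hilbert_function_eq)
  have ind: "imposes_independent (int a, int b)" if "card X \<le> (a + 1) * (b + 1)" for a b
    by (rule imposes_independent_if_dim) (use dim that in simp)
  have triv: "van (int a, int b) = {0}" if "(a + 1) * (b + 1) \<le> card X" for a b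
    by (rule van_trivial_if_dim) (use dim that in simp)
  \<comment> \<open>|X| is at least (i+1)(i+2), hence larger than r; so \<open>q - 1\<close> below
    is a genuine predecessor.\<close>
  have q0: "q > 0"
  proof (rule ccontr)
    assume "\<not> q > 0"
    then have "(i + 1) * (j + 1) < i + 2" using N q r by simp
    moreover have "(i + 1) * (i + 2) \<le> (i + 1) * (j + 1)" using ij by (intro mult_le_mono) auto
    ultimately show False by simp
  qed
  \<comment> \<open>At (i, j) the number of points equals the dimension of the space of forms, so
    evaluation is bijective there.\<close>
  have ind_ij: "imposes_independent (int i, int j)" and triv_ij: "van (int i, int j) = {0}"
    by (rule ind, simp add: N) (rule triv, simp add: N)
  \<comment> \<open>Strip \<open>i\<close> is the case of remainder 0, with \<open>j + 1\<close> in
    place of \<open>q\<close>: all its basis elements have y-degree \<open>j + 1\<close>.\<close>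
  have "imposes_independent (int i, int (j + 1))" using ind_ij by (rule independent_mono_le) auto
  moreover have "van (int i, int (j + 1) - 1) = {0}" using triv_ij by simp
  moreover have "card X = (i + 1) * (j + 1) + 0" using N by simp
  ultimately obtain A where "strip_basis i (\<lambda>m. if m < i + 1 - 0 then int (j + 1) else int (j + 1) + 1) A"
    using van_free_basis by blast
  then have A: "strip_basis i (\<lambda>_. int j + 1) A"
    unfolding strip_basis_def by (simp add: add.commute)
  \<comment> \<open>From \<open>(i + 2) * q \<le> |X| < (i + 2) * (q + 1)\<close>: in x-degree
    \<open>i + 1\<close> the two bounds are the dimensions of the forms of y-degree
    \<open>q - 1\<close> and \<open>q\<close>.\<close>
  have "imposes_independent (int (i + 1), int q)"
    using q r by (intro ind) (simp add: algebra_simps)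
  moreover have "van (int (i + 1), int (q - 1)) = {0}"
    using q q0 by (intro triv) (simp add: algebra_simps)
  then have "van (int (i + 1), int q - 1) = {0}" using q0 by (simp add: of_nat_diff)
  moreover have "card X = (i + 1 + 1) * q + r" using q by simp
  ultimately obtain B where B': "strip_basis (i + 1) (\<lambda>m. if m < i + 1 + 1 - r then int q else int q + 1) B"
    using van_free_basis by blast
  define e where "e k = (if k < i + 2 - r then int q else int q + 1)" for k
  have B: "strip_basis (i + 1) e B" using B' unfolding e_def by simp
  \<comment> \<open>The products of \<open>x_0\<close> and \<open>x_1\<close> with the
    \<open>A_m\<close> in the row order of \<open>M\<close>; expanding them in \<open>B\<close>
    yields the rows.\<close>
  define src where "src m = (if m < i + 1 then Var X0 * A m else Var X1 * A (m - (i + 1)))" for m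
  have src: "src m \<in> van (int (i + 1), int j + 1)" if "m < 2 * i + 2" for m
  proof -
    have "A n \<in> van (int i, int j + 1)" if "n < i + 1" for n
      using A that unfolding strip_basis_def by blast
    then show ?thesis unfolding src_def using that by (auto intro!: van_Var_mult)
  qed
  have "\<exists>u. m < 2 * i + 2 \<longrightarrow> (\<forall>k<i+1+1. u k \<in> S_comp (0, int j + 1 - e k)) \<and> src m = (\<Sum>k<i+1+1. u k * B k)" for m
    using B src[of m] unfolding strip_basis_def by blast
  then have "\<exists>M. \<forall>m. m < 2 * i + 2 \<longrightarrow> (\<forall>k<i+1+1. M m k \<in> S_comp (0, int j + 1 - e k)) \<and>
      src m = (\<Sum>k<i+1+1. M m k * B k)"
    by (intro choice allI)
  then obtain M where M: "\<And>m k. m < 2 * i + 2 \<Longrightarrow> k < i + 2 \<Longrightarrow> M m k \<in> S_comp (0, int j + 1 - e k)"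
    "\<And>m. m < 2 * i + 2 \<Longrightarrow> src m = (\<Sum>k<i+2. M m k * B k)"
    by auto
  interpret strip_resolution X c i j e A B M
  proof unfold_locales
    show "imposes_independent (int i, int j)" by (rule ind_ij)
    show "0 \<le> e k" for k by (simp add: e_def)
    show "strip_basis i (\<lambda>_. int j + 1) A" "strip_basis (i + 1) e B" by (rule A, rule B)
    show "M m k \<in> S_comp (0, int j + 1 - e k)" if "m < 2 * i + 2" "k < i + 2" for m k
      using M(1)[OF that] .
    show "Var X0 * A m = (\<Sum>k<i+2. M m k * B k)" if "m < i + 1" for m
      using M(2)[of m] that by (simp add: src_def)
    show "Var X1 * A m = (\<Sum>k<i+2. M (i + 1 + m) k * B k)" if "m < i + 1" for m
      using M(2)[of "i + 1 + m"] that by (simp add: src_def)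
    show "i \<le> j" using ij by simp
  qed
  have "map gen_deg [0..<2*i+3] = replicate (i + 1) (int i, int j + 1) @
      replicate (i + 2 - r) (int i + 1, int q) @ replicate r (int i + 1, int q + 1)"
  proof (rule nth_equalityI)
    show "length (map gen_deg [0..<2*i+3]) = length (replicate (i + 1) (int i, int j + 1) @
      replicate (i + 2 - r) (int i + 1, int q) @ replicate r (int i + 1, int q + 1))"
      using r by simp
    fix k assume "k < length (map gen_deg [0..<2*i+3])"
    then have k: "k < 2 * i + 3" by simp
    then show "map gen_deg [0..<2*i+3] ! k = (replicate (i + 1) (int i, int j + 1) @
      replicate (i + 2 - r) (int i + 1, int q) @ replicate r (int i + 1, int q + 1)) ! k"
      using r by (auto simp: gen_deg_def e_def nth_append simp del: replicate.simps)
  qed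
  then show ?thesis
    using virtual_resolution_res has_length_res
    by (intro exI[of _ res_degs] exI[of _ res_map] conjI) (simp_all only: res_degs_def gen_degs_def rel_degs_def, simp_all)
qed

theorem theorem3p1:
  fixes X :: "'k::field_char_0 point set"
    and U :: "'k point list set"
    and i j :: nat
  assumes "gmr_open_set (card X) U"
    and "sufficiently_general U X"
    and "finite X"
    and "card X > 1"
    and "i < j"
    and "card X = (i + 1) * (j + 1)"
  shows "(\<exists>F \<delta>. virtual_resolution F \<delta> (coord_gmodule X) \<and> has_length F 2) \<and>
    (\<forall>q r. card X = (i + 2) * q + r \<and> r < i + 2 \<longrightarrow>
      (\<exists>F \<delta>. virtual_resolution F \<delta> (coord_gmodule X) \<and> has_length F 2 \<and>
        F 0 = [(0, 0)] \<and>
        F 1 = replicate (i + 1) (int i, int j + 1) @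
              replicate (i + 2 - r) (int i + 1, int q) @
              replicate r (int i + 1, int q + 1) \<and>
        F 2 = replicate (2 * i + 2) (int i + 1, int j + 1)))"
proof -
  have "generic_hilbert_function X"
    using assms(1,2) by (auto simp: gmr_open_set_def sufficiently_general_def)
  note res = generic_virtual_resolution[OF assms(3) this assms(5,6)]
  \<comment> \<open>The first claim follows from the explicit one as soon as some \<open>q\<close>
    and \<open>r\<close> are at hand.\<close>
  have "card X = (i + 2) * (card X div (i + 2)) + card X mod (i + 2)" "card X mod (i + 2) < i + 2"
    by (simp_all only: mult_div_mod_eq) simp
  from res[OF this] have "\<exists>F \<delta>. virtual_resolution F \<delta> (coord_gmodule X) \<and> has_length F 2"
    by blast
  then show ?thesis using res by blast
qed

end
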